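(* Let $\nu>0$, $T>0$, let $N\ge 1$ be an integer, and set $\Delta t=T/N$, $t^n=n\Delta t$. Let $\{(\tilde{\mathbf u}^{n+1},\mathbf u^{n+1},p^{n+1},q^{n+1})\}_{0\le n\le N-1}$ be a solution, starting from given initial data $(\mathbf u^0,p^0,q^0)$, of the first-order SAV pressure-correction scheme without external force ($\mathbf f=0$): for each $0\le n\le N-1$, $$\frac{\tilde{\mathbf u}^{n+1}-\mathbf u^{n}}{\Delta t}+\frac{q^{n+1}}{\exp(-t^{n+1}/T)}\,\mathbf u^{n}\cdot\nabla\mathbf u^{n}-\nu\Delta\tilde{\mathbf u}^{n+1}+\nabla p^{n}=0\ \text{ in }\Omega,\qquad \tilde{\mathbf u}^{n+1}|_{\partial\Omega}=0,$$ $$\frac{\mathbf u^{n+1}-\tilde{\mathbf u}^{n+1}}{\Delta t}+\nabla(p^{n+1}-p^n)=0\ \text{ in }\Omega,$$ $$\nabla\cdot\mathbf u^{n+1}=0\ \text{ in }\Omega,\qquad \mathbf u^{n+1}\cdot\mathbf n|_{\partial\Omega}=0,$$ $$\frac{q^{n+1}-q^n}{\Delta t}=-\frac1T q^{n+1}+\frac{1}{\exp(-t^{n+1}/T)}\big(\mathbf u^n\cdot\nabla\mathbf u^n,\tilde{\mathbf u}^{n+1}\big).$$ Define $$E^{n}=\|\mathbf u^{n}\|^2+|q^{n}|^2+(\Delta t)^2\|\nabla p^{n}\|^2 .$$ Then the scheme is unconditionally energy stable, in the sense that, with no restriction on $\Delta t$, $$E^{n+1}-E^{n}\le -2\nu\Delta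 t\,\|\nabla\tilde{\mathbf u}^{n+1}\|^2\qquad\text{for all } 0\le n\le N-1 .$$
   Context: $\Omega\subset\mathbb R^2$ is an open bounded domain with sufficiently smooth boundary $\partial\Omega$ and unit outward normal $\mathbf n$. $(\cdot,\cdot)$ and $\|\cdot\|$ denote the inner product and norm of $L^2(\Omega)$ (for scalar-, vector- or matrix-valued functions). $\mathbf u\cdot\nabla\mathbf v=(\mathbf u\cdot\nabla)\mathbf v$. The unknowns are vector fields $\tilde{\mathbf u}^{n+1},\mathbf u^{n+1}:\Omega\to\mathbb R^2$, a scalar function $p^{n+1}:\Omega\to\mathbb R$ and a real number $q^{n+1}$. There is no spatial discretization. The equations are understood for functions regular enough to make sense of them almost everywhere: $\tilde{\mathbf u}^{n}\in \mathbf H^2(\Omega)\cap\mathbf H^1_0(\Omega)$, $\mathbf u^n\in\mathbf H^2(\Omega)$, $p^n\in H^1(\Omega)$; the initial data satisfy $\mathbf u^0\in\mathbf H^2(\Omega)\cap\mathbf H^1_0(\Omega)$, $\nabla\cdot\mathbf u^0=0$, $p^0\in H^1(\Omega)$, $q^0\in\mathbb R$. *)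

theory Defs
  imports "HOL-Analysis.Analysis"
begin

section \<open>Planar domains with boundary of class C1\<close>

text \<open>
  Near the boundary point x, and in the Cartesian coordinates given by the orthonormal frame
  (e, d), the set \<open>\<Omega>\<close> is the strict epigraph of the C1 function g, whose derivative is g'.
  The frame is an arbitrary one, so no side of the boundary and no axis is preferred.
\<close>

definition C1_boundary_chart ::
  "(real^2) set \<Rightarrow> real^2 \<Rightarrow> real \<Rightarrow> real^2 \<Rightarrow> real^2 \<Rightarrow> (real \<Rightarrow> real) \<Rightarrow> (real \<Rightarrow> real) \<Rightarrow> bool"
  where "C1_boundary_chart \<Omega> x r e d g g' \<longleftrightarrow>
    r > 0 \<and> norm e = 1 \<and> norm d = 1 \<and> e \<bullet> d = 0 \<and>
    (\<forall>s. (g has_real_derivative g' s) (at s)) \<and> continuous_on UNIV g' \<and>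
    \<Omega> \<inter> ball x r = {y \<in> ball x r. g (y \<bullet> e) < y \<bullet> d}"

definition C1_boundary :: "(real^2) set \<Rightarrow> bool"
  where "C1_boundary \<Omega> \<longleftrightarrow> (\<forall>x\<in>frontier \<Omega>. \<exists>r e d g g'. C1_boundary_chart \<Omega> x r e d g g')"

text \<open>
  Outward normal: \<open>\<Omega>\<close> is locally \<open>{y. g (y \<bullet> e) - y \<bullet> d < 0}\<close>, and the normal is the normalised
  gradient of this defining function.
\<close>

definition outward_unit_normal :: "(real^2) set \<Rightarrow> real^2 \<Rightarrow> real^2 \<Rightarrow> bool"
  where "outward_unit_normal \<Omega> x \<n> \<longleftrightarrow>
    (\<exists>r e d g g'. C1_boundary_chart \<Omega> x r e d g g' \<and>
       \<n> = (1 / sqrt (1 + (g' (x \<bullet> e))\<^sup>2)) *\<^sub>R (g' (x \<bullet> e) *\<^sub>R e - d))"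


section \<open>The space L2\<close>

text \<open>
  Functions on \<open>\<Omega>\<close> are represented by total functions of which only the values on \<open>\<Omega>\<close>, up to
  null sets, matter. On \<open>real^2^2\<close> the norm and the inner product are those of Frobenius.
\<close>

definition L2 :: "(real^2) set \<Rightarrow> (real^2 \<Rightarrow> 'b::euclidean_space) set"
  where "L2 \<Omega> = {f. f \<in> borel_measurable (lebesgue_on \<Omega>) \<and>
    integrable (lebesgue_on \<Omega>) (\<lambda>x. (norm (f x))\<^sup>2)}"

definition L2_inner ::
  "(real^2) set \<Rightarrow> (real^2 \<Rightarrow> 'b::euclidean_space) \<Rightarrow> (real^2 \<Rightarrow> 'b) \<Rightarrow> real"
  where "L2_inner \<Omega> f g = (LINT x|lebesgue_on \<Omega>. f x \<bullet> g x)"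

definition L2_norm :: "(real^2) set \<Rightarrow> (real^2 \<Rightarrow> 'b::euclidean_space) \<Rightarrow> real"
  where "L2_norm \<Omega> f = sqrt (L2_inner \<Omega> f f)"


section \<open>Test functions and weak derivatives\<close>

definition partial :: "2 \<Rightarrow> (real^2 \<Rightarrow> 'b::euclidean_space) \<Rightarrow> real^2 \<Rightarrow> 'b"
  where "partial i f = (\<lambda>x. frechet_derivative f (at x) (axis i 1))"

primrec Ck :: "nat \<Rightarrow> (real^2 \<Rightarrow> 'b::euclidean_space) \<Rightarrow> bool"
  where
    "Ck 0 f \<longleftrightarrow> continuous_on UNIV f"
  | "Ck (Suc k) f \<longleftrightarrow> (\<forall>x. f differentiable (at x)) \<and> (\<forall>i. Ck k (partial i f))"

definition test_function :: "(real^2) set \<Rightarrow> (real^2 \<Rightarrow> 'b::euclidean_space) \<Rightarrow> bool"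
  where "test_function \<Omega> \<phi> \<longleftrightarrow>
    (\<forall>k. Ck k \<phi>) \<and> compact (closure {x. \<phi> x \<noteq> 0}) \<and> closure {x. \<phi> x \<noteq> 0} \<subseteq> \<Omega>"

definition locally_integrable :: "(real^2) set \<Rightarrow> (real^2 \<Rightarrow> 'b::euclidean_space) \<Rightarrow> bool"
  where "locally_integrable \<Omega> f \<longleftrightarrow>
    (\<forall>K. compact K \<and> K \<subseteq> \<Omega> \<longrightarrow> set_integrable lebesgue K f)"

definition has_weak_partial ::
  "(real^2) set \<Rightarrow> 2 \<Rightarrow> (real^2 \<Rightarrow> 'b::euclidean_space) \<Rightarrow> (real^2 \<Rightarrow> 'b) \<Rightarrow> bool"
  where "has_weak_partial \<Omega> i f g \<longleftrightarrow>
    locally_integrable \<Omega> f \<and> locally_integrable \<Omega> g \<and>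
    (\<forall>\<phi>::real^2 \<Rightarrow> real. test_function \<Omega> \<phi> \<longrightarrow>
       (LINT x|lebesgue_on \<Omega>. partial i \<phi> x *\<^sub>R f x) = - (LINT x|lebesgue_on \<Omega>. \<phi> x *\<^sub>R g x))"

text \<open>The weak partial derivative is unique up to null sets; some representative is chosen.\<close>

definition wpartial ::
  "(real^2) set \<Rightarrow> 2 \<Rightarrow> (real^2 \<Rightarrow> 'b::euclidean_space) \<Rightarrow> real^2 \<Rightarrow> 'b"
  where "wpartial \<Omega> i f = (SOME g. has_weak_partial \<Omega> i f g)"

definition grad :: "(real^2) set \<Rightarrow> (real^2 \<Rightarrow> real) \<Rightarrow> real^2 \<Rightarrow> real^2"
  where "grad \<Omega> p x = (\<chi> i. wpartial \<Omega> i p x)"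

definition vgrad :: "(real^2) set \<Rightarrow> (real^2 \<Rightarrow> real^2) \<Rightarrow> real^2 \<Rightarrow> real^2^2"
  where "vgrad \<Omega> u x = (\<chi> i j. wpartial \<Omega> j u x $ i)"

definition divergence :: "(real^2) set \<Rightarrow> (real^2 \<Rightarrow> real^2) \<Rightarrow> real^2 \<Rightarrow> real"
  where "divergence \<Omega> u x = (\<Sum>i\<in>UNIV. wpartial \<Omega> i u x $ i)"

definition laplacian :: "(real^2) set \<Rightarrow> (real^2 \<Rightarrow> real^2) \<Rightarrow> real^2 \<Rightarrow> real^2"
  where "laplacian \<Omega> u x = (\<Sum>i\<in>UNIV. wpartial \<Omega> i (wpartial \<Omega> i u) x)"

text \<open>The convective term \<open>(u \<cdot> \<nabla>) v\<close>.\<close>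

definition convect ::
  "(real^2) set \<Rightarrow> (real^2 \<Rightarrow> real^2) \<Rightarrow> (real^2 \<Rightarrow> real^2) \<Rightarrow> real^2 \<Rightarrow> real^2"
  where "convect \<Omega> u v x = (\<Sum>j\<in>UNIV. (u x $ j) *\<^sub>R wpartial \<Omega> j v x)"


section \<open>Sobolev spaces and boundary values\<close>

definition H1 :: "(real^2) set \<Rightarrow> (real^2 \<Rightarrow> 'b::euclidean_space) set"
  where "H1 \<Omega> = {f. f \<in> L2 \<Omega> \<and> (\<forall>i. (\<exists>g. has_weak_partial \<Omega> i f g) \<and> wpartial \<Omega> i f \<in> L2 \<Omega>)}"

definition H2 :: "(real^2) set \<Rightarrow> (real^2 \<Rightarrow> 'b::euclidean_space) set"
  where "H2 \<Omega> = {f. f \<in> H1 \<Omega> \<and> (\<forall>i. wpartial \<Omega> i f \<in> H1 \<Omega>)}"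

text \<open>The closure of the test functions in the norm of \<open>H1\<close>.\<close>

definition H10 :: "(real^2) set \<Rightarrow> (real^2 \<Rightarrow> 'b::euclidean_space) set"
  where "H10 \<Omega> = {f. f \<in> H1 \<Omega> \<and>
    (\<forall>\<epsilon>>0. \<exists>\<phi>. test_function \<Omega> \<phi> \<and>
       (L2_norm \<Omega> (\<lambda>x. f x - \<phi> x))\<^sup>2
         + (\<Sum>i\<in>UNIV. (L2_norm \<Omega> (\<lambda>x. wpartial \<Omega> i f x - partial i \<phi> x))\<^sup>2) < \<epsilon>)}"

text \<open>
  Boundary values of a function that is almost everywhere equal to a function continuous up to the
  boundary. Over a bounded planar domain with C1 boundary every function in \<open>H2\<close> is of this kind,
  by the Sobolev embedding, and its trace is the restriction of the continuous representative.
\<close>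

definition has_trace ::
  "(real^2) set \<Rightarrow> (real^2 \<Rightarrow> 'b::euclidean_space) \<Rightarrow> (real^2 \<Rightarrow> 'b) \<Rightarrow> bool"
  where "has_trace \<Omega> u b \<longleftrightarrow>
    (\<exists>v. continuous_on (closure \<Omega>) v \<and> (AE x in lebesgue_on \<Omega>. u x = v x) \<and>
         (\<forall>x\<in>frontier \<Omega>. b x = v x))"

end

theory Submission
  imports Defs
begin

text \<open>
  In each time step write \<open>w\<close> for the intermediate velocity, \<open>u\<close>, \<open>u'\<close> for the old and new
  velocities, and likewise \<open>p\<close>, \<open>p'\<close> and \<open>q\<close>, \<open>q'\<close>. Three identities are combined.

  The momentum equation tested with \<open>2 dt w\<close> gives
  \<open>\<parallel>w\<parallel>\<^sup>2 - \<parallel>u\<parallel>\<^sup>2 + \<parallel>w - u\<parallel>\<^sup>2 + 2 \<nu> dt \<parallel>\<nabla>w\<parallel>\<^sup>2 + 2 dt (\<nabla>p, w) + 2 dt c (u \<cdot> \<nabla>u, w) = 0\<close>,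
  where \<open>c = q' / exp (- t' / T)\<close> at the new time \<open>t'\<close>.
  The projection step says \<open>u' + dt \<nabla>p' = w + dt \<nabla>p\<close>. Since \<open>u'\<close> is solenoidal and tangential at
  the boundary, \<open>(\<nabla>p', u') = 0\<close>, and squaring yields
  \<open>\<parallel>u'\<parallel>\<^sup>2 + dt\<^sup>2 \<parallel>\<nabla>p'\<parallel>\<^sup>2 = \<parallel>w\<parallel>\<^sup>2 + 2 dt (\<nabla>p, w) + dt\<^sup>2 \<parallel>\<nabla>p\<parallel>\<^sup>2\<close>.
  The equation for \<open>q\<close> multiplied by \<open>2 dt q'\<close> contains exactly the term \<open>2 dt c (u \<cdot> \<nabla>u, w)\<close>. In the
  sum of the three, the pressure and convective cross terms cancel, and what remains besides the
  viscous dissipation is \<open>- \<parallel>w - u\<parallel>\<^sup>2 - (q' - q)\<^sup>2 - 2 (dt / T) q'\<^sup>2 \<le> 0\<close>.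

  The analytic content lies in two integrations by parts. The identity
  \<open>(\<Delta>w, w) = - \<parallel>\<nabla>w\<parallel>\<^sup>2\<close> (\<open>L2_inner_laplacian\<close>) follows from the density of test functions in
  \<open>H10\<close>. The orthogonality \<open>(\<nabla>p', u') = 0\<close> (\<open>gradient_orthogonal_to_solenoidal\<close>) has
  to be shown on a domain whose boundary is only C1, for a pressure that has only one weak
  derivative. Its proof avoids traces and boundary integrals. In a boundary chart, the extension
  of \<open>u'\<close> by zero remains weakly divergence free across the boundary
  (\<open>flux_vanishes_near_boundary\<close>); a mollification of it that is shifted into the domain is
  therefore solenoidal and, after localization, an admissible test function for the weak gradient
  of \<open>p'\<close> (\<open>chart_integration_by_parts\<close>). A partition of unity puts the local identities together.
  The necessary smooth functions and the uniqueness of weak derivatives are developed first.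
\<close>

section \<open>Calculus of functions of class Ck\<close>

lemma partial_has_derivative:
  "(f has_derivative f') (at x) \<Longrightarrow> partial i f x = f' (axis i 1)"
  unfolding partial_def by (simp add: frechet_derivative_at [symmetric])

lemma Ck_antimono: "Ck (Suc k) f \<Longrightarrow> Ck k f"
proof (induction k arbitrary: f)
  case 0
  then show ?case
    by (auto simp: differentiable_imp_continuous_within intro!: continuous_at_imp_continuous_on)
next
  case (Suc k)
  then show ?case by simp
qed

lemma Ck_le: "Ck m f \<Longrightarrow> k \<le> m \<Longrightarrow> Ck k f"
proof (induction m)
  case (Suc m)
  then show ?case by (metis Ck_antimono le_Suc_eq)
qed simp

lemma Ck_const: "Ck k (\<lambda>x. c)"
proof (induction k arbitrary: c)
  case (Suc k)
  have "partial i (\<lambda>x. c) = (\<lambda>x. 0)" for i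
    by (rule ext) (simp add: partial_has_derivative[OF has_derivative_const])
  with Suc show ?case by simp
qed simp

lemma Ck_has_derivative:
  "Ck (Suc k) f \<Longrightarrow> (f has_derivative frechet_derivative f (at x)) (at x)"
  using frechet_derivative_works[of f "at x"] by simp

lemma Ck_bounded_linear_comp:
  assumes L: "bounded_linear L" shows "Ck k f \<Longrightarrow> Ck k (\<lambda>x. L (f x))"
proof (induction k arbitrary: f)
  case 0
  then show ?case using linear_continuous_on_compose[OF _ bounded_linear.linear[OF L]] by auto
next
  case (Suc k)
  have d: "((\<lambda>x. L (f x)) has_derivative (\<lambda>h. L (frechet_derivative f (at x) h))) (at x)" for x
    by (rule bounded_linear.has_derivative[OF L Ck_has_derivative[OF Suc.prems]])
  have "partial i (\<lambda>x. L (f x)) = (\<lambda>x. L (partial i f x))" for i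
    by (rule ext) (simp add: partial_has_derivative[OF d], simp add: partial_def)
  with Suc d show ?case by (auto simp: differentiable_def)
qed

lemma Ck_bounded_linear:
  assumes L: "bounded_linear L" shows "Ck k L"
proof (cases k)
  case 0 with L show ?thesis by (simp add: linear_continuous_on)
next
  case (Suc m)
  have d: "(L has_derivative L) (at x)" for x by (rule bounded_linear_imp_has_derivative[OF L])
  have "partial i L = (\<lambda>x. L (axis i 1))" for i
    by (rule ext) (simp add: partial_has_derivative[OF d])
  with Suc d show ?thesis by (auto simp: differentiable_def Ck_const)
qed

lemma partial_add:
  assumes "f differentiable at x" "g differentiable at x"
  shows "partial i (\<lambda>x. f x + g x) x = partial i f x + partial i g x"
  using partial_has_derivative[OF has_derivative_add[OF assms[unfolded frechet_derivative_works]]]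
  by (simp add: partial_def)

lemma Ck_add: "Ck k f \<Longrightarrow> Ck k g \<Longrightarrow> Ck k (\<lambda>x. f x + g x)"
proof (induction k arbitrary: f g)
  case 0 then show ?case by (simp add: continuous_on_add)
next
  case (Suc k)
  have "partial i (\<lambda>x. f x + g x) = (\<lambda>x. partial i f x + partial i g x)" for i
    using Suc.prems by (intro ext partial_add) auto
  with Suc show ?case by auto
qed

lemma Ck_uminus: "Ck k f \<Longrightarrow> Ck k (\<lambda>x. - f x)"
  by (rule Ck_bounded_linear_comp[OF bounded_linear_minus[OF bounded_linear_ident]])

lemma Ck_diff: "Ck k f \<Longrightarrow> Ck k g \<Longrightarrow> Ck k (\<lambda>x. f x - g x)"
  using Ck_add[OF _ Ck_uminus, of k f g] by simp

lemma Ck_sum: "(\<And>j. j \<in> J \<Longrightarrow> Ck k (f j)) \<Longrightarrow> Ck k (\<lambda>x. \<Sum>j\<in>J. f j x)"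
  by (induction J rule: infinite_finite_induct) (auto intro: Ck_add Ck_const)

lemma partial_scaleR:
  assumes "f differentiable at x" "g differentiable at x"
  shows "partial i (\<lambda>x. f x *\<^sub>R g x) x = f x *\<^sub>R partial i g x + partial i f x *\<^sub>R g x"
  using partial_has_derivative[OF has_derivative_scaleR[OF assms[unfolded frechet_derivative_works]]]
  by (simp add: partial_def)

lemma Ck_scaleR: "Ck k f \<Longrightarrow> Ck k g \<Longrightarrow> Ck k (\<lambda>x. f x *\<^sub>R g x)"
proof (induction k arbitrary: f g)
  case 0 then show ?case by (simp add: continuous_on_scaleR)
next
  case (Suc k)
  have "partial i (\<lambda>x. f x *\<^sub>R g x) = (\<lambda>x. f x *\<^sub>R partial i g x + partial i f x *\<^sub>R g x)" for i
    using Suc.prems by (intro ext partial_scaleR) auto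
  moreover have "Ck k f" "Ck k g" using Suc.prems Ck_antimono by blast+
  ultimately show ?case using Suc by (auto intro: Ck_add)
qed

lemma Ck_mult: "Ck k f \<Longrightarrow> Ck k g \<Longrightarrow> Ck k (\<lambda>x. f x * g x :: real)"
  using Ck_scaleR[of k f g] by simp

lemma Ck_inverse:
  fixes f :: "real^2 \<Rightarrow> real"
  assumes nz: "\<And>x. f x \<noteq> 0"
  shows "Ck k f \<Longrightarrow> Ck k (\<lambda>x. inverse (f x))"
proof (induction k)
  case 0 then show ?case using nz by (simp add: continuous_on_inverse)
next
  case (Suc k)
  have d: "((\<lambda>x. inverse (f x)) has_derivative
      (\<lambda>h. - (inverse (f x) * frechet_derivative f (at x) h * inverse (f x)))) (at x)" for x
    by (rule Deriv.has_derivative_inverse[OF nz Ck_has_derivative[OF Suc.prems]])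
  have "partial i (\<lambda>x. inverse (f x)) = (\<lambda>x. - (inverse (f x) * partial i f x * inverse (f x)))" for i
    by (rule ext) (simp add: partial_has_derivative[OF d], simp add: partial_def)
  moreover have "Ck k (\<lambda>x. inverse (f x))" using Suc Ck_antimono by blast
  ultimately show ?case using Suc d
    by (auto simp: differentiable_def intro!: Ck_uminus Ck_mult)
qed

lemma partial_affine:
  assumes "\<forall>x. f differentiable at x"
  shows "partial i (\<lambda>x. f (a + c *\<^sub>R x)) = (\<lambda>x. c *\<^sub>R partial i f (a + c *\<^sub>R x))"
    and "(\<lambda>x. f (a + c *\<^sub>R x)) differentiable at x"
proof -
  have d: "((\<lambda>x. f (a + c *\<^sub>R x)) has_derivative
      (\<lambda>h. frechet_derivative f (at (a + c *\<^sub>R x)) (c *\<^sub>R h))) (at x)" for x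
    by (rule has_derivative_compose[where g = f and f = "\<lambda>x. a + c *\<^sub>R x"])
       (auto intro!: derivative_eq_intros assms[rule_format, unfolded frechet_derivative_works])
  show "(\<lambda>x. f (a + c *\<^sub>R x)) differentiable at x" using d by (auto simp: differentiable_def)
  have "linear (frechet_derivative f (at y))" for y
    using assms linear_frechet_derivative by blast
  then show "partial i (\<lambda>x. f (a + c *\<^sub>R x)) = (\<lambda>x. c *\<^sub>R partial i f (a + c *\<^sub>R x))"
    by (intro ext) (simp add: partial_has_derivative[OF d] linear_cmul, simp add: partial_def)
qed

lemma Ck_affine: "Ck k f \<Longrightarrow> Ck k (\<lambda>x. f (a + c *\<^sub>R x))"
proof (induction k arbitrary: f)
  case 0
  then show ?case
    by (auto intro!: continuous_on_compose2[of UNIV f] continuous_intros)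
next
  case (Suc k)
  then show ?case
    by (auto simp: partial_affine intro!: Ck_scaleR Ck_const)
qed

section \<open>A smooth flat function\<close>

text \<open>
  \<open>flat 0\<close> is the standard smooth function that is flat at the origin. The whole family is needed
  because it is closed under differentiation, which turns smoothness into an induction on the
  order of differentiability.
\<close>

definition flat :: "nat \<Rightarrow> real \<Rightarrow> real"
  where "flat n t = (if t > 0 then exp (- 1 / t) / t ^ n else 0)"

lemma flat_nonneg: "flat n t \<ge> 0" by (simp add: flat_def)
lemma flat_pos: "t > 0 \<Longrightarrow> flat n t > 0" by (simp add: flat_def)
lemma flat_eq_0: "t \<le> 0 \<Longrightarrow> flat n t = 0" by (simp add: flat_def)
lemma flat_0_le_1: "flat 0 t \<le> 1" by (simp add: flat_def)

text \<open>
  From \<open>(x / m)\<^sup>m \<le> (1 + x / m)\<^sup>m \<le> exp x\<close> at \<open>x = 1 / t\<close>, \<open>m = n + 1\<close>: the exponential beats the power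
  \<open>1 / t\<^sup>n\<close> with one factor \<open>t\<close> to spare, hence continuity at the origin.
\<close>

lemma flat_le: "flat n t \<le> real (Suc n) ^ Suc n * \<bar>t\<bar>"
proof (cases "t > 0")
  case True
  have "(1 / t / real (Suc n)) ^ Suc n \<le> (1 + 1 / t / real (Suc n)) ^ Suc n"
    using True by (intro power_mono) auto
  also have "\<dots> \<le> exp (1/t)"
    using True by (intro exp_ge_one_plus_x_over_n_power_n) (auto intro: order_trans[of _ 0])
  finally have "1 \<le> exp (1/t) * (real (Suc n) * t) ^ Suc n"
    using True by (simp add: power_divide power_mult_distrib field_simps del: power_Suc of_nat_Suc)
  then have "exp (- (1/t)) \<le> (real (Suc n) * t) ^ Suc n"
    by (simp add: exp_minus field_simps del: power_Suc of_nat_Suc)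
  then have "exp (- (1/t)) / t ^ n \<le> (real (Suc n) * t) ^ Suc n / t ^ n"
    using True by (intro divide_right_mono) auto
  also have "\<dots> = real (Suc n) ^ Suc n * t"
    using True by (simp add: power_mult_distrib del: of_nat_Suc)
  finally show ?thesis using True by (simp add: flat_def)
next
  case False
  then show ?thesis
    by (metis flat_eq_0 linorder_not_less abs_ge_zero mult_nonneg_nonneg of_nat_0_le_iff zero_le_power)
qed

lemma flat_tendsto_0: "(flat n \<longlongrightarrow> 0) (at 0)"
proof (rule tendsto_sandwich[where f = "\<lambda>t. 0"])
  show "((\<lambda>t. real (Suc n) ^ Suc n * \<bar>t\<bar>) \<longlongrightarrow> 0) (at (0::real))"
    by (intro tendsto_mult_right_zero tendsto_rabs_zero tendsto_ident_at)
  show "eventually (\<lambda>t. 0 \<le> flat n t) (at 0)"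
    by (intro always_eventually allI flat_nonneg)
  show "eventually (\<lambda>t. flat n t \<le> real (Suc n) ^ Suc n * \<bar>t\<bar>) (at 0)"
    by (intro always_eventually allI flat_le)
qed (rule tendsto_const)

text \<open>
  At the origin the difference quotient of \<open>flat n\<close> is exactly \<open>flat (n + 1)\<close>, which tends to 0.
\<close>

lemma flat_has_derivative:
  "(flat n has_real_derivative (flat (n+2) t - n * flat (n+1) t)) (at t)"
proof -
  consider "t > 0" | "t < 0" | "t = 0" by linarith
  then show ?thesis
  proof cases
    case 1
    have "((\<lambda>t. exp (- 1 / t) / t ^ n) has_real_derivative (flat (n+2) t - n * flat (n+1) t)) (at t)"
    proof -
      have "((\<lambda>t. t ^ n) has_real_derivative real n * t ^ n / t) (at t)"
        using 1 DERIV_pow[of n t] by (cases n) simp_all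
      moreover have "((\<lambda>t. exp (- 1 / t)) has_real_derivative exp (- 1 / t) / (t * t)) (at t)"
        using 1 by (auto intro!: derivative_eq_intros)
      ultimately have "((\<lambda>t. exp (- 1 / t) / t ^ n) has_real_derivative
          (exp (- 1 / t) / (t * t) * t ^ n - exp (- 1 / t) * (real n * t ^ n / t)) / (t ^ n * t ^ n)) (at t)"
        using 1 by (intro DERIV_divide) auto
      then show ?thesis
        by (rule DERIV_cong)
           (use 1 in \<open>auto simp: flat_def field_simps\<close>)
    qed
    then show ?thesis
      by (rule has_field_derivative_transform_within_open[where S = "{0<..}"])
         (use 1 in \<open>auto simp: flat_def\<close>)
  next
    case 2
    have "((\<lambda>t. 0) has_real_derivative (flat (n+2) t - n * flat (n+1) t)) (at t)"
      using 2 by (auto simp: flat_def)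
    then show ?thesis
      by (rule has_field_derivative_transform_within_open[where S = "{..<0}"])
         (use 2 in \<open>auto simp: flat_def\<close>)
  next
    case 3
    have "(flat n (0 + h) - flat n 0) / h = flat (Suc n) h" for h
      by (simp add: flat_def)
    with flat_tendsto_0[of "Suc n"] 3 show ?thesis by (simp add: DERIV_def flat_eq_0)
  qed
qed

lemma partial_flat:
  assumes "s differentiable at x"
  shows "partial i (\<lambda>x. flat n (s x)) x = (flat (n+2) (s x) - n * flat (n+1) (s x)) * partial i s x"
    and "(\<lambda>x. flat n (s x)) differentiable at x"
proof -
  have d: "((\<lambda>x. flat n (s x)) has_derivative
      (\<lambda>h. (flat (n+2) (s x) - n * flat (n+1) (s x)) * frechet_derivative s (at x) h)) (at x)"
    using has_derivative_compose[OF assms[unfolded frechet_derivative_works]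
        flat_has_derivative[of n "s x", unfolded has_field_derivative_def]] .
  then show "(\<lambda>x. flat n (s x)) differentiable at x" by (auto simp: differentiable_def)
  show "partial i (\<lambda>x. flat n (s x)) x = (flat (n+2) (s x) - n * flat (n+1) (s x)) * partial i s x"
    by (simp only: partial_has_derivative[OF d], simp add: partial_def)
qed

lemma continuous_flat: "continuous_on S (flat n)"
  by (intro continuous_at_imp_continuous_on ballI DERIV_isCont[OF flat_has_derivative])

text \<open>
  Composition with \<open>flat\<close> is the only chain rule for higher derivatives that the construction of
  cut-off functions requires; all of them are built from it by products and quotients.
\<close>

lemma Ck_flat: "Ck k s \<Longrightarrow> Ck k (\<lambda>x. flat n (s x))"
proof (induction k arbitrary: n)
  case 0
  then show ?case using continuous_on_compose2[OF continuous_flat[of UNIV]] by auto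
next
  case (Suc k)
  then have "partial i (\<lambda>x. flat n (s x)) =
      (\<lambda>x. (flat (n+2) (s x) - n * flat (n+1) (s x)) * partial i s x)" for i
    by (intro ext partial_flat) auto
  moreover have "Ck k s" using Suc.prems by (rule Ck_antimono)
  ultimately show ?case using Suc
    by (auto intro!: Ck_mult Ck_diff Ck_const partial_flat)
qed

section \<open>Test functions and uniqueness of weak derivatives\<close>

lemma Ck_prod:
  fixes f :: "'i \<Rightarrow> real^2 \<Rightarrow> real"
  shows "(\<And>j. j \<in> J \<Longrightarrow> Ck k (f j)) \<Longrightarrow> Ck k (\<lambda>x. \<Prod>j\<in>J. f j x)"
  by (induction J rule: infinite_finite_induct) (simp_all add: Ck_const Ck_mult)

lemma Ck_component: "Ck k (\<lambda>x::real^2. x $ i)"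
  by (rule Ck_bounded_linear[OF bounded_linear_vec_nth])

lemma continuous_Ck: "Ck k f \<Longrightarrow> continuous_on UNIV f"
  using Ck_le[of k f 0] by simp

lemma partial_eq_0_outside:
  assumes "closed C" "\<And>x. x \<notin> C \<Longrightarrow> f x = 0" "x \<notin> C"
  shows "partial i f x = 0"
proof -
  have "(f has_derivative (\<lambda>h. 0)) (at x)"
    by (rule has_derivative_transform_within_open[of "\<lambda>x. 0" _ _ _ "- C"])
       (use assms in auto)
  then show ?thesis by (simp add: partial_has_derivative)
qed

lemma integrable_compact_support:
  fixes f :: "'a::euclidean_space \<Rightarrow> 'b::euclidean_space"
  assumes "continuous_on UNIV f" "compact C" "\<And>x. x \<notin> C \<Longrightarrow> f x = 0"
  shows "integrable lborel f"
proof -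
  have "integrable lborel (\<lambda>x. indicator C x *\<^sub>R f x)"
    by (intro borel_integrable_compact assms(2) continuous_on_subset[OF assms(1)]) simp
  moreover have "(\<lambda>x. indicator C x *\<^sub>R f x) = f"
    using assms(3) by (auto simp: indicator_def)
  ultimately show ?thesis by simp
qed

lemma borel_measurable_lebesgue_on:
  fixes f :: "'a::euclidean_space \<Rightarrow> 'b::topological_space"
  assumes "f \<in> borel_measurable borel"
  shows "f \<in> borel_measurable (lebesgue_on \<Omega>)"
  using assms by (intro measurable_restrict_space1 measurable_completion) simp

lemma integrable_bounded_mult:
  fixes f g :: "'a \<Rightarrow> real"
  assumes "integrable M f" "g \<in> borel_measurable M" "\<And>x. \<bar>g x\<bar> \<le> B"
  shows "integrable M (\<lambda>x. f x * g x)"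
proof (rule Bochner_Integration.integrable_bound[where f = "\<lambda>x. B * f x"])
  show "integrable M (\<lambda>x. B * f x)" using assms(1) by simp
  show "(\<lambda>x. f x * g x) \<in> borel_measurable M" using assms by simp
  show "AE x in M. norm (f x * g x) \<le> norm (B * f x)"
  proof (intro always_eventually allI)
    fix x
    have "\<bar>f x\<bar> * \<bar>g x\<bar> \<le> \<bar>f x\<bar> * \<bar>B\<bar>" using assms(3)[of x] by (intro mult_left_mono) auto
    then show "norm (f x * g x) \<le> norm (B * f x)" by (simp add: abs_mult mult.commute)
  qed
qed

lemma bounded_compact_support:
  fixes f :: "'a::euclidean_space \<Rightarrow> 'b::euclidean_space"
  assumes "continuous_on UNIV f" "compact C" "\<And>x. x \<notin> C \<Longrightarrow> f x = 0"
  obtains M where "M > 0" "\<And>x. norm (f x) \<le> M"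
proof -
  have "bounded (f ` C)"
    using assms continuous_on_subset compact_continuous_image compact_imp_bounded by blast
  then obtain M where "M > 0" "\<And>x. x \<in> C \<Longrightarrow> norm (f x) \<le> M"
    by (auto simp: bounded_pos)
  then show ?thesis using assms(3) that[of M] by (metis less_eq_real_def norm_zero)
qed

lemma test_functionI:
  assumes "\<And>k. Ck k f" "compact C" "C \<subseteq> \<Omega>" "\<And>x. x \<notin> C \<Longrightarrow> f x = 0"
  shows "test_function \<Omega> f"
proof -
  have "closure {x. f x \<noteq> 0} \<subseteq> C"
    using assms by (intro closure_minimal compact_imp_closed) auto
  moreover have "bounded C" using assms(2) by (rule compact_imp_bounded)
  ultimately show ?thesis using assms
    by (auto simp: test_function_def compact_eq_bounded_closed intro: bounded_subset)
qed

lemma test_functionE: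
  assumes "test_function \<Omega> f"
  obtains C where "\<And>k. Ck k f" "compact C" "C \<subseteq> \<Omega>" "\<And>x. x \<notin> C \<Longrightarrow> f x = 0"
    "\<And>x i. x \<notin> C \<Longrightarrow> partial i f x = 0"
proof (rule that[of "closure {x. f x \<noteq> 0}"])
  show "x \<notin> closure {x. f x \<noteq> 0} \<Longrightarrow> f x = 0" for x
    using closure_subset[of "{x. f x \<noteq> 0}"] by blast
  then show "x \<notin> closure {x. f x \<noteq> 0} \<Longrightarrow> partial i f x = 0" for x i
    by (rule partial_eq_0_outside[OF closed_closure])
qed (use assms in \<open>auto simp: test_function_def\<close>)

lemma integrable_times_locally_integrable:
  fixes f :: "real^2 \<Rightarrow> 'b::euclidean_space" and \<psi> :: "real^2 \<Rightarrow> real"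
  assumes "open \<Omega>" "locally_integrable \<Omega> f"
    and \<psi>: "continuous_on UNIV \<psi>" "compact C" "C \<subseteq> \<Omega>" "\<And>x. x \<notin> C \<Longrightarrow> \<psi> x = 0"
  shows "integrable (lebesgue_on \<Omega>) (\<lambda>x. \<psi> x *\<^sub>R f x)"
proof -
  obtain M where M: "M > 0" "\<And>x. norm (\<psi> x) \<le> M"
    using bounded_compact_support[OF \<psi>(1,2,4)] by blast
  have i: "integrable lebesgue (\<lambda>x. indicator C x *\<^sub>R f x)"
    using assms by (auto simp: locally_integrable_def set_integrable_def)
  have m: "\<psi> \<in> borel_measurable lebesgue"
    using \<psi>(1) by (intro measurable_completion) (simp add: borel_measurable_continuous_onI)
  have "integrable lebesgue (\<lambda>x. \<psi> x *\<^sub>R (indicator C x *\<^sub>R f x))"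
  proof (rule Bochner_Integration.integrable_bound[where f = "\<lambda>x. M *\<^sub>R (indicator C x *\<^sub>R f x)"])
    show "integrable lebesgue (\<lambda>x. M *\<^sub>R (indicator C x *\<^sub>R f x))" using i by (rule integrable_scaleR_right)
    show "(\<lambda>x. \<psi> x *\<^sub>R (indicator C x *\<^sub>R f x)) \<in> borel_measurable lebesgue"
      using m borel_measurable_integrable[OF i] by (rule borel_measurable_scaleR)
    show "AE x in lebesgue. norm (\<psi> x *\<^sub>R (indicator C x *\<^sub>R f x)) \<le> norm (M *\<^sub>R (indicator C x *\<^sub>R f x))"
      using M by (auto intro!: mult_right_mono always_eventually simp del: scaleR_scaleR)
  qed
  moreover have "(\<lambda>x. \<psi> x *\<^sub>R (indicator C x *\<^sub>R f x)) = (\<lambda>x. indicator \<Omega> x *\<^sub>R (\<psi> x *\<^sub>R f x))"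
    using \<psi>(3,4) by (fastforce simp: indicator_def)
  ultimately show ?thesis using assms(1)
    by (simp add: integrable_restrict_space borel_open lborelD)
qed

lemma flat_0_tendsto_1: "(flat 0 \<longlongrightarrow> 1) at_top"
proof -
  have "((\<lambda>t::real. exp (- inverse t)) \<longlongrightarrow> exp (- 0)) at_top"
    by (intro tendsto_intros tendsto_inverse_0_at_top filterlim_ident)
  moreover have "eventually (\<lambda>t. exp (- inverse t) = flat 0 t) at_top"
    using eventually_gt_at_top[of 0] by eventually_elim (simp add: flat_def divide_inverse)
  ultimately show ?thesis by (simp add: Lim_transform_eventually)
qed

text \<open>
  A product of one-sided factors \<open>flat 0 (n s)\<close>, which tend to 1 for \<open>s > 0\<close> and vanish for \<open>s \<le> 0\<close>.
\<close>

lemma box_indicator_limit: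
  fixes a b :: "real^2"
  obtains \<phi> :: "nat \<Rightarrow> real^2 \<Rightarrow> real"
  where "\<And>n k. Ck k (\<phi> n)" "\<And>n x. 0 \<le> \<phi> n x \<and> \<phi> n x \<le> 1"
    "\<And>n x. x \<notin> box a b \<Longrightarrow> \<phi> n x = 0"
    "\<And>x. (\<lambda>n. \<phi> n x) \<longlonglongrightarrow> indicator (box a b) x"
proof -
  define \<phi> where "\<phi> n x = (\<Prod>i\<in>UNIV. flat 0 (real n * (x $ i - a $ i)) * flat 0 (real n * (b $ i - x $ i)))"
    for n and x :: "real^2"
  have lim: "(\<lambda>n. flat 0 (real n * s)) \<longlonglongrightarrow> 1" if "s > 0" for s
    by (rule filterlim_compose[OF flat_0_tendsto_1])
       (use filterlim_at_top_mult_tendsto_pos[OF tendsto_const that filterlim_real_sequentially] in simp)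
  show ?thesis
  proof (rule that[of \<phi>])
    show "Ck k (\<phi> n)" for n k
      unfolding \<phi>_def
      by (intro Ck_prod Ck_mult Ck_flat Ck_const Ck_diff Ck_component)
    show "0 \<le> \<phi> n x \<and> \<phi> n x \<le> 1" for n x
      unfolding \<phi>_def
      by (auto intro!: prod_nonneg prod_le_1 mult_le_one simp: flat_nonneg flat_0_le_1)
    show out: "\<phi> n x = 0" if nb: "x \<notin> box a b" for n x
    proof -
      obtain i where "x $ i - a $ i \<le> 0 \<or> b $ i - x $ i \<le> 0"
        using nb unfolding mem_box_cart by (meson diff_le_0_iff_le not_less)
      then have "flat 0 (real n * (x $ i - a $ i)) * flat 0 (real n * (b $ i - x $ i)) = 0"
        by (auto simp: flat_eq_0 mult_nonneg_nonpos)
      then show ?thesis unfolding \<phi>_def by (intro prod_zero) auto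
    qed
    show "(\<lambda>n. \<phi> n x) \<longlonglongrightarrow> indicator (box a b) x" for x
    proof (cases "x \<in> box a b")
      case True
      then have "(\<lambda>n. \<phi> n x) \<longlonglongrightarrow> (\<Prod>i\<in>(UNIV::2 set). 1 * 1)"
        unfolding \<phi>_def
        by (intro tendsto_prod tendsto_mult lim) (auto simp: mem_box_cart)
      with True show ?thesis by simp
    qed (simp add: out)
  qed
qed

text \<open>
  Dominated convergence along smooth approximations of the indicator of the box.
\<close>

lemma cbox_integral_eq_0_if_test_integrals_eq_0:
  fixes g :: "real^2 \<Rightarrow> 'b::euclidean_space"
  assumes "open \<Omega>" "locally_integrable \<Omega> g"
    and 0: "\<And>\<phi>::real^2 \<Rightarrow> real. test_function \<Omega> \<phi> \<Longrightarrow> (LINT x|lebesgue_on \<Omega>. \<phi> x *\<^sub>R g x) = 0"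
    and ab: "cbox a b \<subseteq> \<Omega>"
  shows "integral (cbox a b) g = 0"
proof -
  obtain \<phi> :: "nat \<Rightarrow> real^2 \<Rightarrow> real" where \<phi>: "\<And>n k. Ck k (\<phi> n)" "\<And>n x. 0 \<le> \<phi> n x \<and> \<phi> n x \<le> 1"
    "\<And>n x. x \<notin> box a b \<Longrightarrow> \<phi> n x = 0" "\<And>x. (\<lambda>n. \<phi> n x) \<longlonglongrightarrow> indicator (box a b) x"
    using box_indicator_limit by blast
  have out: "x \<notin> cbox a b \<Longrightarrow> \<phi> n x = 0" for n x
    using \<phi>(3) box_subset_cbox by blast
  define G where "G x = indicator (cbox a b) x *\<^sub>R g x" for x
  have si: "set_integrable lebesgue (cbox a b) g"
    using assms by (auto simp: locally_integrable_def)
  then have G: "integrable lebesgue G" by (simp add: set_integrable_def G_def[abs_def])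
  have "(LINT x|lebesgue. \<phi> n x *\<^sub>R G x) = 0" for n
  proof -
    have "test_function \<Omega> (\<phi> n)" by (rule test_functionI[OF \<phi>(1) compact_cbox ab out])
    then have "(LINT x|lebesgue_on \<Omega>. \<phi> n x *\<^sub>R g x) = 0" by (rule 0)
    moreover have "(\<lambda>x. indicator \<Omega> x *\<^sub>R \<phi> n x *\<^sub>R g x) = (\<lambda>x. \<phi> n x *\<^sub>R G x)"
      using out ab by (fastforce simp: G_def indicator_def)
    ultimately show ?thesis
      using assms(1) by (simp add: integral_restrict_space borel_open lborelD)
  qed
  moreover have "(\<lambda>n. LINT x|lebesgue. \<phi> n x *\<^sub>R G x) \<longlonglongrightarrow> (LINT x|lebesgue. indicator (box a b) x *\<^sub>R G x)"
  proof (rule integral_dominated_convergence[where w = "\<lambda>x. norm (G x)"])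
    show "(\<lambda>x. \<phi> n x *\<^sub>R G x) \<in> borel_measurable lebesgue" for n
    proof (rule borel_measurable_scaleR)
      show "\<phi> n \<in> borel_measurable lebesgue"
        using continuous_Ck[OF \<phi>(1)] by (intro measurable_completion) (simp add: borel_measurable_continuous_onI)
    qed (use G in auto)
    show "(\<lambda>x. indicator (box a b) x *\<^sub>R G x) \<in> borel_measurable lebesgue"
      using G by (intro borel_measurable_scaleR borel_measurable_indicator) auto
    show "AE x in lebesgue. norm (\<phi> n x *\<^sub>R G x) \<le> norm (G x)" for n
      using \<phi>(2) by (auto intro!: mult_left_le_one_le always_eventually)
    show "AE x in lebesgue. (\<lambda>n. \<phi> n x *\<^sub>R G x) \<longlonglongrightarrow> indicator (box a b) x *\<^sub>R G x"
      by (intro always_eventually allI tendsto_intros \<phi>)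
  qed (use G in auto)
  ultimately have "(LINT x|lebesgue. indicator (box a b) x *\<^sub>R G x) = 0"
    by (simp add: LIMSEQ_const_iff)
  moreover have "(\<lambda>x. indicator (box a b) x *\<^sub>R G x) = (\<lambda>x. indicator (box a b) x *\<^sub>R g x)"
    using box_subset_cbox by (fastforce simp: G_def indicator_def)
  moreover have "set_integrable lebesgue (box a b) g"
    using set_integrable_subset[OF si _ box_subset_cbox] by simp
  ultimately have "integral (box a b) g = 0"
    using set_lebesgue_integral_eq_integral(2)[of "box a b" g] by (simp add: set_lebesgue_integral_def)
  then show ?thesis by (simp add: integral_open_interval)
qed

text \<open>
  The fundamental lemma of the calculus of variations. All integrals of \<open>g\<close> over boxes inside \<open>\<Omega>\<close>
  vanish, and almost every value of \<open>g\<close> is a limit of averages over small cubes.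
\<close>

lemma AE_eq_0_if_test_integrals_eq_0:
  fixes g :: "real^2 \<Rightarrow> 'b::euclidean_space"
  assumes "open \<Omega>" "locally_integrable \<Omega> g"
    and 0: "\<And>\<phi>::real^2 \<Rightarrow> real. test_function \<Omega> \<phi> \<Longrightarrow> (LINT x|lebesgue_on \<Omega>. \<phi> x *\<^sub>R g x) = 0"
  shows "AE x in lebesgue_on \<Omega>. g x = 0"
proof -
  have *: "negligible {x \<in> cbox a b. g x \<noteq> 0}" if ab: "cbox a b \<subseteq> \<Omega>" for a b
  proof -
    define G where "G x = (if x \<in> cbox a b then g x else 0)" for x
    have "set_integrable lebesgue (cbox a b) g"
      using assms ab by (auto simp: locally_integrable_def)
    then have "g integrable_on cbox a b" by (rule set_lebesgue_integral_eq_integral)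
    then have "G integrable_on UNIV"
      unfolding G_def by (simp add: integrable_restrict_UNIV)
    then have "G integrable_on cbox c d" for c d by (rule integrable_on_subcbox) simp
    then obtain N where N: "negligible N"
      "\<And>x e. \<lbrakk>x \<notin> N; 0 < e\<rbrakk> \<Longrightarrow> \<exists>d>0. \<forall>h. 0 < h \<and> h < d \<longrightarrow>
         norm (integral (cbox x (x + h *\<^sub>R One)) G /\<^sub>R h ^ DIM(real^2) - G x) < e"
      using integrable_ccontinuous_explicit[of G] by blast
    have "g x = 0" if x: "x \<in> box a b" "x \<notin> N" for x
    proof (rule ccontr)
      assume "g x \<noteq> 0"
      then obtain d where d: "d > 0" "\<And>h. 0 < h \<and> h < d \<Longrightarrow>
         norm (integral (cbox x (x + h *\<^sub>R One)) G /\<^sub>R h ^ DIM(real^2) - G x) < norm (g x)"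
        using N(2)[OF x(2), of "norm (g x)"] by auto
      obtain r where r: "r > 0" "ball x r \<subseteq> box a b"
        using x(1) open_box openE by blast
      define h where "h = min d (r / (norm (One::real^2) + 1)) / 2"
      have n1: "norm (One::real^2) + 1 > 0" by (simp add: add_nonneg_pos)
      then have h: "0 < h" "h < d" using d(1) r(1) by (auto simp: h_def min_less_iff_disj)
      have "h * norm (One::real^2) < r"
      proof -
        have "h \<le> r / (norm (One::real^2) + 1) / 2" unfolding h_def by (intro divide_right_mono min.cobounded2) simp
        then have "h * (norm (One::real^2) + 1) \<le> r / 2"
          using n1 by (simp add: field_simps)
        then have "h * norm (One::real^2) + h \<le> r / 2" by (simp add: algebra_simps)
        then show ?thesis using h r(1) by linarith
      qed
      then have "x + h *\<^sub>R One \<in> ball x r" using h by (simp add: dist_norm)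
      then have xh: "x + h *\<^sub>R One \<in> box a b" using r by blast
      have "cbox x (x + h *\<^sub>R One) \<subseteq> box a b"
      proof
        fix y assume y: "y \<in> cbox x (x + h *\<^sub>R One)"
        show "y \<in> box a b" unfolding mem_box
        proof
          fix i :: "real^2" assume "i \<in> Basis"
          with x(1) xh y have "a \<bullet> i < x \<bullet> i" "(x + h *\<^sub>R One) \<bullet> i < b \<bullet> i"
            "x \<bullet> i \<le> y \<bullet> i" "y \<bullet> i \<le> (x + h *\<^sub>R One) \<bullet> i" unfolding mem_box by blast+
          then show "a \<bullet> i < y \<bullet> i \<and> y \<bullet> i < b \<bullet> i" by linarith
        qed
      qed
      then have sub: "cbox x (x + h *\<^sub>R One) \<subseteq> cbox a b" using box_subset_cbox by blast
      have "integral (cbox x (x + h *\<^sub>R One)) G = integral (cbox x (x + h *\<^sub>R One)) g"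
        using sub by (intro integral_cong) (auto simp: G_def)
      also have "\<dots> = 0"
        using sub ab by (intro cbox_integral_eq_0_if_test_integrals_eq_0[OF assms]) auto
      finally have "norm (G x) < norm (g x)" using d(2)[of h] h by simp
      then show False using x(1) box_subset_cbox[of a b] by (simp add: G_def subset_iff)
    qed
    then have "{x \<in> cbox a b. g x \<noteq> 0} \<subseteq> N \<union> (cbox a b - box a b)" by blast
    then show ?thesis
      by (rule negligible_subset[rotated]) (intro negligible_Un N negligible_frontier_interval)
  qed
  obtain \<D> where \<D>: "countable \<D>" "\<D> \<subseteq> Pow \<Omega>" "\<And>X. X \<in> \<D> \<Longrightarrow> \<exists>a b. X = cbox a b" "\<Union>\<D> = \<Omega>"
    using open_countable_Union_open_cbox[OF assms(1)] by metis
  have "negligible (\<Union>X\<in>\<D>. {x \<in> X. g x \<noteq> 0})"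
  proof (rule negligible_countable_Union)
    show "countable ((\<lambda>X. {x \<in> X. g x \<noteq> 0}) ` \<D>)" using \<D>(1) by (rule countable_image)
    fix S assume "S \<in> (\<lambda>X. {x \<in> X. g x \<noteq> 0}) ` \<D>"
    then obtain X where X: "X \<in> \<D>" "S = {x \<in> X. g x \<noteq> 0}" by blast
    then obtain a b where "X = cbox a b" using \<D>(3) by blast
    with X \<D>(2) show "negligible S" using *[of a b] by blast
  qed
  then have "negligible {x \<in> \<Omega>. g x \<noteq> 0}"
    by (rule negligible_subset) (use \<D>(4) in auto)
  then have "AE x in lebesgue. \<not> (x \<in> \<Omega> \<and> g x \<noteq> 0)"
    by (intro AE_I'[where N = "{x \<in> \<Omega>. g x \<noteq> 0}"]) (auto simp: negligible_iff_null_sets)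
  then have "AE x in lebesgue. x \<in> \<Omega> \<longrightarrow> g x = 0" by simp
  then show ?thesis using assms(1) by (simp add: AE_restrict_space_iff borel_open lborelD)
qed

lemma locally_integrable_diff:
  "locally_integrable \<Omega> f \<Longrightarrow> locally_integrable \<Omega> g \<Longrightarrow> locally_integrable \<Omega> (\<lambda>x. f x - g x)"
  by (auto simp: locally_integrable_def intro: set_integral_diff)

lemma has_weak_partial_diff:
  assumes "open \<Omega>" "has_weak_partial \<Omega> i f g" "has_weak_partial \<Omega> i f' g'"
  shows "has_weak_partial \<Omega> i (\<lambda>x. f x - f' x) (\<lambda>x. g x - g' x)"
  unfolding has_weak_partial_def
proof (intro conjI allI impI)
  note a = assms[unfolded has_weak_partial_def]
  show "locally_integrable \<Omega> (\<lambda>x. f x - f' x)" "locally_integrable \<Omega> (\<lambda>x. g x - g' x)"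
    using a by (auto intro: locally_integrable_diff)
  fix \<phi> :: "real^2 \<Rightarrow> real" assume t: "test_function \<Omega> \<phi>"
  obtain C where C: "\<And>k. Ck k \<phi>" "compact C" "C \<subseteq> \<Omega>" "\<And>x. x \<notin> C \<Longrightarrow> \<phi> x = 0"
    "\<And>x i. x \<notin> C \<Longrightarrow> partial i \<phi> x = 0" using test_functionE[OF t] by blast
  have c: "continuous_on UNIV \<phi>" "continuous_on UNIV (partial i \<phi>)"
    using C(1)[of 0] C(1)[of 1] by auto
  have I: "integrable (lebesgue_on \<Omega>) (\<lambda>x. \<phi> x *\<^sub>R h x)"
    "integrable (lebesgue_on \<Omega>) (\<lambda>x. partial i \<phi> x *\<^sub>R h x)"
    if "locally_integrable \<Omega> h" for h :: "real^2 \<Rightarrow> 'a"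
    by (rule integrable_times_locally_integrable[OF assms(1) that c(1) C(2,3,4)], assumption)
       (rule integrable_times_locally_integrable[OF assms(1) that c(2) C(2,3,5)], assumption)
  have li: "locally_integrable \<Omega> f" "locally_integrable \<Omega> f'"
    "locally_integrable \<Omega> g" "locally_integrable \<Omega> g'" using a by blast+
  have "(LINT x|lebesgue_on \<Omega>. partial i \<phi> x *\<^sub>R (f x - f' x)) =
      (LINT x|lebesgue_on \<Omega>. partial i \<phi> x *\<^sub>R f x) - (LINT x|lebesgue_on \<Omega>. partial i \<phi> x *\<^sub>R f' x)"
    unfolding scaleR_diff_right by (rule Bochner_Integration.integral_diff[OF I(2)[OF li(1)] I(2)[OF li(2)]])
  also have "\<dots> = - (LINT x|lebesgue_on \<Omega>. \<phi> x *\<^sub>R g x) - - (LINT x|lebesgue_on \<Omega>. \<phi> x *\<^sub>R g' x)"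
    using a t by (intro arg_cong2[where f = "(-)"]) blast+
  also have "\<dots> = - (LINT x|lebesgue_on \<Omega>. \<phi> x *\<^sub>R (g x - g' x))"
    unfolding scaleR_diff_right Bochner_Integration.integral_diff[OF I(1)[OF li(3)] I(1)[OF li(4)]] by simp
  finally show "(LINT x|lebesgue_on \<Omega>. partial i \<phi> x *\<^sub>R (f x - f' x)) =
      - (LINT x|lebesgue_on \<Omega>. \<phi> x *\<^sub>R (g x - g' x))" .
qed

lemma has_weak_partial_unique:
  assumes "open \<Omega>" "has_weak_partial \<Omega> i f g" "has_weak_partial \<Omega> i f g'"
  shows "AE x in lebesgue_on \<Omega>. g x = g' x"
proof -
  have "has_weak_partial \<Omega> i (\<lambda>x. f x - f x) (\<lambda>x. g x - g' x)"
    by (rule has_weak_partial_diff[OF assms])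
  then have "AE x in lebesgue_on \<Omega>. g x - g' x = 0"
    by (intro AE_eq_0_if_test_integrals_eq_0[OF assms(1)]) (auto simp: has_weak_partial_def)
  then show ?thesis by simp
qed

lemma has_weak_partial_wpartial:
  "f \<in> H1 \<Omega> \<Longrightarrow> has_weak_partial \<Omega> i f (wpartial \<Omega> i f)"
  unfolding H1_def wpartial_def using someI_ex[of "has_weak_partial \<Omega> i f"] by simp

text \<open>
  The operator \<open>grad\<close> selects an unspecified weak derivative of each function, so its linearity is
  available only almost everywhere, by uniqueness of weak derivatives.
\<close>

lemma grad_diff:
  assumes "open \<Omega>" "f \<in> H1 \<Omega>" "g \<in> H1 \<Omega>"
  shows "AE x in lebesgue_on \<Omega>. grad \<Omega> (\<lambda>y. f y - g y) x = grad \<Omega> f x - grad \<Omega> g x"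
proof -
  have "AE x in lebesgue_on \<Omega>. wpartial \<Omega> i (\<lambda>y. f y - g y) x = wpartial \<Omega> i f x - wpartial \<Omega> i g x" for i
  proof -
    have *: "has_weak_partial \<Omega> i (\<lambda>y. f y - g y) (\<lambda>x. wpartial \<Omega> i f x - wpartial \<Omega> i g x)"
      by (intro has_weak_partial_diff has_weak_partial_wpartial assms)
    then have "has_weak_partial \<Omega> i (\<lambda>y. f y - g y) (wpartial \<Omega> i (\<lambda>y. f y - g y))"
      using someI_ex[of "has_weak_partial \<Omega> i (\<lambda>y. f y - g y)"]
      unfolding wpartial_def[of \<Omega> i "\<lambda>y. f y - g y"] by blast
    from has_weak_partial_unique[OF assms(1) this *] show ?thesis .
  qed
  then have "AE x in lebesgue_on \<Omega>. \<forall>i\<in>UNIV. wpartial \<Omega> i (\<lambda>y. f y - g y) x = wpartial \<Omega> i f x - wpartial \<Omega> i g x"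
    by (intro AE_finite_allI) auto
  then show ?thesis by eventually_elim (simp add: grad_def vec_eq_iff)
qed

section \<open>Convolution and mollifiers\<close>

definition conv :: "(real^2 \<Rightarrow> real) \<Rightarrow> (real^2 \<Rightarrow> 'b::euclidean_space) \<Rightarrow> real^2 \<Rightarrow> 'b"
  where "conv K U x = (LINT y|lborel. K (x - y) *\<^sub>R U y)"

lemma frechet_derivative_eq_partial_sum:
  assumes "f differentiable at x"
  shows "frechet_derivative f (at x) h = (\<Sum>i\<in>UNIV. (h $ i) *\<^sub>R partial i f x)"
proof -
  interpret linear "frechet_derivative f (at x)" by (rule linear_frechet_derivative[OF assms])
  have "frechet_derivative f (at x) h = frechet_derivative f (at x) (\<Sum>i\<in>UNIV. (h $ i) *\<^sub>R axis i 1)"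
    using basis_expansion[of h] by (simp add: scalar_mult_eq_scaleR)
  also have "\<dots> = (\<Sum>i\<in>UNIV. (h $ i) *\<^sub>R partial i f x)"
    by (simp add: sum scale partial_def)
  finally show ?thesis .
qed

lemma uniformly_continuous_compact_support:
  fixes f :: "'a::euclidean_space \<Rightarrow> 'b::euclidean_space"
  assumes f: "continuous_on UNIV f" "compact C" "\<And>x. x \<notin> C \<Longrightarrow> f x = 0" and "e > 0"
  obtains d where "d > 0" "\<And>x y. dist x y < d \<Longrightarrow> dist (f x) (f y) < e"
proof -
  obtain R where R: "\<And>x. x \<in> C \<Longrightarrow> norm x \<le> R"
    using compact_imp_bounded[OF f(2)] by (auto simp: bounded_iff)
  have "uniformly_continuous_on (cball 0 (R + 1)) f"
    using f(1) by (intro compact_uniformly_continuous) (auto intro: continuous_on_subset)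
  then obtain d where d: "d > 0"
    "\<And>x y. x \<in> cball 0 (R+1) \<Longrightarrow> y \<in> cball 0 (R+1) \<Longrightarrow> dist x y < d \<Longrightarrow> dist (f x) (f y) < e"
    unfolding uniformly_continuous_on_def using \<open>e > 0\<close> by (metis dist_commute)
  have "dist (f x) (f y) < e" if "dist x y < min d 1" for x y
  proof (cases "norm x \<le> R + 1 \<and> norm y \<le> R + 1")
    case True with d that show ?thesis by simp
  next
    case False
    have "\<bar>norm x - norm y\<bar> < 1" using that norm_triangle_ineq3[of x y] by (simp add: dist_norm)
    with False have "norm x > R" "norm y > R" by linarith+
    then have "f x = 0" "f y = 0" using R f(3) by (meson not_less)+
    with \<open>e > 0\<close> show ?thesis by simp
  qed
  with d(1) that[of "min d 1"] show ?thesis by simp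
qed

text \<open>
  The remainder of the first-order expansion is small uniformly in the base point, since the
  partial derivatives are uniformly continuous. This allows differentiation under the integral
  sign in a convolution with an arbitrary integrable function.
\<close>

lemma uniform_linearization:
  fixes f :: "real^2 \<Rightarrow> 'b::euclidean_space"
  assumes f: "Ck 1 f" "compact C" "\<And>x. x \<notin> C \<Longrightarrow> f x = 0" and "e > 0"
  obtains d where "d > 0"
    "\<And>z h. norm h < d \<Longrightarrow> norm (f (z + h) - f z - (\<Sum>i\<in>UNIV. (h $ i) *\<^sub>R partial i f z)) \<le> e * norm h"
proof -
  have c: "continuous_on UNIV (partial i f)" for i using f(1) by simp
  have o: "x \<notin> C \<Longrightarrow> partial i f x = 0" for x i
    using partial_eq_0_outside[OF compact_imp_closed[OF f(2)] f(3)] .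
  have "\<exists>d>0. \<forall>x y. dist x y < d \<longrightarrow> dist (partial i f x) (partial i f y) < e / 2" for i
  proof -
    have "e / 2 > 0" using \<open>e > 0\<close> by simp
    from uniformly_continuous_compact_support[OF c f(2) o this, of i] show ?thesis by metis
  qed
  then obtain d where d: "\<And>i. d i > 0"
    "\<And>i x y. dist x y < d i \<Longrightarrow> dist (partial i f x) (partial i f y) < e / 2" by metis
  define \<delta> where "\<delta> = Min (range d)"
  have \<delta>: "\<delta> > 0" "\<And>i. \<delta> \<le> d i" using d(1) by (auto simp: \<delta>_def)
  have df: "(f has_derivative (\<lambda>h. \<Sum>i\<in>UNIV. (h $ i) *\<^sub>R partial i f x)) (at x within S)" for x S
  proof -
    have "f differentiable at x" using f(1) by simp
    then have "(f has_derivative frechet_derivative f (at x)) (at x)" by (simp add: frechet_derivative_works)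
    then have "(f has_derivative (\<lambda>h. \<Sum>i\<in>UNIV. (h $ i) *\<^sub>R partial i f x)) (at x)"
      using frechet_derivative_eq_partial_sum[OF \<open>f differentiable at x\<close>, abs_def] by simp
    then show ?thesis by (rule has_derivative_at_withinI)
  qed
  have "norm (f (z + h) - f z - (\<Sum>i\<in>UNIV. (h $ i) *\<^sub>R partial i f z)) \<le> e * norm h"
    if h: "norm h < \<delta>" for z h
  proof -
    have "norm (f (z + h) - f z - (\<lambda>h. \<Sum>i\<in>UNIV. (h $ i) *\<^sub>R partial i f z) (z + h - z)) \<le> norm (z + h - z) * e"
    proof (rule differentiable_bound_linearization[where S = "ball z \<delta>" and ?x0.0 = z
          and f' = "\<lambda>x h. \<Sum>i\<in>UNIV. (h $ i) *\<^sub>R partial i f x"])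
      fix t :: real assume t: "t \<in> {0..1}"
      have "norm (t *\<^sub>R h) \<le> norm h" using t by (simp add: mult_left_le_one_le)
      with h show "z + t *\<^sub>R (z + h - z) \<in> ball z \<delta>" by (simp add: dist_norm)
    next
      fix x assume x: "x \<in> ball z \<delta>"
      show "onorm ((\<lambda>h. \<Sum>i\<in>UNIV. (h $ i) *\<^sub>R partial i f x) - (\<lambda>h. \<Sum>i\<in>UNIV. (h $ i) *\<^sub>R partial i f z)) \<le> e"
      proof (rule onorm_le)
        fix k :: "real^2"
        have "norm (((\<lambda>h. \<Sum>i\<in>UNIV. (h $ i) *\<^sub>R partial i f x) - (\<lambda>h. \<Sum>i\<in>UNIV. (h $ i) *\<^sub>R partial i f z)) k)
            = norm (\<Sum>i\<in>UNIV. (k $ i) *\<^sub>R (partial i f x - partial i f z))"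
          by (simp add: scaleR_diff_right sum_subtractf)
        also have "\<dots> \<le> (\<Sum>i\<in>(UNIV::2 set). norm k * (e / 2))"
        proof (rule sum_norm_le)
          fix i
          have "dist x z < d i" using x \<delta>(2)[of i] by (simp add: dist_commute)
          then have "norm (partial i f x - partial i f z) \<le> e / 2"
            using d(2)[of x z i] by (simp add: dist_norm)
          then show "norm ((k $ i) *\<^sub>R (partial i f x - partial i f z)) \<le> norm k * (e / 2)"
            using component_le_norm_cart[of k i] by (simp only: norm_scaleR) (intro mult_mono; simp)
        qed
        also have "\<dots> = e * norm k" by (simp add: sum_2)
        finally show "norm (((\<lambda>h. \<Sum>i\<in>UNIV. (h $ i) *\<^sub>R partial i f x) - (\<lambda>h. \<Sum>i\<in>UNIV. (h $ i) *\<^sub>R partial i f z)) k) \<le> e * norm k" .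
      qed
    qed (use \<delta> df in auto)
    then show ?thesis by (simp add: mult.commute)
  qed
  with \<delta>(1) that show ?thesis by blast
qed

lemma reflect_lborel: "distr lborel borel (\<lambda>y. x - y) = (lborel :: (real^2) measure)"
proof -
  have "lborel = density (distr lborel borel (\<lambda>y. x - y)) (\<lambda>_. 1)"
    using lborel_affine[of "-1" x] by simp
  then show ?thesis by (simp add: density_1)
qed

lemma integral_reflect:
  fixes f :: "real^2 \<Rightarrow> 'b::euclidean_space"
  assumes "f \<in> borel_measurable borel"
  shows "(LINT y|lborel. f (x - y)) = integral\<^sup>L lborel f"
  using integral_distr[of "\<lambda>y. x - y" lborel borel f] assms by (simp add: reflect_lborel)

lemma integrable_reflect:
  fixes f :: "real^2 \<Rightarrow> 'b::euclidean_space"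
  assumes "integrable lborel f"
  shows "integrable lborel (\<lambda>y. f (x - y))"
  using integrable_distr[of "\<lambda>y. x - y" lborel borel f] assms by (simp add: reflect_lborel)

lemma integrable_conv:
  fixes K :: "real^2 \<Rightarrow> real" and U :: "real^2 \<Rightarrow> 'b::euclidean_space"
  assumes K: "continuous_on UNIV K" "compact C" "\<And>z. z \<notin> C \<Longrightarrow> K z = 0" and U: "integrable lborel U"
  shows "integrable lborel (\<lambda>y. K (x - y) *\<^sub>R U y)"
proof -
  obtain M where M: "M > 0" "\<And>z. norm (K z) \<le> M"
    using bounded_compact_support[OF K] by blast
  have m: "(\<lambda>y. K (x - y)) \<in> borel_measurable borel"
    by (intro borel_measurable_continuous_onI continuous_on_compose2[OF K(1)] continuous_intros) simp
  show ?thesis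
  proof (rule Bochner_Integration.integrable_bound[where f = "\<lambda>y. M *\<^sub>R U y"])
    show "integrable lborel (\<lambda>y. M *\<^sub>R U y)" using U by (rule integrable_scaleR_right)
    show "(\<lambda>y. K (x - y) *\<^sub>R U y) \<in> borel_measurable lborel"
      by (rule borel_measurable_scaleR) (use m U in auto)
    show "AE y in lborel. norm (K (x - y) *\<^sub>R U y) \<le> norm (M *\<^sub>R U y)"
      using M by (intro always_eventually allI) (simp add: mult_right_mono)
  qed
qed

lemma conv_commute:
  fixes K U :: "real^2 \<Rightarrow> real"
  assumes "K \<in> borel_measurable borel" "U \<in> borel_measurable borel"
  shows "conv K U = conv U K"
proof
  fix x
  have "(\<lambda>y. K y * U (x - y)) \<in> borel_measurable borel"
    using assms by measurable
  from integral_reflect[OF this, of x] show "conv K U x = conv U K x"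
    by (simp add: conv_def mult.commute)
qed

lemma continuous_conv:
  fixes K :: "real^2 \<Rightarrow> real" and U :: "real^2 \<Rightarrow> 'b::euclidean_space"
  assumes K: "continuous_on UNIV K" "compact C" "\<And>z. z \<notin> C \<Longrightarrow> K z = 0" and U: "integrable lborel U"
  shows "continuous_on UNIV (conv K U)"
  unfolding continuous_on_iff
proof (intro ballI allI impI)
  fix x :: "real^2" and e :: real assume "e > 0"
  define I where "I = (LINT y|lborel. norm (U y))"
  have I: "I \<ge> 0" by (simp add: I_def)
  then have "e / (I + 1) > 0" using \<open>e > 0\<close> by simp
  from uniformly_continuous_compact_support[OF K this]
  obtain d where d: "d > 0" "\<And>x y. dist x y < d \<Longrightarrow> dist (K x) (K y) < e / (I + 1)" by metis
  have "dist (conv K U x') (conv K U x) < e" if x': "dist x' x < d" for x'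
  proof -
    have "conv K U x' - conv K U x = (LINT y|lborel. (K (x' - y) - K (x - y)) *\<^sub>R U y)"
      unfolding conv_def scaleR_diff_left
      by (rule Bochner_Integration.integral_diff[symmetric]; rule integrable_conv[OF K U])
    also have "norm \<dots> \<le> (LINT y|lborel. e / (I + 1) * norm (U y))"
    proof (rule Bochner_Integration.integral_norm_bound_integral)
      show "integrable lborel (\<lambda>y. (K (x' - y) - K (x - y)) *\<^sub>R U y)"
        unfolding scaleR_diff_left by (intro Bochner_Integration.integrable_diff integrable_conv[OF K U])
      show "integrable lborel (\<lambda>y. e / (I + 1) * norm (U y))"
        using U by (intro integrable_mult_right integrable_norm)
      show "norm ((K (x' - y) - K (x - y)) *\<^sub>R U y) \<le> e / (I + 1) * norm (U y)" for y
      proof -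
        have "dist (x' - y) (x - y) < d" using x' by (simp add: dist_norm)
        then have "\<bar>K (x' - y) - K (x - y)\<bar> \<le> e / (I + 1)" using d(2) by (fastforce simp: dist_real_def)
        then show ?thesis by (simp only: norm_scaleR real_norm_def) (intro mult_right_mono; simp)
      qed
    qed
    also have "\<dots> = e / (I + 1) * I" by (simp add: I_def)
    also have "\<dots> < e" using I \<open>e > 0\<close> by (simp add: field_simps)
    finally show ?thesis by (simp add: dist_norm)
  qed
  with d(1) show "\<exists>d>0. \<forall>x'\<in>UNIV. dist x' x < d \<longrightarrow> dist (conv K U x') (conv K U x) < e" by blast
qed

lemma conv_has_derivative:
  fixes K :: "real^2 \<Rightarrow> real" and U :: "real^2 \<Rightarrow> 'b::euclidean_space"
  assumes K: "Ck 1 K" "compact C" "\<And>z. z \<notin> C \<Longrightarrow> K z = 0" and U: "integrable lborel U"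
  shows "(conv K U has_derivative (\<lambda>h. \<Sum>i\<in>UNIV. (h $ i) *\<^sub>R conv (partial i K) U x)) (at x)"
  unfolding has_derivative_at_alt
proof (intro conjI allI impI)
  show "bounded_linear (\<lambda>h. \<Sum>i\<in>UNIV. (h $ i) *\<^sub>R conv (partial i K) U x)"
    by (intro bounded_linear_sum bounded_linear_scaleR_const bounded_linear_vec_nth)
  fix e :: real assume "e > 0"
  define I where "I = (LINT y|lborel. norm (U y))"
  have I: "I \<ge> 0" by (simp add: I_def)
  then have e': "e / (I + 1) > 0" using \<open>e > 0\<close> by simp
  obtain d where d: "d > 0" "\<And>z h. norm h < d \<Longrightarrow>
      norm (K (z + h) - K z - (\<Sum>i\<in>UNIV. (h $ i) *\<^sub>R partial i K z)) \<le> e / (I + 1) * norm h"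
    using uniform_linearization[OF K e'] by blast
  have cK: "continuous_on UNIV K" using continuous_Ck[OF K(1)] .
  have cp: "continuous_on UNIV (partial i K)" for i using K(1) by simp
  have o: "z \<notin> C \<Longrightarrow> partial i K z = 0" for z i
    using partial_eq_0_outside[OF compact_imp_closed[OF K(2)] K(3)] .
  note i0 = integrable_conv[OF cK K(2,3) U] and i1 = integrable_conv[OF cp K(2) o U]
  have "norm (conv K U y - conv K U x - (\<Sum>i\<in>UNIV. ((y - x) $ i) *\<^sub>R conv (partial i K) U x)) \<le> e * norm (y - x)"
    if y: "norm (y - x) < d" for y
  proof -
    define h where "h = y - x"
    let ?L = "\<lambda>w. \<Sum>i\<in>UNIV. (h $ i) *\<^sub>R (partial i K (x - w) *\<^sub>R U w)"
    have iL: "integrable lborel ?L" by (intro Bochner_Integration.integrable_sum integrable_scaleR_right i1)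
    have iA: "integrable lborel (\<lambda>w. K (y - w) *\<^sub>R U w - K (x - w) *\<^sub>R U w - ?L w)"
      by (intro Bochner_Integration.integrable_diff i0 iL)
    have "conv K U y - conv K U x - (\<Sum>i\<in>UNIV. (h $ i) *\<^sub>R conv (partial i K) U x)
        = (LINT w|lborel. K (y - w) *\<^sub>R U w - K (x - w) *\<^sub>R U w - ?L w)"
    proof -
      have "(LINT w|lborel. ?L w) = (\<Sum>i\<in>UNIV. (h $ i) *\<^sub>R conv (partial i K) U x)"
        unfolding conv_def using i1
        by (simp add: Bochner_Integration.integral_sum del: scaleR_scaleR)
      moreover have "(LINT w|lborel. K (y - w) *\<^sub>R U w - K (x - w) *\<^sub>R U w) = conv K U y - conv K U x"
        unfolding conv_def by (rule Bochner_Integration.integral_diff[OF i0 i0])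
      moreover have "(LINT w|lborel. K (y - w) *\<^sub>R U w - K (x - w) *\<^sub>R U w - ?L w)
          = (LINT w|lborel. K (y - w) *\<^sub>R U w - K (x - w) *\<^sub>R U w) - (LINT w|lborel. ?L w)"
        by (rule Bochner_Integration.integral_diff[OF Bochner_Integration.integrable_diff[OF i0 i0] iL])
      ultimately show ?thesis by argo
    qed
    also have "norm \<dots> \<le> (LINT w|lborel. e / (I + 1) * norm h * norm (U w))"
    proof (rule Bochner_Integration.integral_norm_bound_integral[OF iA])
      show "integrable lborel (\<lambda>w. e / (I + 1) * norm h * norm (U w))"
        using U by (intro integrable_mult_right integrable_norm)
      fix w
      have "K (y - w) *\<^sub>R U w - K (x - w) *\<^sub>R U w - ?L w
          = (K (x - w + h) - K (x - w) - (\<Sum>i\<in>UNIV. (h $ i) *\<^sub>R partial i K (x - w))) *\<^sub>R U w"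
        by (simp add: h_def scaleR_diff_left scaleR_sum_left algebra_simps)
      also have "norm \<dots> \<le> e / (I + 1) * norm h * norm (U w)"
        unfolding norm_scaleR real_norm_def using d(2)[of h "x - w"] y
        by (intro mult_right_mono) (simp_all add: h_def)
      finally show "norm (K (y - w) *\<^sub>R U w - K (x - w) *\<^sub>R U w - ?L w) \<le> e / (I + 1) * norm h * norm (U w)" .
    qed
    also have "\<dots> = e * norm h * (I / (I + 1))" by (simp add: I_def)
    also have "\<dots> \<le> e * norm h" using I \<open>e > 0\<close> by (intro mult_left_le) auto
    finally show ?thesis by (simp add: h_def)
  qed
  with d(1) show "\<exists>d>0. \<forall>y. norm (y - x) < d \<longrightarrow>
      norm (conv K U y - conv K U x - (\<Sum>i\<in>UNIV. ((y - x) $ i) *\<^sub>R conv (partial i K) U x)) \<le> e * norm (y - x)"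
    by blast
qed

lemma partial_conv:
  fixes K :: "real^2 \<Rightarrow> real" and U :: "real^2 \<Rightarrow> 'b::euclidean_space"
  assumes K: "Ck 1 K" "compact C" "\<And>z. z \<notin> C \<Longrightarrow> K z = 0" and U: "integrable lborel U"
  shows "partial i (conv K U) = conv (partial i K) U"
proof
  fix x
  have "partial i (conv K U) x = (\<Sum>j\<in>UNIV. (axis i 1 $ j) *\<^sub>R conv (partial j K) U x)"
    by (rule partial_has_derivative[OF conv_has_derivative[OF K U]])
  also have "\<dots> = (\<Sum>j\<in>UNIV. if j = i then conv (partial j K) U x else 0)"
    by (intro sum.cong) (auto simp: axis_def)
  finally show "partial i (conv K U) x = conv (partial i K) U x" by simp
qed

lemma Ck_conv:
  fixes K :: "real^2 \<Rightarrow> real" and U :: "real^2 \<Rightarrow> 'b::euclidean_space"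
  assumes C: "compact C" and U: "integrable lborel U"
  shows "Ck k K \<Longrightarrow> (\<And>z. z \<notin> C \<Longrightarrow> K z = 0) \<Longrightarrow> Ck k (conv K U)"
proof (induction k arbitrary: K)
  case 0
  then show ?case using continuous_conv[OF _ C _ U, of K] by simp
next
  case (Suc k)
  have K1: "Ck 1 K" using Ck_le[OF Suc.prems(1), of 1] by simp
  have "conv K U differentiable at x" for x
    using conv_has_derivative[OF K1 C Suc.prems(2) U] unfolding differentiable_def by blast
  moreover have "Ck k (partial i (conv K U))" for i
  proof -
    have "Ck k (conv (partial i K) U)"
    proof (rule Suc.IH)
      show "Ck k (partial i K)" using Suc.prems(1) by simp
      show "z \<notin> C \<Longrightarrow> partial i K z = 0" for z
        using partial_eq_0_outside[OF compact_imp_closed[OF C] Suc.prems(2)] .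
    qed
    moreover have "partial i (conv K U) = conv (partial i K) U" by (rule partial_conv[OF K1 C Suc.prems(2) U])
    ultimately show ?thesis by simp
  qed
  ultimately show ?case by simp
qed

text \<open>
  Convolving \<open>f\<close> with the indicator of a large ball gives a function that is constant near the
  origin; its derivative there is the integral of the derivative of \<open>f\<close>.
\<close>

lemma integral_partial_eq_0:
  fixes f :: "real^2 \<Rightarrow> real"
  assumes f: "Ck 1 f" "compact C" "\<And>x. x \<notin> C \<Longrightarrow> f x = 0"
  shows "(LINT x|lborel. partial i f x) = 0"
proof -
  obtain R where R: "\<And>x. x \<in> C \<Longrightarrow> norm x \<le> R"
    using compact_imp_bounded[OF f(2)] by (auto simp: bounded_iff)
  define U :: "real^2 \<Rightarrow> real" where "U = indicator (cball 0 (R + 1))"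
  have U: "integrable lborel U"
    unfolding U_def by (intro integrable_real_indicator emeasure_bounded_finite) auto
  have eq: "g (x - y) *\<^sub>R U y = g (x - y)" if "norm x < 1" "\<And>z. z \<notin> C \<Longrightarrow> g z = 0"
    for g :: "real^2 \<Rightarrow> real" and x y
  proof (cases "x - y \<in> C")
    case True
    then have "norm y \<le> R + 1" using R[of "x - y"] that(1) norm_triangle_ineq2[of y x]
      by (simp add: norm_minus_commute)
    then show ?thesis by (simp add: U_def)
  qed (simp add: that)
  have c: "continuous_on UNIV f" "continuous_on UNIV (partial i f)"
    using f(1) continuous_Ck[OF f(1)] by simp_all
  have o: "x \<notin> C \<Longrightarrow> partial i f x = 0" for x
    using partial_eq_0_outside[OF compact_imp_closed[OF f(2)] f(3)] .
  have cf: "conv g U x = integral\<^sup>L lborel g"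
    if "norm x < 1" "\<And>z. z \<notin> C \<Longrightarrow> g z = 0" "continuous_on UNIV g" for g x
  proof -
    have "(\<lambda>y. g (x - y) *\<^sub>R U y) = (\<lambda>y. g (x - y))"
      using eq[OF that(1), of g] that(2) by blast
    then show ?thesis
      using integral_reflect[of g x] that(3) by (simp only: conv_def borel_measurable_continuous_onI)
  qed
  have "(conv f U has_derivative (\<lambda>h. 0)) (at 0)"
  proof (rule has_derivative_transform_within_open[of "\<lambda>x. integral\<^sup>L lborel f" _ _ _ "ball 0 1"])
    show "integral\<^sup>L lborel f = conv f U x" if "x \<in> ball 0 1" for x
      using cf[of x f] that f(3) c(1) by simp
  qed auto
  then have "partial i (conv f U) 0 = 0" by (simp add: partial_has_derivative)
  moreover have "partial i (conv f U) = conv (partial i f) U" by (rule partial_conv[OF f U])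
  ultimately have "conv (partial i f) U 0 = 0" by simp
  then show ?thesis using cf[of 0 "partial i f"] o c(2) by simp
qed

text \<open>
  The centre \<open>c\<close> is arbitrary because the mollifiers used at the boundary must also shift the
  support of a field into the domain; the precise support makes the same functions usable as bumps in a
  partition of unity.
\<close>

lemma mollifier_exists:
  fixes c :: "real^2"
  assumes "\<epsilon> > 0"
  obtains K :: "real^2 \<Rightarrow> real"
  where "\<And>k. Ck k K" "\<And>z. K z \<ge> 0" "\<And>z. K z \<noteq> 0 \<longleftrightarrow> z \<in> ball c \<epsilon>" "integral\<^sup>L lborel K = 1"
proof -
  define f where "f z = flat 0 (\<epsilon>\<^sup>2 - (\<Sum>i\<in>UNIV. (z $ i - c $ i) * (z $ i - c $ i)))" for z :: "real^2"
  have Cf: "Ck k f" for k unfolding f_def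
    by (intro Ck_flat Ck_diff Ck_const Ck_sum Ck_mult Ck_component)
  have f0: "f z \<ge> 0" for z by (simp add: f_def flat_nonneg)
  have fnz: "f z \<noteq> 0 \<longleftrightarrow> z \<in> ball c \<epsilon>" for z
  proof -
    have "(\<Sum>i\<in>UNIV. (z $ i - c $ i) * (z $ i - c $ i)) = (norm (z - c))\<^sup>2"
      by (simp add: power2_norm_eq_inner inner_vec_def)
    moreover have "(norm (z - c))\<^sup>2 < \<epsilon>\<^sup>2 \<longleftrightarrow> norm (z - c) < \<epsilon>"
      using assms by (meson less_imp_le norm_ge_zero pos2 power2_less_imp_less power_strict_mono)
    ultimately show ?thesis
      by (simp add: f_def flat_def dist_norm norm_minus_commute)
  qed
  have fi: "integrable lborel f"
    by (rule integrable_compact_support[OF continuous_Ck[OF Cf] compact_cball[of c \<epsilon>]]) (use fnz in force)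
  define Z where "Z = integral\<^sup>L lborel f"
  have "Z \<noteq> 0"
  proof
    assume "Z = 0"
    then have "AE z in lborel. f z = 0"
      using integral_nonneg_eq_0_iff_AE[OF fi] f0 by (simp add: Z_def)
    then have "AE z in lborel. z \<notin> ball c \<epsilon>"
      by eventually_elim (use fnz in blast)
    then have "emeasure lborel (ball c \<epsilon>) = 0"
      by (subst (asm) AE_iff_measurable[where N = "ball c \<epsilon>"]) auto
    then have "negligible (ball c \<epsilon>)"
      by (simp add: negligible_iff_emeasure0)
    then show False using assms open_not_negligible[of "ball c \<epsilon>"] by simp
  qed
  moreover have "Z \<ge> 0" using f0 by (simp add: Z_def)
  ultimately have Z: "Z > 0" by simp
  show ?thesis
  proof (rule that[of "\<lambda>z. inverse Z * f z"])
    show "Ck k (\<lambda>z. inverse Z * f z)" for k by (intro Ck_mult Ck_const Cf)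
    show "inverse Z * f z \<ge> 0" for z using Z f0 by simp
    show "inverse Z * f z \<noteq> 0 \<longleftrightarrow> z \<in> ball c \<epsilon>" for z using Z fnz by simp
    show "(LINT z|lborel. inverse Z * f z) = 1" using Z by (simp add: Z_def)
  qed
qed

lemma conv_close:
  fixes K :: "real^2 \<Rightarrow> real" and U :: "real^2 \<Rightarrow> 'b::euclidean_space"
  assumes K: "continuous_on UNIV K" "\<And>z. K z \<ge> 0" "compact C" "\<And>z. z \<notin> C \<Longrightarrow> K z = 0" "integral\<^sup>L lborel K = 1"
    and U: "integrable lborel U" and close: "\<And>y. x - y \<in> C \<Longrightarrow> norm (U y - c) \<le> e"
  shows "norm (conv K U x - c) \<le> e"
proof -
  have Ki: "integrable lborel (\<lambda>y. K (x - y))"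
    by (intro integrable_reflect integrable_compact_support[OF K(1,3,4)])
  have K1: "(LINT y|lborel. K (x - y)) = 1"
    using integral_reflect[of K x] K(1,5) by (simp add: borel_measurable_continuous_onI)
  have "conv K U x - c = (LINT y|lborel. K (x - y) *\<^sub>R U y) - (LINT y|lborel. K (x - y) *\<^sub>R c)"
    using Ki K1 by (simp add: conv_def)
  also have "\<dots> = (LINT y|lborel. K (x - y) *\<^sub>R (U y - c))"
    unfolding scaleR_diff_right
    by (rule Bochner_Integration.integral_diff[symmetric])
       (use integrable_conv[OF K(1,3,4) U] Ki in auto)
  also have "norm \<dots> \<le> (LINT y|lborel. K (x - y) * e)"
  proof (rule Bochner_Integration.integral_norm_bound_integral)
    show "integrable lborel (\<lambda>y. K (x - y) *\<^sub>R (U y - c))"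
      unfolding scaleR_diff_right
      by (rule Bochner_Integration.integrable_diff) (use integrable_conv[OF K(1,3,4) U] Ki in auto)
    show "integrable lborel (\<lambda>y. K (x - y) * e)" using Ki by simp
    show "norm (K (x - y) *\<^sub>R (U y - c)) \<le> K (x - y) * e" for y
      using K(2)[of "x - y"] K(4)[of "x - y"] close[of y]
      by (cases "x - y \<in> C") (auto intro: mult_left_mono)
  qed
  also have "\<dots> = e" using K1 by simp
  finally show ?thesis .
qed

section \<open>Weakly divergence-free fields\<close>

definition gradient :: "(real^2 \<Rightarrow> real) \<Rightarrow> real^2 \<Rightarrow> real^2"
  where "gradient f x = (\<chi> i. partial i f x)"

lemma gradient_inner: "gradient f x \<bullet> h = (\<Sum>i\<in>UNIV. partial i f x * h $ i)"
  by (simp add: gradient_def inner_vec_def)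

lemma gradient_eqI:
  assumes "(f has_derivative (\<lambda>h. a \<bullet> h)) (at x)" shows "gradient f x = a"
  by (simp add: vec_eq_iff gradient_def partial_has_derivative[OF assms] inner_axis)

lemma continuous_gradient: "Ck 1 f \<Longrightarrow> continuous_on UNIV (gradient f)"
  unfolding gradient_def by (intro continuous_on_vec_lambda) simp

lemma gradient_eq_0_outside:
  assumes "compact C" "\<And>x. x \<notin> C \<Longrightarrow> f x = 0" "x \<notin> C" shows "gradient f x = 0"
  using partial_eq_0_outside[OF compact_imp_closed[OF assms(1)] assms(2,3)]
  by (simp add: gradient_def vec_eq_iff)

lemma gradient_mult:
  assumes "f differentiable at x" "g differentiable at x"
  shows "gradient (\<lambda>x. f x * g x) x = f x *\<^sub>R gradient g x + g x *\<^sub>R gradient f x"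
  using partial_scaleR[OF assms] by (simp add: gradient_def vec_eq_iff mult.commute)

lemma integrable_inner_compact_support:
  fixes F V :: "real^2 \<Rightarrow> real^2"
  assumes F: "continuous_on UNIV F" "compact C" "\<And>x. x \<notin> C \<Longrightarrow> F x = 0"
    and V: "integrable lborel V"
  shows "integrable lborel (\<lambda>x. F x \<bullet> V x)"
proof -
  obtain M where M: "M > 0" "\<And>x. norm (F x) \<le> M" using bounded_compact_support[OF F] by blast
  have m: "F \<in> borel_measurable borel" using F(1) by (rule borel_measurable_continuous_onI)
  show ?thesis
  proof (rule Bochner_Integration.integrable_bound[where f = "\<lambda>x. M *\<^sub>R V x"])
    show "integrable lborel (\<lambda>x. M *\<^sub>R V x)" using V by (rule integrable_scaleR_right)
    show "(\<lambda>x. F x \<bullet> V x) \<in> borel_measurable lborel"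
      using m borel_measurable_integrable[OF V] by simp
    show "AE x in lborel. norm (F x \<bullet> V x) \<le> norm (M *\<^sub>R V x)"
    proof (intro always_eventually allI)
      fix x
      have "norm (F x \<bullet> V x) \<le> norm (F x) * norm (V x)" by (simp add: Cauchy_Schwarz_ineq2)
      also have "\<dots> \<le> M * norm (V x)" using M by (intro mult_right_mono) auto
      finally show "norm (F x \<bullet> V x) \<le> norm (M *\<^sub>R V x)" using M by simp
    qed
  qed
qed

lemma conv_tendsto:
  fixes K :: "nat \<Rightarrow> real^2 \<Rightarrow> real" and U :: "real^2 \<Rightarrow> 'b::euclidean_space"
  assumes K: "\<And>n. continuous_on UNIV (K n)" "\<And>n z. K n z \<ge> 0"
    "\<And>n z. K n z \<noteq> 0 \<Longrightarrow> norm z \<le> s n" "\<And>n. integral\<^sup>L lborel (K n) = 1" "s \<longlonglongrightarrow> 0"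
    and U: "integrable lborel U" "isCont U x"
  shows "(\<lambda>n. conv (K n) U x) \<longlonglongrightarrow> U x"
proof (rule LIMSEQ_I)
  fix e :: real assume "e > 0"
  then obtain d where d: "d > 0" "\<And>y. dist y x < d \<Longrightarrow> dist (U y) (U x) < e / 2"
    using U(2) unfolding continuous_at_eps_delta by (metis half_gt_zero)
  obtain N where N: "\<And>n. n \<ge> N \<Longrightarrow> norm (s n - 0) < d"
    using LIMSEQ_D[OF K(5) d(1)] by blast
  have "norm (conv (K n) U x - U x) < e" if "n \<ge> N" for n
  proof -
    have "norm (conv (K n) U x - U x) \<le> e / 2"
    proof (rule conv_close[OF K(1,2) compact_cball[of 0 "s n"] _ K(4) U(1)])
      show "z \<notin> cball 0 (s n) \<Longrightarrow> K n z = 0" for z using K(3) by auto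
      fix y assume "x - y \<in> cball 0 (s n)"
      then have "dist y x < d" using N[OF that] by (simp add: dist_norm norm_minus_commute)
      then show "norm (U y - U x) \<le> e / 2" using d(2)[of y] by (simp add: dist_norm)
    qed
    with \<open>e > 0\<close> show ?thesis by simp
  qed
  then show "\<exists>N. \<forall>n\<ge>N. norm (conv (K n) U x - U x) < e" by blast
qed

lemma norm_conv_le:
  fixes U :: "real^2 \<Rightarrow> 'b::euclidean_space"
  assumes K: "continuous_on UNIV K" "\<And>z. K z \<ge> 0" "compact C" "\<And>z. z \<notin> C \<Longrightarrow> K z = 0" "integral\<^sup>L lborel K = 1"
    and U: "integrable lborel U" "\<And>y. norm (U y) \<le> M"
  shows "norm (conv K U x) \<le> M"
proof -
  have "norm (conv K U x - 0) \<le> M"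
    by (rule conv_close[OF K U(1)]) (use U(2) in simp_all)
  then show ?thesis by simp
qed

text \<open>
  Cut-off functions adapted to a C1 boundary are themselves only C1, so the weak equation is first
  extended from smooth to C1 test functions. Mollifying the test function commutes with its
  derivatives, because by commutativity of convolution they can be moved to either factor.
\<close>

lemma weak_divergence_free_C1:
  fixes V :: "real^2 \<Rightarrow> real^2"
  assumes "open \<Omega>" and V: "integrable lborel V"
    and D: "\<And>\<phi>. test_function \<Omega> \<phi> \<Longrightarrow> (LINT x|lborel. gradient \<phi> x \<bullet> V x) = 0"
    and \<psi>: "Ck 1 \<psi>" "compact C" "C \<subseteq> \<Omega>" "\<And>x. x \<notin> C \<Longrightarrow> \<psi> x = 0"
  shows "(LINT x|lborel. gradient \<psi> x \<bullet> V x) = 0"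
proof -
  obtain \<delta> where \<delta>: "\<delta> > 0" "(\<Union>x\<in>C. cball x \<delta>) \<subseteq> \<Omega>"
    using compact_subset_open_imp_cball_epsilon_subset[OF \<psi>(2) assms(1) \<psi>(3)] by blast
  define s where "s n = \<delta> / real (Suc n)" for n
  have s: "s n > 0" "s n \<le> \<delta>" for n using \<delta>(1) by (auto simp: s_def field_simps)
  have "s \<longlonglongrightarrow> 0" unfolding s_def by (rule LIMSEQ_Suc[OF lim_const_over_n])
  have "\<exists>K::real^2 \<Rightarrow> real. (\<forall>k. Ck k K) \<and> (\<forall>z. K z \<ge> 0) \<and> (\<forall>z. K z \<noteq> 0 \<longleftrightarrow> z \<in> ball 0 (s n)) \<and> integral\<^sup>L lborel K = 1" for n
    by (rule mollifier_exists[OF s(1)[of n], of 0]) blast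
  then obtain K :: "nat \<Rightarrow> real^2 \<Rightarrow> real" where K: "\<And>n k. Ck k (K n)" "\<And>n z. K n z \<ge> 0" "\<And>n z. K n z \<noteq> 0 \<longleftrightarrow> z \<in> ball 0 (s n)"
    "\<And>n. integral\<^sup>L lborel (K n) = 1" by metis
  have Kc: "continuous_on UNIV (K n)" for n using continuous_Ck[OF K(1)] .
  have Ko: "z \<notin> cball 0 (s n) \<Longrightarrow> K n z = 0" for n z using K(3)[of n z] by auto
  have K\<delta>: "z \<notin> cball 0 \<delta> \<Longrightarrow> K n z = 0" for n z using K(3)[of n z] s(2)[of n] by auto
  have Ki: "integrable lborel (K n)" for n by (rule integrable_compact_support[OF Kc compact_cball Ko])
  have c\<psi>: "continuous_on UNIV \<psi>" using continuous_Ck[OF \<psi>(1)] .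
  have c\<psi>': "continuous_on UNIV (partial i \<psi>)" for i using \<psi>(1) by simp
  have \<psi>i: "integrable lborel \<psi>" by (rule integrable_compact_support[OF c\<psi> \<psi>(2,4)])
  have o: "x \<notin> C \<Longrightarrow> partial i \<psi> x = 0" for x i
    using partial_eq_0_outside[OF compact_imp_closed[OF \<psi>(2)] \<psi>(4)] .
  have \<psi>i': "integrable lborel (partial i \<psi>)" for i
    by (rule integrable_compact_support[OF c\<psi>' \<psi>(2) o])
  have par: "partial i (conv (K n) \<psi>) = conv (K n) (partial i \<psi>)" for n i
  proof -
    have "partial i (conv \<psi> (K n)) = conv (partial i \<psi>) (K n)"
      by (rule partial_conv[OF \<psi>(1,2,4) Ki])
    moreover have "conv \<psi> (K n) = conv (K n) \<psi>" "conv (partial i \<psi>) (K n) = conv (K n) (partial i \<psi>)"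
      by (intro conv_commute borel_measurable_continuous_onI c\<psi> c\<psi>' Kc)+
    ultimately show ?thesis by simp
  qed
  have zero: "(LINT x|lborel. gradient (conv (K n) \<psi>) x \<bullet> V x) = 0" for n
  proof (rule D, rule test_functionI[where C = "{x + y | x y. x \<in> C \<and> y \<in> cball 0 \<delta>}"])
    show "Ck k (conv (K n) \<psi>)" for k by (rule Ck_conv[OF compact_cball \<psi>i K(1) K\<delta>])
    show "compact {x + y | x y. x \<in> C \<and> y \<in> cball 0 \<delta>}" by (rule compact_sums[OF \<psi>(2) compact_cball])
    show "{x + y | x y. x \<in> C \<and> y \<in> cball 0 \<delta>} \<subseteq> \<Omega>"
    proof clarify
      fix x y :: "real^2" assume xy: "x \<in> C" "y \<in> cball 0 \<delta>"
      then have "x + y \<in> cball x \<delta>" by (simp add: dist_norm)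
      with xy \<delta>(2) show "x + y \<in> \<Omega>" by blast
    qed
    fix x assume x: "x \<notin> {x + y | x y. x \<in> C \<and> y \<in> cball 0 \<delta>}"
    have "K n (x - y) *\<^sub>R \<psi> y = 0" for y
    proof (cases "y \<in> C")
      case True
      with x have "x - y \<notin> cball 0 \<delta>" by force
      then show ?thesis using K\<delta> by simp
    qed (simp add: \<psi>(4))
    then show "conv (K n) \<psi> x = 0" by (simp only: conv_def Bochner_Integration.integral_zero)
  qed
  have "\<exists>M. \<forall>x. norm (partial i \<psi> x) \<le> M" for i
    using bounded_compact_support[OF c\<psi>' \<psi>(2) o, of i] by metis
  then obtain M where M: "\<And>i x. norm (partial i \<psi> x) \<le> M i" by metis
  have Mc: "norm (conv (K n) (partial i \<psi>) x) \<le> M i" for n i x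
    by (rule norm_conv_le[OF Kc K(2) compact_cball Ko K(4) \<psi>i' M])
  have cc: "continuous_on UNIV (conv (K n) (partial i \<psi>))" for n i
    by (rule continuous_conv[OF Kc compact_cball Ko \<psi>i'])
  have Vm: "V \<in> borel_measurable borel" using borel_measurable_integrable[OF V] by simp
  have "(\<lambda>n. LINT x|lborel. gradient (conv (K n) \<psi>) x \<bullet> V x) \<longlonglongrightarrow> (LINT x|lborel. gradient \<psi> x \<bullet> V x)"
    unfolding gradient_inner par
  proof (rule integral_dominated_convergence[where w = "\<lambda>x. \<Sum>i\<in>UNIV. M i * norm (V x)"])
    have Vi: "(\<lambda>x. V x $ i) \<in> borel_measurable lborel" for i
    proof -
      have "(\<lambda>x. V x \<bullet> axis i 1) \<in> borel_measurable lborel" using Vm by simp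
      then show ?thesis by (simp add: inner_axis)
    qed
    show "(\<lambda>x. \<Sum>i\<in>UNIV. partial i \<psi> x * V x $ i) \<in> borel_measurable lborel"
      by (intro borel_measurable_sum borel_measurable_times Vi) (simp add: borel_measurable_continuous_onI c\<psi>')
    show "(\<lambda>x. \<Sum>i\<in>UNIV. conv (K n) (partial i \<psi>) x * V x $ i) \<in> borel_measurable lborel" for n
      by (intro borel_measurable_sum borel_measurable_times Vi) (simp add: borel_measurable_continuous_onI cc)
    show "integrable lborel (\<lambda>x. \<Sum>i\<in>UNIV. M i * norm (V x))"
      by (intro Bochner_Integration.integrable_sum integrable_mult_right integrable_norm V)
    show "AE x in lborel. (\<lambda>n. \<Sum>i\<in>UNIV. conv (K n) (partial i \<psi>) x * V x $ i)
        \<longlonglongrightarrow> (\<Sum>i\<in>UNIV. partial i \<psi> x * V x $ i)"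
    proof (intro always_eventually allI tendsto_sum tendsto_mult tendsto_const)
      fix x i
      show "(\<lambda>n. conv (K n) (partial i \<psi>) x) \<longlonglongrightarrow> partial i \<psi> x"
      proof (rule conv_tendsto[OF Kc K(2) _ K(4) \<open>s \<longlonglongrightarrow> 0\<close> \<psi>i'])
        show "norm z \<le> s n" if "K n z \<noteq> 0" for n z using that Ko[of z n] by force
        show "isCont (partial i \<psi>) x" using c\<psi>' by (simp add: continuous_on_eq_continuous_at)
      qed
    qed
    show "AE x in lborel. norm (\<Sum>i\<in>UNIV. conv (K n) (partial i \<psi>) x * V x $ i) \<le> (\<Sum>i\<in>UNIV. M i * norm (V x))" for n
    proof (intro always_eventually allI sum_norm_le)
      fix x i
      show "norm (conv (K n) (partial i \<psi>) x * V x $ i) \<le> M i * norm (V x)"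
        unfolding norm_mult using Mc[of n i x] component_le_norm_cart[of "V x" i]
        by (intro mult_mono) (auto intro: order_trans[OF norm_ge_zero])
    qed
  qed
  then show ?thesis by (simp add: zero LIMSEQ_const_iff)
qed

section \<open>Charts and the flux through the boundary\<close>

lemma chart_has_derivative:
  assumes "\<And>s. (g has_real_derivative g' s) (at s)"
  shows "((\<lambda>y. y \<bullet> d - g (y \<bullet> e)) has_derivative (\<lambda>h. (d - g' (x \<bullet> e) *\<^sub>R e) \<bullet> h)) (at x)"
proof -
  have 1: "((\<lambda>y. g (y \<bullet> e)) has_derivative (\<lambda>h. g' (x \<bullet> e) * (h \<bullet> e))) (at x)"
    by (rule has_derivative_compose[OF _ assms[unfolded has_field_derivative_def]])
       (intro has_derivative_inner_left has_derivative_ident)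
  have "((\<lambda>y. y \<bullet> d - g (y \<bullet> e)) has_derivative (\<lambda>h. h \<bullet> d - g' (x \<bullet> e) * (h \<bullet> e))) (at x)"
    by (intro has_derivative_diff 1 has_derivative_inner_left has_derivative_ident)
  moreover have "h \<bullet> d - g' (x \<bullet> e) * (h \<bullet> e) = (d - g' (x \<bullet> e) *\<^sub>R e) \<bullet> h" for h
    by (simp add: inner_diff_left inner_commute[of h])
  ultimately show ?thesis by simp
qed

lemma chart_Ck_1:
  assumes "\<And>s. (g has_real_derivative g' s) (at s)" "continuous_on UNIV g'"
  shows "Ck 1 (\<lambda>y. y \<bullet> d - g (y \<bullet> e))"
proof -
  note hd = chart_has_derivative[OF assms(1)]
  have "partial i (\<lambda>y. y \<bullet> d - g (y \<bullet> e)) = (\<lambda>x. (d - g' (x \<bullet> e) *\<^sub>R e) \<bullet> axis i 1)" for i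
    by (rule ext) (rule partial_has_derivative[OF hd])
  moreover have "continuous_on UNIV (\<lambda>x. (d - g' (x \<bullet> e) *\<^sub>R e) \<bullet> axis i 1)" for i
    by (intro continuous_intros continuous_on_compose2[OF assms(2)]) simp
  moreover have "(\<lambda>y. y \<bullet> d - g (y \<bullet> e)) differentiable at x" for x
    using hd unfolding differentiable_def by blast
  ultimately show ?thesis by simp
qed

text \<open>
  A negative value would be negative in a whole neighbourhood, which then misses \<open>\<Omega>\<close>; a positive
  value puts the point into \<open>\<Omega>\<close>.
\<close>

lemma chart_closure:
  assumes "C1_boundary_chart \<Omega> x0 r e d g g'" "y \<in> closure \<Omega>" "y \<in> ball x0 r"
  shows "y \<bullet> d - g (y \<bullet> e) \<ge> 0" "y \<notin> \<Omega> \<Longrightarrow> y \<bullet> d - g (y \<bullet> e) = 0"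
    "y \<in> \<Omega> \<Longrightarrow> y \<bullet> d - g (y \<bullet> e) > 0"
proof -
  define w where "w y = y \<bullet> d - g (y \<bullet> e)" for y
  have ch: "\<And>s. (g has_real_derivative g' s) (at s)" "continuous_on UNIV g'"
    "\<Omega> \<inter> ball x0 r = {y \<in> ball x0 r. w y > 0}"
    using assms(1) by (auto simp: C1_boundary_chart_def w_def)
  have cw: "continuous_on UNIV w" using continuous_Ck[OF chart_Ck_1[OF ch(1,2)]] by (simp add: w_def[abs_def])
  have "w y \<ge> 0"
  proof (rule ccontr)
    assume "\<not> w y \<ge> 0"
    then have "y \<in> {y. w y < 0} \<inter> ball x0 r" using assms(3) by simp
    moreover have "open ({y. w y < 0} \<inter> ball x0 r)"
      by (intro open_Int open_ball open_Collect_less cw continuous_on_const)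
    ultimately have "\<Omega> \<inter> ({y. w y < 0} \<inter> ball x0 r) \<noteq> {}"
      using assms(2) open_Int_closure_eq_empty by blast
    then obtain z where "z \<in> \<Omega> \<inter> ball x0 r" "w z < 0" by blast
    then show False unfolding ch(3) by auto
  qed
  then show "y \<bullet> d - g (y \<bullet> e) \<ge> 0" by (simp add: w_def)
  show "y \<bullet> d - g (y \<bullet> e) > 0" if "y \<in> \<Omega>"
  proof -
    have "y \<in> \<Omega> \<inter> ball x0 r" using that assms(3) by blast
    then show ?thesis unfolding ch(3) by (simp add: w_def)
  qed
  show "y \<bullet> d - g (y \<bullet> e) = 0" if "y \<notin> \<Omega>"
  proof -
    have "\<not> w y > 0" using that assms(3) ch(3) by blast
    with \<open>w y \<ge> 0\<close> show ?thesis by (simp add: w_def)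
  qed
qed

lemma flat_2_le: "s > 0 \<Longrightarrow> flat 2 s \<le> 1 / s\<^sup>2"
  by (simp add: flat_def divide_right_mono)

text \<open>
  The extension of a solenoidal tangential field by zero is solenoidal across the boundary.

  Let \<open>w = y \<bullet> d - g (y \<bullet> e)\<close> be the defining function of the chart, and cut off by
  \<open>\<theta>\<^sub>n = flat 0 (n w - 1)\<close>, which vanishes near the boundary and tends to 1 inside. Testing with
  \<open>\<theta>\<^sub>n \<phi>\<close> gives \<open>\<integral> \<theta>\<^sub>n \<nabla>\<phi> \<cdot> V = - \<integral> m\<^sub>n \<nabla>w \<cdot> V\<close>, where \<open>m\<^sub>n = \<phi> \<theta>\<^sub>n'\<close> concentrates at the boundary, and
  \<open>\<nabla>w \<cdot> V\<close> is small there because \<open>\<nabla>w\<close> is normal to the boundary.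

  It remains to bound the mass of \<open>m\<^sub>n\<close>. Instead of estimating the area of a boundary strip, one
  applies the same identity to the constant field \<open>d\<close>: since \<open>\<nabla>w \<cdot> d = 1\<close>, it yields
  \<open>\<integral> m\<^sub>n = - \<integral> \<theta>\<^sub>n \<nabla>\<phi> \<cdot> d\<close>, which is bounded. This is where \<open>\<phi> \<ge> 0\<close> enters, for then \<open>m\<^sub>n \<ge> 0\<close>.
\<close>

lemma flux_vanishes_near_boundary:
  fixes V v :: "real^2 \<Rightarrow> real^2"
  assumes chart: "C1_boundary_chart \<Omega> x0 r e d g g'"
    and \<Omega>: "open \<Omega>" "bounded \<Omega>"
    and V: "integrable lborel V" "\<And>x. x \<in> \<Omega> \<Longrightarrow> V x = v x" "\<And>x. x \<notin> \<Omega> \<Longrightarrow> V x = 0"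
    and v: "continuous_on (closure \<Omega>) v"
    and tangential: "\<And>y. y \<in> frontier \<Omega> \<Longrightarrow> y \<in> ball x0 r \<Longrightarrow> (d - g' (y \<bullet> e) *\<^sub>R e) \<bullet> v y = 0"
    and D: "\<And>\<phi>. test_function \<Omega> \<phi> \<Longrightarrow> (LINT x|lborel. gradient \<phi> x \<bullet> V x) = 0"
    and \<phi>: "Ck 1 \<phi>" "\<And>x. \<phi> x \<ge> 0" "compact C" "C \<subseteq> ball x0 r" "\<And>x. x \<notin> C \<Longrightarrow> \<phi> x = 0"
  shows "(LINT x|lborel. gradient \<phi> x \<bullet> V x) = 0"
proof -
  define w where "w y = y \<bullet> d - g (y \<bullet> e)" for y
  define G where "G y = d - g' (y \<bullet> e) *\<^sub>R e" for y
  have ch: "\<And>s. (g has_real_derivative g' s) (at s)" "continuous_on UNIV g'" "norm d = 1" "e \<bullet> d = 0"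
    "\<Omega> \<inter> ball x0 r = {y \<in> ball x0 r. w y > 0}"
    using chart by (auto simp: C1_boundary_chart_def w_def)
  have w: "Ck 1 w" using chart_Ck_1[OF ch(1,2)] by (simp add: w_def[abs_def])
  have wd: "w differentiable at x" for x using w by simp
  have gw: "gradient w x = G x" for x
    using gradient_eqI[OF chart_has_derivative[OF ch(1)]] by (simp add: w_def[abs_def] G_def)
  have Gd: "G x \<bullet> d = 1" for x
    using ch(3,4) by (simp add: G_def inner_diff_left norm_eq_1)
  have cG: "continuous_on UNIV G"
    unfolding G_def by (intro continuous_intros continuous_on_compose2[OF ch(2)]) simp
  have cw: "continuous_on UNIV w" using continuous_Ck[OF w] .
  define \<theta> where "\<theta> n y = flat 0 (real (Suc n) * w y - 1)" for n y
  define m where "m n y = \<phi> y * (real (Suc n) * flat 2 (real (Suc n) * w y - 1))" for n y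
  define \<psi> where "\<psi> n y = \<theta> n y * \<phi> y" for n y
  have Ck\<theta>: "Ck 1 (\<theta> n)" for n
    unfolding \<theta>_def by (intro Ck_flat Ck_diff Ck_mult Ck_const w)
  have Ck\<psi>: "Ck 1 (\<psi> n)" for n
    unfolding \<psi>_def by (intro Ck_mult Ck\<theta> \<phi>(1))
  have \<phi>d: "\<phi> differentiable at x" for x using \<phi>(1) by simp
  have g\<theta>: "gradient (\<theta> n) x = (real (Suc n) * flat 2 (real (Suc n) * w x - 1)) *\<^sub>R G x" for n x
  proof -
    have "((\<lambda>y. real (Suc n) * w y - 1) has_derivative (\<lambda>h. real (Suc n) * (G x \<bullet> h))) (at x)"
      unfolding w_def G_def
      by (intro has_derivative_eq_rhs[OF has_derivative_diff[OF has_derivative_mult_right[OF chart_has_derivative[OF ch(1)]] has_derivative_const]])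
         simp
    from has_derivative_compose[OF this flat_has_derivative[of 0, unfolded has_field_derivative_def]]
    have "(\<theta> n has_derivative (\<lambda>h. ((real (Suc n) * flat 2 (real (Suc n) * w x - 1)) *\<^sub>R G x) \<bullet> h)) (at x)"
      unfolding \<theta>_def by (rule has_derivative_eq_rhs) (auto simp: fun_eq_iff numeral_2_eq_2)
    then show ?thesis by (rule gradient_eqI)
  qed
  have g\<psi>: "gradient (\<psi> n) x = \<theta> n x *\<^sub>R gradient \<phi> x + m n x *\<^sub>R G x" for n x
  proof -
    have "\<theta> n differentiable at x" using Ck\<theta> by simp
    from gradient_mult[OF this \<phi>d] show ?thesis
      by (simp add: \<psi>_def[abs_def] m_def g\<theta>)
  qed
  have \<theta>01: "0 \<le> \<theta> n x" "\<theta> n x \<le> 1" for n x by (simp_all add: \<theta>_def flat_nonneg flat_0_le_1)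
  have m0: "m n x \<ge> 0" for n x using \<phi>(2) by (simp add: m_def flat_nonneg)
  have cg: "continuous_on UNIV (gradient \<phi>)" by (rule continuous_gradient[OF \<phi>(1)])
  have og: "x \<notin> C \<Longrightarrow> gradient \<phi> x = 0" for x by (rule gradient_eq_0_outside[OF \<phi>(3,5)])
  have c\<phi>: "continuous_on UNIV \<phi>" using continuous_Ck[OF \<phi>(1)] .
  have c\<theta>: "continuous_on UNIV (\<theta> n)" for n using continuous_Ck[OF Ck\<theta>] .
  have cm: "continuous_on UNIV (m n)" for n
    unfolding m_def by (intro continuous_intros c\<phi> continuous_on_compose2[OF continuous_flat[of UNIV]] cw) simp
  have om: "x \<notin> C \<Longrightarrow> m n x = 0" for n x using \<phi>(5) by (simp add: m_def)
  have mi: "integrable lborel (m n)" for n by (rule integrable_compact_support[OF cm \<phi>(3) om])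
  have \<phi>i: "integrable lborel \<phi>" by (rule integrable_compact_support[OF c\<phi> \<phi>(3,5)])
  have i1: "integrable lborel (\<lambda>x. (\<theta> n x *\<^sub>R gradient \<phi> x) \<bullet> V x)" for n
    by (rule integrable_inner_compact_support[OF _ \<phi>(3) _ V(1)])
       (auto intro!: continuous_intros c\<theta> cg simp: og)
  have i2: "integrable lborel (\<lambda>x. (m n x *\<^sub>R G x) \<bullet> V x)" for n
    by (rule integrable_inner_compact_support[OF _ \<phi>(3) _ V(1)])
       (auto intro!: continuous_intros cm cG simp: om)
  have split: "(LINT x|lborel. (\<theta> n x *\<^sub>R gradient \<phi> x) \<bullet> V x) = - (LINT x|lborel. (m n x *\<^sub>R G x) \<bullet> V x)" for n
  proof -
    define C' where "C' = C \<inter> {y. w y \<ge> 1 / real (Suc n)}"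
    have "(LINT x|lborel. gradient (\<psi> n) x \<bullet> V x) = 0"
    proof (rule weak_divergence_free_C1[OF \<Omega>(1) V(1) D Ck\<psi>])
      show "compact C'" unfolding C'_def
        by (intro compact_Int_closed \<phi>(3) closed_Collect_le continuous_on_const cw)
      show "C' \<subseteq> \<Omega>"
      proof
        fix y assume y: "y \<in> C'"
        then have "w y \<ge> 1 / real (Suc n)" by (simp add: C'_def)
        then have "w y > 0" by (rule less_le_trans[rotated]) simp
        moreover have "y \<in> ball x0 r" using y \<phi>(4) by (auto simp: C'_def)
        ultimately show "y \<in> \<Omega>" using ch(5) by blast
      qed
      show "\<psi> n x = 0" if "x \<notin> C'" for x
      proof (cases "x \<in> C")
        case True
        with that have "w x < 1 / real (Suc n)" by (simp add: C'_def)
        then have "real (Suc n) * w x - 1 \<le> 0" by (simp add: field_simps)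
        then show ?thesis by (simp add: \<psi>_def \<theta>_def flat_eq_0)
      qed (simp add: \<psi>_def \<phi>(5))
    qed
    then have "(LINT x|lborel. (\<theta> n x *\<^sub>R gradient \<phi> x) \<bullet> V x + (m n x *\<^sub>R G x) \<bullet> V x) = 0"
      by (simp only: g\<psi> inner_add_left)
    then show ?thesis using i1[of n] i2[of n] by simp
  qed
  define A where "A = (LINT x|lborel. norm (gradient \<phi> x))"
  have gi: "integrable lborel (gradient \<phi>)" by (rule integrable_compact_support[OF cg \<phi>(3) og])
  have mass: "(LINT x|lborel. m n x) \<le> A" for n
  proof -
    have o\<psi>: "x \<notin> C \<Longrightarrow> \<psi> n x = 0" for x using \<phi>(5) by (simp add: \<psi>_def)
    have pi: "integrable lborel (partial i (\<psi> n))" for i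
      by (rule integrable_compact_support[OF _ \<phi>(3)])
         (use Ck\<psi>[of n] partial_eq_0_outside[OF compact_imp_closed[OF \<phi>(3)] o\<psi>] in auto)
    have "(LINT x|lborel. gradient (\<psi> n) x \<bullet> d) = (\<Sum>i\<in>UNIV. (LINT x|lborel. partial i (\<psi> n) x) * d $ i)"
      unfolding gradient_inner by (simp add: Bochner_Integration.integral_sum pi)
    also have "\<dots> = 0"
      by (simp add: integral_partial_eq_0[OF Ck\<psi> \<phi>(3) o\<psi>])
    finally have 0: "(LINT x|lborel. \<theta> n x *\<^sub>R gradient \<phi> x \<bullet> d + m n x) = 0"
      by (simp add: g\<psi> inner_add_left Gd)
    have ci: "integrable lborel (\<lambda>x. \<theta> n x *\<^sub>R gradient \<phi> x)"
      by (rule integrable_compact_support[OF _ \<phi>(3)])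
         (auto intro!: continuous_intros c\<theta> cg simp: og)
    then have ci': "integrable lborel (\<lambda>x. \<theta> n x *\<^sub>R gradient \<phi> x \<bullet> d)"
      by (intro integrable_inner_left)
    have "(LINT x|lborel. m n x) = - (LINT x|lborel. \<theta> n x *\<^sub>R gradient \<phi> x \<bullet> d)"
      using 0 Bochner_Integration.integral_add[OF ci' mi[of n]] by simp
    also have "\<dots> = (LINT x|lborel. - (\<theta> n x *\<^sub>R gradient \<phi> x \<bullet> d))" by simp
    also have "\<dots> \<le> A" unfolding A_def
    proof (rule integral_mono)
      show "integrable lborel (\<lambda>x. - (\<theta> n x *\<^sub>R gradient \<phi> x \<bullet> d))" using ci' by simp
      show "integrable lborel (\<lambda>x. norm (gradient \<phi> x))" using gi by simp
      fix x
      have "\<bar>\<theta> n x *\<^sub>R gradient \<phi> x \<bullet> d\<bar> \<le> norm (\<theta> n x *\<^sub>R gradient \<phi> x) * norm d"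
        by (rule Cauchy_Schwarz_ineq2)
      also have "\<dots> \<le> norm (gradient \<phi> x)"
        using \<theta>01[of n x] by (simp add: ch(3) mult_left_le_one_le)
      finally show "- (\<theta> n x *\<^sub>R gradient \<phi> x \<bullet> d) \<le> norm (gradient \<phi> x)" by linarith
    qed
    finally show ?thesis .
  qed
  have A0: "A \<ge> 0" by (simp add: A_def)
  define L where "L = (LINT x|lborel. gradient \<phi> x \<bullet> V x)"
  have lim: "(\<lambda>n. LINT x|lborel. (\<theta> n x *\<^sub>R gradient \<phi> x) \<bullet> V x) \<longlonglongrightarrow> L"
    unfolding L_def
  proof (rule integral_dominated_convergence[where w = "\<lambda>x. norm (gradient \<phi> x \<bullet> V x)"])
    have gV: "integrable lborel (\<lambda>x. gradient \<phi> x \<bullet> V x)"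
      by (rule integrable_inner_compact_support[OF cg \<phi>(3) og V(1)])
    then show "(\<lambda>x. gradient \<phi> x \<bullet> V x) \<in> borel_measurable lborel"
      "integrable lborel (\<lambda>x. norm (gradient \<phi> x \<bullet> V x))" by auto
    show "(\<lambda>x. (\<theta> n x *\<^sub>R gradient \<phi> x) \<bullet> V x) \<in> borel_measurable lborel" for n
      using i1 by auto
    show "AE x in lborel. norm ((\<theta> n x *\<^sub>R gradient \<phi> x) \<bullet> V x) \<le> norm (gradient \<phi> x \<bullet> V x)" for n
      using \<theta>01 by (intro always_eventually allI) (simp add: abs_mult mult_left_le_one_le)
    show "AE x in lborel. (\<lambda>n. (\<theta> n x *\<^sub>R gradient \<phi> x) \<bullet> V x) \<longlonglongrightarrow> gradient \<phi> x \<bullet> V x"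
    proof (intro always_eventually allI)
      fix x
      show "(\<lambda>n. (\<theta> n x *\<^sub>R gradient \<phi> x) \<bullet> V x) \<longlonglongrightarrow> gradient \<phi> x \<bullet> V x"
      proof (cases "x \<in> C \<and> x \<in> \<Omega>")
        case True
        then have "x \<in> \<Omega> \<inter> ball x0 r" using \<phi>(4) by blast
        then have wx: "w x > 0" unfolding ch(5) by simp
        have "(\<lambda>n. \<theta> n x) \<longlonglongrightarrow> 1"
        proof -
          have f: "filterlim (\<lambda>n. real (Suc n) * w x - 1) at_top sequentially"
          proof -
            have "filterlim (\<lambda>n. real (Suc n) * w x) at_top sequentially"
              by (rule filterlim_at_top_mult_tendsto_pos[OF tendsto_const wx
                    filterlim_compose[OF filterlim_real_sequentially filterlim_Suc]])
            from filterlim_tendsto_add_at_top[OF tendsto_const[of "-1"] this] show ?thesis by simp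
          qed
          from filterlim_compose[OF flat_0_tendsto_1 f] show ?thesis by (simp add: \<theta>_def)
        qed
        then have "(\<lambda>n. (\<theta> n x *\<^sub>R gradient \<phi> x) \<bullet> V x) \<longlonglongrightarrow> (1 *\<^sub>R gradient \<phi> x) \<bullet> V x"
          by (intro tendsto_intros)
        then show ?thesis by simp
      next
        case False
        then have "gradient \<phi> x \<bullet> V x = 0" using og V(3) by (cases "x \<in> C") auto
        then show ?thesis by simp
      qed
    qed
  qed
  have cH: "continuous_on (C \<inter> closure \<Omega>) (\<lambda>y. G y \<bullet> v y)"
    by (intro continuous_on_inner continuous_on_subset[OF cG] continuous_on_subset[OF v]) auto
  have CH: "compact (C \<inter> closure \<Omega>)" by (intro compact_Int_closed \<phi>(3)) simp
  obtain M where M: "M > 0" "\<And>y. y \<in> C \<inter> closure \<Omega> \<Longrightarrow> \<bar>G y \<bullet> v y\<bar> \<le> M"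
    using compact_imp_bounded[OF compact_continuous_image[OF cH CH]]
    by (auto simp: bounded_pos)
  have "\<bar>L\<bar> \<le> \<epsilon> * A" if \<epsilon>: "\<epsilon> > 0" for \<epsilon>
  proof -
    \<comment> \<open>By compactness, \<open>G \<bullet> v\<close> is small wherever \<open>w\<close> is small.\<close>
    obtain c where c: "c > 0" "\<And>y. y \<in> C \<inter> closure \<Omega> \<Longrightarrow> w y < c \<Longrightarrow> \<bar>G y \<bullet> v y\<bar> \<le> \<epsilon>"
    proof (cases "{y \<in> C \<inter> closure \<Omega>. \<bar>G y \<bullet> v y\<bar> \<ge> \<epsilon>} = {}")
      case True
      then show ?thesis using that[of 1] by fastforce
    next
      case False
      have "{y \<in> C \<inter> closure \<Omega>. \<bar>G y \<bullet> v y\<bar> \<ge> \<epsilon>} = (C \<inter> closure \<Omega>) \<inter> (\<lambda>y. \<bar>G y \<bullet> v y\<bar>) -` {\<epsilon>..}" by auto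
      moreover have "closed ((C \<inter> closure \<Omega>) \<inter> (\<lambda>y. \<bar>G y \<bullet> v y\<bar>) -` {\<epsilon>..})"
        by (intro continuous_closed_preimage continuous_on_rabs cH compact_imp_closed[OF CH]) simp
      ultimately have "compact {y \<in> C \<inter> closure \<Omega>. \<bar>G y \<bullet> v y\<bar> \<ge> \<epsilon>}"
        using compact_Int_closed[OF CH] by (metis Int_assoc Int_absorb)
      from continuous_attains_inf[OF this False continuous_on_subset[OF cw]]
      obtain z where z: "z \<in> C \<inter> closure \<Omega>" "\<bar>G z \<bullet> v z\<bar> \<ge> \<epsilon>"
        "\<And>y. y \<in> C \<inter> closure \<Omega> \<Longrightarrow> \<bar>G y \<bullet> v y\<bar> \<ge> \<epsilon> \<Longrightarrow> w z \<le> w y" by auto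
      have zb: "z \<in> ball x0 r" "z \<in> closure \<Omega>" using z(1) \<phi>(4) by auto
      have "z \<in> \<Omega>"
      proof (rule ccontr)
        assume "z \<notin> \<Omega>"
        then have "z \<in> frontier \<Omega>" using zb(2) \<Omega>(1) by (simp add: frontier_def interior_open)
        then have "G z \<bullet> v z = 0" using tangential[OF _ zb(1)] by (simp add: G_def)
        with z(2) \<epsilon> show False by simp
      qed
      then have "w z > 0" using chart_closure(3)[OF chart zb(2,1)] by (simp add: w_def)
      moreover have "\<bar>G y \<bullet> v y\<bar> \<le> \<epsilon>" if "y \<in> C \<inter> closure \<Omega>" "w y < w z" for y
        using z(3)[OF that(1)] that(2) by linarith
      ultimately show ?thesis using that by blast
    qed
    \<comment> \<open>Where \<open>w \<ge> c\<close>, \<open>flat 2 s \<le> 1 / s\<^sup>2\<close> makes \<open>m n\<close> of order \<open>1 / n\<close>.\<close>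
    define B where "B = M * (4 / c\<^sup>2) * integral\<^sup>L lborel \<phi>"
    have bound: "\<bar>LINT x|lborel. (\<theta> n x *\<^sub>R gradient \<phi> x) \<bullet> V x\<bar> \<le> \<epsilon> * A + B * (1 / real (Suc n))"
      if n: "real (Suc n) * c \<ge> 2" for n
    proof -
      let ?N = "real (Suc n)"
      have "\<bar>LINT x|lborel. (m n x *\<^sub>R G x) \<bullet> V x\<bar> \<le> (LINT x|lborel. \<epsilon> * m n x + M * (4 / c\<^sup>2) * (1 / ?N) * \<phi> x)"
        unfolding real_norm_def[symmetric]
      proof (rule Bochner_Integration.integral_norm_bound_integral[OF i2])
        show "integrable lborel (\<lambda>x. \<epsilon> * m n x + M * (4 / c\<^sup>2) * (1 / ?N) * \<phi> x)"
          by (intro Bochner_Integration.integrable_add integrable_mult_right mi \<phi>i)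
        fix x
        have r0: "0 \<le> \<epsilon> * m n x" "0 \<le> M * (4 / c\<^sup>2) * (1 / ?N) * \<phi> x"
          using \<epsilon> m0 M(1) \<phi>(2)[of x] by auto
        show "norm ((m n x *\<^sub>R G x) \<bullet> V x) \<le> \<epsilon> * m n x + M * (4 / c\<^sup>2) * (1 / ?N) * \<phi> x"
        proof (cases "x \<in> C \<and> x \<in> \<Omega>")
          case False
          then have "(m n x *\<^sub>R G x) \<bullet> V x = 0" using om V(3) by (cases "x \<in> C") auto
          then have "norm ((m n x *\<^sub>R G x) \<bullet> V x) = 0" by simp
          then show ?thesis using r0 by linarith
        next
          case True
          then have x: "x \<in> C \<inter> closure \<Omega>" using closure_subset by blast
          have eq: "norm ((m n x *\<^sub>R G x) \<bullet> V x) = m n x * \<bar>G x \<bullet> v x\<bar>"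
            using V(2) True m0 by (simp add: abs_mult)
          show ?thesis
          proof (cases "w x < c")
            case True
            then have "m n x * \<bar>G x \<bullet> v x\<bar> \<le> m n x * \<epsilon>" using c(2)[OF x] m0 by (intro mult_left_mono) auto
            then show ?thesis using r0 eq by (simp add: mult.commute)
          next
            case False
            then have "?N * c \<le> ?N * w x" by (intro mult_left_mono) auto
            then have s: "?N * w x - 1 \<ge> ?N * c / 2" using n by linarith
            have "?N * c / 2 > 0" using c(1) by simp
            then have s0: "?N * w x - 1 > 0" using s by linarith
            have "flat 2 (?N * w x - 1) \<le> 1 / (?N * w x - 1)\<^sup>2" by (rule flat_2_le[OF s0])
            also have "\<dots> \<le> 1 / (?N * c / 2)\<^sup>2"
              using s \<open>?N * c / 2 > 0\<close> by (intro divide_left_mono power_mono mult_pos_pos) auto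
            finally have "?N * flat 2 (?N * w x - 1) \<le> ?N * (1 / (?N * c / 2)\<^sup>2)" by (intro mult_left_mono) auto
            also have "\<dots> = 4 / c\<^sup>2 * (1 / ?N)" using c(1) by (simp add: power2_eq_square field_simps del: of_nat_Suc)
            finally have "m n x \<le> \<phi> x * (4 / c\<^sup>2 * (1 / ?N))" unfolding m_def by (intro mult_left_mono \<phi>(2))
            then have "m n x * \<bar>G x \<bullet> v x\<bar> \<le> \<phi> x * (4 / c\<^sup>2 * (1 / ?N)) * M"
              using M(2)[OF x] m0 M(1) \<phi>(2)[of x] by (intro mult_mono) auto
            then show ?thesis using r0(1) eq by (simp add: algebra_simps del: of_nat_Suc)
          qed
        qed
      qed
      also have "\<dots> = \<epsilon> * (LINT x|lborel. m n x) + M * (4 / c\<^sup>2) * (1 / ?N) * integral\<^sup>L lborel \<phi>"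
        using mi \<phi>i by simp
      also have "\<dots> \<le> \<epsilon> * A + B * (1 / ?N)"
        using mass[of n] \<epsilon> by (simp add: B_def mult.commute)
      finally show ?thesis unfolding split abs_minus_cancel .
    qed
    have "(\<lambda>n. \<bar>LINT x|lborel. (\<theta> n x *\<^sub>R gradient \<phi> x) \<bullet> V x\<bar>) \<longlonglongrightarrow> \<bar>L\<bar>"
      by (intro tendsto_rabs lim)
    moreover have "(\<lambda>n. \<epsilon> * A + B * (1 / real (Suc n))) \<longlonglongrightarrow> \<epsilon> * A + B * 0"
      by (intro tendsto_intros LIMSEQ_Suc[OF lim_1_over_n])
    moreover have "\<exists>N. \<forall>n\<ge>N. \<bar>LINT x|lborel. (\<theta> n x *\<^sub>R gradient \<phi> x) \<bullet> V x\<bar> \<le> \<epsilon> * A + B * (1 / real (Suc n))"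
    proof -
      obtain N :: nat where N: "2 / c < real N" using reals_Archimedean2 by blast
      have "real (Suc n) * c \<ge> 2" if "n \<ge> N" for n
      proof -
        have "2 / c < real (Suc n)" using N that by linarith
        then show ?thesis using c(1) by (simp add: field_simps del: of_nat_Suc)
      qed
      then show ?thesis using bound by blast
    qed
    ultimately show ?thesis using LIMSEQ_le by fastforce
  qed
  note eps = this
  have "\<bar>L\<bar> \<le> 0"
  proof (rule field_le_epsilon)
    fix \<epsilon> :: real assume "\<epsilon> > 0"
    then have "\<bar>L\<bar> \<le> \<epsilon> / (A + 1) * A" using A0 by (intro eps) simp
    also have "\<dots> \<le> \<epsilon>" using A0 \<open>\<epsilon> > 0\<close> by (simp add: field_simps)
    finally show "\<bar>L\<bar> \<le> 0 + \<epsilon>" by simp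
  qed
  then show ?thesis by (simp add: L_def)
qed

text \<open>
  With a graph far below the ball, an interior point is covered by the notion of a boundary chart,
  so that interior and boundary points need no separate treatment.
\<close>

lemma interior_chart:
  fixes \<Omega> :: "(real^2) set"
  assumes "open \<Omega>" "x \<in> \<Omega>"
  shows "\<exists>r e d g g'. C1_boundary_chart \<Omega> x r e d g g'"
proof -
  obtain r where r: "r > 0" "ball x r \<subseteq> \<Omega>" using assms openE by blast
  define d :: "real^2" where "d = axis 2 1"
  have "x \<bullet> d - 2 * r < y \<bullet> d" if "y \<in> ball x r" for y
  proof -
    have "\<bar>(x - y) \<bullet> d\<bar> \<le> norm (x - y) * norm d" by (rule Cauchy_Schwarz_ineq2)
    then have "x \<bullet> d - y \<bullet> d < r" using that by (simp add: d_def inner_diff_left dist_norm)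
    then show ?thesis using r(1) by linarith
  qed
  then have "\<Omega> \<inter> ball x r = {y \<in> ball x r. x \<bullet> d - 2 * r < y \<bullet> d}" using r(2) by blast
  then have "C1_boundary_chart \<Omega> x r (axis 1 1) d (\<lambda>s. x \<bullet> d - 2 * r) (\<lambda>s. 0)"
    using r(1) by (simp add: C1_boundary_chart_def d_def inner_axis_axis)
  then show ?thesis by blast
qed

lemma chart_DERIV:
  assumes "C1_boundary_chart \<Omega> x0 r e d g g'"
  shows "((\<lambda>t. (y + t *\<^sub>R z) \<bullet> d - g ((y + t *\<^sub>R z) \<bullet> e)) has_real_derivative (d - g' (y \<bullet> e) *\<^sub>R e) \<bullet> z) (at 0)"
proof -
  have ch: "\<And>s. (g has_real_derivative g' s) (at s)"
    using assms by (auto simp: C1_boundary_chart_def)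
  have l: "((\<lambda>t. y + t *\<^sub>R z) has_derivative (\<lambda>t. t *\<^sub>R z)) (at 0)"
    by (auto intro!: derivative_eq_intros)
  have "((\<lambda>y. y \<bullet> d - g (y \<bullet> e)) has_derivative (\<lambda>h. (d - g' (y \<bullet> e) *\<^sub>R e) \<bullet> h)) (at (y + 0 *\<^sub>R z))"
    using chart_has_derivative[OF ch, where x = y] by simp
  from has_derivative_compose[OF l this] show ?thesis
    by (simp add: has_field_derivative_def mult_commute_abs)
qed

text \<open>
  The unit normal is described by some chart at the point, in general not the one in use. Two
  defining functions of the same set have parallel gradients \<open>a\<close> and \<open>b\<close>: a direction with
  \<open>a \<bullet> z > 0\<close> enters \<open>\<Omega>\<close>, which excludes \<open>b \<bullet> z < 0\<close>; so \<open>a\<close> cannot be positive anywhere on the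
  hyperplane orthogonal to \<open>b\<close>, as a small step along \<open>- b\<close> would contradict this.
\<close>

lemma chart_normals_parallel:
  assumes 1: "C1_boundary_chart \<Omega> x1 r1 e1 d1 g1 g1'" and 2: "C1_boundary_chart \<Omega> x2 r2 e2 d2 g2 g2'"
    and y: "y \<in> closure \<Omega>" "y \<notin> \<Omega>" "y \<in> ball x1 r1" "y \<in> ball x2 r2"
    and z: "(d2 - g2' (y \<bullet> e2) *\<^sub>R e2) \<bullet> z = 0"
  shows "(d1 - g1' (y \<bullet> e1) *\<^sub>R e1) \<bullet> z = 0"
proof -
  define a where "a = d1 - g1' (y \<bullet> e1) *\<^sub>R e1"
  define b where "b = d2 - g2' (y \<bullet> e2) *\<^sub>R e2"
  have *: "b \<bullet> z \<ge> 0" if a: "a \<bullet> z > 0" for z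
  proof (rule ccontr)
    assume "\<not> b \<bullet> z \<ge> 0"
    then have b: "b \<bullet> z < 0" by simp
    have w0: "y \<bullet> d1 - g1 (y \<bullet> e1) = 0" "y \<bullet> d2 - g2 (y \<bullet> e2) = 0"
      using chart_closure(2)[OF 1 y(1,3,2)] chart_closure(2)[OF 2 y(1,4,2)] by auto
    obtain t1 where t1: "t1 > 0" "\<And>t. t > 0 \<Longrightarrow> t < t1 \<Longrightarrow> (y + t *\<^sub>R z) \<bullet> d1 - g1 ((y + t *\<^sub>R z) \<bullet> e1) > 0"
      using DERIV_pos_inc_right[OF chart_DERIV[OF 1, of y z]] a w0(1) by (auto simp: a_def)
    obtain t2 where t2: "t2 > 0" "\<And>t. t > 0 \<Longrightarrow> t < t2 \<Longrightarrow> (y + t *\<^sub>R z) \<bullet> d2 - g2 ((y + t *\<^sub>R z) \<bullet> e2) < 0"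
      using DERIV_neg_dec_right[OF chart_DERIV[OF 2, of y z]] b w0(2) by (auto simp: b_def)
    have "open (ball x1 r1 \<inter> ball x2 r2)" "y \<in> ball x1 r1 \<inter> ball x2 r2" using y by auto
    then obtain s where s: "s > 0" "ball y s \<subseteq> ball x1 r1 \<inter> ball x2 r2" by (rule openE)
    define t where "t = min (min t1 t2) (s / (norm z + 1)) / 2"
    have nz: "norm z + 1 > 0" by (simp add: add_nonneg_pos)
    have t: "t > 0" "t < t1" "t < t2" 
    proof -
      have "s / (norm z + 1) > 0" using s(1) nz by simp
      then show "t > 0" using t1(1) t2(1) by (simp add: t_def)
      have "t \<le> min t1 t2 / 2" unfolding t_def by (intro divide_right_mono min.cobounded1) simp
      then have "t \<le> t1 / 2" "t \<le> t2 / 2" by auto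
      then show "t < t1" "t < t2" using t1(1) t2(1) by linarith+
    qed
    have "t \<le> s / (norm z + 1) / 2" unfolding t_def by (intro divide_right_mono min.cobounded2) simp
    then have "t * (norm z + 1) \<le> s / 2" using nz by (simp add: field_simps)
    then have "t * norm z < s" using t(1) s(1) by (simp add: algebra_simps)
    then have "y + t *\<^sub>R z \<in> ball y s" using t(1) by (simp add: dist_norm)
    then have B: "y + t *\<^sub>R z \<in> ball x1 r1" "y + t *\<^sub>R z \<in> ball x2 r2" using s(2) by auto
    have "y + t *\<^sub>R z \<in> {y \<in> ball x1 r1. g1 (y \<bullet> e1) < y \<bullet> d1}" using t1(2)[OF t(1,2)] B(1) by simp
    then have "y + t *\<^sub>R z \<in> \<Omega> \<inter> ball x2 r2" using 1 B(2) unfolding C1_boundary_chart_def by blast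
    then have "y + t *\<^sub>R z \<in> {y \<in> ball x2 r2. g2 (y \<bullet> e2) < y \<bullet> d2}" using 2 unfolding C1_boundary_chart_def by blast
    then show False using t2(2)[OF t(1,3)] by simp
  qed
  have "b \<bullet> d2 = 1"
    using 2 by (simp add: b_def C1_boundary_chart_def inner_diff_left norm_eq_1)
  then have "b \<noteq> 0" by auto
  then have bb: "b \<bullet> b > 0" by simp
  have no: "\<not> a \<bullet> z > 0" if bz: "b \<bullet> z = 0" for z
  proof
    assume az: "a \<bullet> z > 0"
    define s where "s = a \<bullet> z / 2 / (\<bar>a \<bullet> b\<bar> + 1)"
    have s: "s > 0" using az by (simp add: s_def)
    have "s * \<bar>a \<bullet> b\<bar> < a \<bullet> z"
    proof -
      have "\<bar>a \<bullet> b\<bar> + 1 \<noteq> 0" by linarith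
      from iffD1[OF nonzero_eq_divide_eq[OF this] s_def]
      have "s * (\<bar>a \<bullet> b\<bar> + 1) = a \<bullet> z / 2" .
      then have "s * \<bar>a \<bullet> b\<bar> + s = a \<bullet> z / 2" by (simp add: algebra_simps)
      then show ?thesis using s az by linarith
    qed
    moreover have "s * (a \<bullet> b) \<le> s * \<bar>a \<bullet> b\<bar>" using s by (intro mult_left_mono) auto
    ultimately have "a \<bullet> (z - s *\<^sub>R b) > 0" by (simp add: inner_diff_right)
    then have "b \<bullet> (z - s *\<^sub>R b) \<ge> 0" by (rule *)
    then have "s * (b \<bullet> b) \<le> 0" using bz by (simp add: inner_diff_right)
    moreover have "s * (b \<bullet> b) > 0" using s bb by simp
    ultimately show False by linarith
  qed
  have "\<not> a \<bullet> z > 0" "\<not> a \<bullet> (- z) > 0" using no[of z] no[of "- z"] z by (auto simp: b_def)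
  then show ?thesis by (simp add: a_def)
qed

text \<open>
  Bumps divided by their sum \<open>S\<close>. To make the quotient globally smooth, \<open>S\<close> is replaced by
  \<open>S + flat 0 (c - S)\<close> with \<open>c\<close> the minimum of \<open>S\<close> on \<open>K\<close>: this is positive everywhere and equals \<open>S\<close>
  on \<open>K\<close>.
\<close>

lemma smooth_partition_of_unity:
  fixes K :: "(real^2) set" and r :: "real^2 \<Rightarrow> real"
  assumes "compact K" "\<And>x. x \<in> K \<Longrightarrow> r x > 0"
  obtains I \<eta> where "finite I" "I \<subseteq> K" "\<And>x k. x \<in> I \<Longrightarrow> Ck k (\<eta> x :: real^2 \<Rightarrow> real)"
    "\<And>x y. x \<in> I \<Longrightarrow> y \<notin> cball x (r x / 2) \<Longrightarrow> \<eta> x y = 0" "\<And>y. y \<in> K \<Longrightarrow> (\<Sum>x\<in>I. \<eta> x y) = 1"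
proof -
  have "K \<subseteq> (\<Union>x\<in>K. ball x (r x / 2))" using assms(2) by force
  then obtain I where I: "I \<subseteq> K" "finite I" "K \<subseteq> (\<Union>x\<in>I. ball x (r x / 2))"
    by (rule compactE_image[OF assms(1) open_ball])
  have "\<exists>b::real^2 \<Rightarrow> real. (\<forall>k. Ck k b) \<and> (\<forall>z. b z \<ge> 0) \<and> (\<forall>z. b z \<noteq> 0 \<longleftrightarrow> z \<in> ball x (r x / 2))" if "x \<in> I" for x
  proof -
    have r: "r x / 2 > 0" using assms(2) I(1) that by auto
    show ?thesis by (rule mollifier_exists[OF r, of x]) blast
  qed
  then obtain b :: "real^2 \<Rightarrow> real^2 \<Rightarrow> real" where b: "\<And>x k. x \<in> I \<Longrightarrow> Ck k (b x)" "\<And>x z. x \<in> I \<Longrightarrow> b x z \<ge> 0"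
    "\<And>x z. x \<in> I \<Longrightarrow> b x z \<noteq> 0 \<longleftrightarrow> z \<in> ball x (r x / 2)" by metis
  define S where "S y = (\<Sum>x\<in>I. b x y)" for y
  have CS: "Ck k S" for k unfolding S_def by (intro Ck_sum b(1))
  have S0: "S y \<ge> 0" for y unfolding S_def by (intro sum_nonneg b(2))
  have SK: "S y > 0" if "y \<in> K" for y
  proof -
    obtain x where x: "x \<in> I" "y \<in> ball x (r x / 2)" using I(3) \<open>y \<in> K\<close> by blast
    then have "b x y > 0" using b(2,3) by (metis less_eq_real_def)
    then show ?thesis unfolding S_def using x(1) I(2) b(2) by (intro sum_pos2) auto
  qed
  obtain c where c: "c > 0" "\<And>y. y \<in> K \<Longrightarrow> S y \<ge> c"
  proof (cases "K = {}")
    case True then show ?thesis using that[of 1] by simp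
  next
    case False
    from continuous_attains_inf[OF assms(1) this continuous_on_subset[OF continuous_Ck[OF CS]]]
    obtain z where "z \<in> K" "\<And>y. y \<in> K \<Longrightarrow> S z \<le> S y" by auto
    then show ?thesis using that[of "S z"] SK by blast
  qed
  define T where "T y = S y + flat 0 (c - S y)" for y
  have CT: "Ck k T" for k unfolding T_def by (intro Ck_add Ck_flat Ck_diff Ck_const CS)
  have T: "T y > 0" for y
  proof (cases "S y = 0")
    case True then show ?thesis using c(1) by (simp add: T_def flat_pos)
  next
    case False
    then have "S y > 0" using S0[of y] by simp
    then show ?thesis using flat_nonneg[of 0 "c - S y"] by (simp add: T_def)
  qed
  have TK: "T y = S y" if "y \<in> K" for y using c(2)[OF that] by (simp add: T_def flat_eq_0)
  show ?thesis
  proof (rule that[of I "\<lambda>x y. b x y * inverse (T y)"])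
    show "Ck k (\<lambda>y. b x y * inverse (T y))" if "x \<in> I" for x k
      by (intro Ck_mult Ck_inverse CT b(1)[OF that]) (use T in \<open>simp add: less_imp_neq[symmetric]\<close>)
    show "b x y * inverse (T y) = 0" if "x \<in> I" "y \<notin> cball x (r x / 2)" for x y
      using b(3)[OF that(1), of y] that(2) by auto
    show "(\<Sum>x\<in>I. b x y * inverse (T y)) = 1" if "y \<in> K" for y
      using SK[OF that] TK[OF that] by (simp add: sum_distrib_right[symmetric] S_def[symmetric])
  qed (use I in auto)
qed

section \<open>Orthogonality of gradients and solenoidal fields\<close>

lemma bounded_zero_extension:
  fixes v V :: "'a::euclidean_space \<Rightarrow> 'b::euclidean_space"
  assumes "bounded \<Omega>" "continuous_on (closure \<Omega>) v"
    and V: "\<And>x. x \<in> \<Omega> \<Longrightarrow> V x = v x" "\<And>x. x \<notin> \<Omega> \<Longrightarrow> V x = 0"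
  obtains M where "\<And>x. norm (V x) \<le> M"
proof -
  have "bounded (v ` closure \<Omega>)"
    using assms(1,2) by (intro compact_imp_bounded compact_continuous_image) (simp_all add: compact_closure)
  then obtain M where "M > 0" "\<And>x. x \<in> closure \<Omega> \<Longrightarrow> norm (v x) \<le> M" by (auto simp: bounded_pos)
  then have "norm (V x) \<le> M" for x
    using V closure_subset[of \<Omega>] by (cases "x \<in> \<Omega>") auto
  then show ?thesis using that by blast
qed

text \<open>
  Integration by parts on the support of a cut-off \<open>\<eta>\<close>, without trace theory for \<open>p\<close>. Convolution
  of \<open>V\<close> with a mollifier centred at \<open>h d\<close>, of radius small compared with \<open>h\<close>, moves the support
  into \<open>\<Omega>\<close>, so \<open>\<eta>\<close> times the result is an admissible test function in the definition of the weak
  gradient of \<open>p\<close>. It is divergence free by \<open>flux_vanishes_near_boundary\<close>, and it converges to \<open>V\<close>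
  boundedly and pointwise on \<open>\<Omega>\<close> as \<open>h\<close> tends to 0.
\<close>

lemma chart_integration_by_parts:
  fixes V v W :: "real^2 \<Rightarrow> real^2" and p :: "real^2 \<Rightarrow> real"
  assumes chart: "C1_boundary_chart \<Omega> x0 r e d g g'"
    and \<Omega>: "open \<Omega>" "bounded \<Omega>"
    and V: "integrable lborel V" "\<And>x. x \<in> \<Omega> \<Longrightarrow> V x = v x" "\<And>x. x \<notin> \<Omega> \<Longrightarrow> V x = 0"
    and v: "continuous_on (closure \<Omega>) v"
    and tangential: "\<And>y. y \<in> frontier \<Omega> \<Longrightarrow> y \<in> ball x0 r \<Longrightarrow> (d - g' (y \<bullet> e) *\<^sub>R e) \<bullet> v y = 0"
    and D: "\<And>\<phi>. test_function \<Omega> \<phi> \<Longrightarrow> (LINT x|lborel. gradient \<phi> x \<bullet> V x) = 0"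
    and p: "\<And>i. has_weak_partial \<Omega> i p (\<lambda>x. W x $ i)"
      "integrable (lebesgue_on \<Omega>) p" "integrable (lebesgue_on \<Omega>) W"
    and \<eta>: "\<And>k. Ck k \<eta>" "compact C" "C \<subseteq> ball x0 r" "\<And>x. x \<notin> C \<Longrightarrow> \<eta> x = 0"
  shows "(LINT x|lebesgue_on \<Omega>. p x * (gradient \<eta> x \<bullet> V x) + \<eta> x * (W x \<bullet> V x)) = 0"
proof -
  have ch: "\<And>s. (g has_real_derivative g' s) (at s)" "continuous_on UNIV g'" "norm e = 1" "norm d = 1" "e \<bullet> d = 0"
    "\<Omega> \<inter> ball x0 r = {y \<in> ball x0 r. g (y \<bullet> e) < y \<bullet> d}"
    using chart by (auto simp: C1_boundary_chart_def)
  obtain \<delta> where \<delta>: "\<delta> > 0" "(\<Union>x\<in>C. cball x \<delta>) \<subseteq> ball x0 r"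
    using compact_subset_open_imp_cball_epsilon_subset[OF \<eta>(2) open_ball \<eta>(3)] by blast
  define R where "R = norm x0 + r"
  have "compact (g' ` {-R..R})"
    by (intro compact_continuous_image continuous_on_subset[OF ch(2)]) auto
  then obtain L where L: "L > 0" "\<And>s. s \<in> {-R..R} \<Longrightarrow> norm (g' s) \<le> L"
    using compact_imp_bounded bounded_pos by (metis imageI)
  have lip: "\<bar>g s - g t\<bar> \<le> L * \<bar>s - t\<bar>" if "s \<in> {-R..R}" "t \<in> {-R..R}" for s t
  proof -
    have "norm (g s - g t) \<le> L * norm (s - t)"
      by (rule field_differentiable_bound[of "{-R..R}" g g'])
         (use that L(2) has_field_derivative_at_within[OF ch(1)] in auto)
    then show ?thesis by simp
  qed
  have inR: "y \<bullet> e \<in> {-R..R}" if "y \<in> ball x0 r" for y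
  proof -
    have "\<bar>y \<bullet> e\<bar> \<le> norm y" using Cauchy_Schwarz_ineq2[of y e] ch(3) by simp
    moreover have "norm y \<le> R"
      using that norm_triangle_ineq2[of y x0] by (simp add: R_def dist_norm norm_minus_commute)
    ultimately show ?thesis by auto
  qed
  define h where "h n = \<delta> / 2 / real (Suc n)" for n
  define \<epsilon> where "\<epsilon> n = h n / (L + 2)" for n
  have h: "h n > 0" "h n \<le> \<delta> / 2" for n using \<delta>(1) by (auto simp: h_def field_simps)
  have \<epsilon>: "\<epsilon> n > 0" "\<epsilon> n \<le> h n" "h n - (L + 1) * \<epsilon> n = \<epsilon> n" for n
    using h(1)[of n] L(1) by (auto simp: \<epsilon>_def field_simps)
  have hlim: "(\<lambda>n. 2 * h n) \<longlonglongrightarrow> 0"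
    using tendsto_mult_right_zero[OF LIMSEQ_Suc[OF lim_const_over_n[of "\<delta> / 2"]], of 2] by (simp add: h_def)
  have "\<exists>K::real^2 \<Rightarrow> real. (\<forall>k. Ck k K) \<and> (\<forall>z. K z \<ge> 0) \<and> (\<forall>z. K z \<noteq> 0 \<longleftrightarrow> z \<in> ball (h n *\<^sub>R d) (\<epsilon> n)) \<and> integral\<^sup>L lborel K = 1" for n
    by (rule mollifier_exists[OF \<epsilon>(1)[of n], of "h n *\<^sub>R d"]) blast
  then obtain K :: "nat \<Rightarrow> real^2 \<Rightarrow> real" where K: "\<And>n k. Ck k (K n)" "\<And>n z. K n z \<ge> 0"
    "\<And>n z. K n z \<noteq> 0 \<longleftrightarrow> z \<in> ball (h n *\<^sub>R d) (\<epsilon> n)" "\<And>n. integral\<^sup>L lborel (K n) = 1" by metis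
  have Kc: "continuous_on UNIV (K n)" for n using continuous_Ck[OF K(1)] .
  have Ko: "z \<notin> cball (h n *\<^sub>R d) (\<epsilon> n) \<Longrightarrow> K n z = 0" for n z using K(3)[of n z] by auto
  have cb: "norm z \<le> 2 * h n" if "z \<in> cball (h n *\<^sub>R d) (\<epsilon> n)" for n z
  proof -
    have "norm z \<le> norm (h n *\<^sub>R d) + norm (h n *\<^sub>R d - z)"
      using norm_triangle_ineq4[of "h n *\<^sub>R d" "h n *\<^sub>R d - z"] by simp
    also have "\<dots> \<le> h n + \<epsilon> n" using that h(1)[of n] ch(4) by (simp add: dist_norm)
    finally show ?thesis using \<epsilon>(2)[of n] by simp
  qed
  have cb\<delta>: "norm z \<le> \<delta>" if "z \<in> cball (h n *\<^sub>R d) (\<epsilon> n)" for n z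
    using cb[OF that] h(2)[of n] by simp
  define U where "U n = conv (K n) V" for n
  have CU: "Ck k (U n)" for k n unfolding U_def by (rule Ck_conv[OF compact_cball V(1) K(1) Ko])
  \<comment> \<open>On \<open>Z n\<close>, moving by \<open>z\<close> raises \<open>y \<bullet> d\<close> by at least \<open>h n - \<epsilon> n\<close>, but \<open>g\<close> by at most \<open>L * \<epsilon> n\<close>;
    the choice of \<open>\<epsilon>\<close> leaves a gap of \<open>\<epsilon> n\<close>.\<close>
  define Z where "Z n = C \<inter> {y + z | y z. y \<in> closure \<Omega> \<and> z \<in> cball (h n *\<^sub>R d) (\<epsilon> n)}" for n
  have cZ: "compact (Z n)" for n
    unfolding Z_def using \<Omega>(2) by (intro compact_Int \<eta>(2) compact_sums compact_cball) (simp add: compact_closure)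
  have Z\<Omega>: "Z n \<subseteq> \<Omega>" for n
  proof
    fix x assume "x \<in> Z n"
    then obtain y z where x: "x \<in> C" "x = y + z" "y \<in> closure \<Omega>" "z \<in> cball (h n *\<^sub>R d) (\<epsilon> n)"
      by (auto simp: Z_def)
    have "y \<in> cball x \<delta>" using cb\<delta>[OF x(4)] x(2) by (simp add: dist_norm)
    then have yB: "y \<in> ball x0 r" using x(1) \<delta>(2) by blast
    have xB: "x \<in> ball x0 r" using x(1) \<eta>(3) by blast
    have nz: "norm (z - h n *\<^sub>R d) \<le> \<epsilon> n" using x(4) by (simp add: dist_norm norm_minus_commute)
    have "\<bar>(z - h n *\<^sub>R d) \<bullet> e\<bar> \<le> \<epsilon> n" "\<bar>(z - h n *\<^sub>R d) \<bullet> d\<bar> \<le> \<epsilon> n"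
      using nz Cauchy_Schwarz_ineq2[of "z - h n *\<^sub>R d" e] Cauchy_Schwarz_ineq2[of "z - h n *\<^sub>R d" d] ch(3,4) by auto
    then have ze: "\<bar>z \<bullet> e\<bar> \<le> \<epsilon> n" and zd: "z \<bullet> d \<ge> h n - \<epsilon> n"
      using ch(4,5) by (auto simp: inner_diff_left inner_commute[of d e] norm_eq_1)
    have "\<bar>g (x \<bullet> e) - g (y \<bullet> e)\<bar> \<le> L * \<bar>x \<bullet> e - y \<bullet> e\<bar>" by (rule lip[OF inR[OF xB] inR[OF yB]])
    also have "\<dots> \<le> L * \<epsilon> n" using ze L(1) by (simp add: x(2) inner_add_left)
    finally have "g (x \<bullet> e) \<le> g (y \<bullet> e) + L * \<epsilon> n" by linarith
    also have "\<dots> \<le> y \<bullet> d + L * \<epsilon> n" using chart_closure(1)[OF chart x(3) yB] by simp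
    also have "\<dots> < y \<bullet> d + (h n - \<epsilon> n)" using \<epsilon>(1,3)[of n] by (simp add: algebra_simps)
    also have "\<dots> \<le> x \<bullet> d" using zd by (simp add: x(2) inner_add_left)
    finally show "x \<in> \<Omega>" using ch(6) xB by blast
  qed
  have \<eta>U: "\<eta> x *\<^sub>R U n x = 0" if "x \<notin> Z n" for n x
  proof (cases "x \<in> C")
    case True
    have "K n (x - y) *\<^sub>R V y = 0" for y
    proof (cases "y \<in> \<Omega>")
      case y: True
      have "x - y \<notin> cball (h n *\<^sub>R d) (\<epsilon> n)"
      proof
        assume "x - y \<in> cball (h n *\<^sub>R d) (\<epsilon> n)"
        moreover have "y \<in> closure \<Omega>" using y closure_subset by blast
        moreover have "x = y + (x - y)" by simp
        ultimately have "x \<in> Z n" using True unfolding Z_def by blast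
        with that show False by simp
      qed
      then show ?thesis using Ko by simp
    qed (simp add: V(3))
    then have "U n x = 0" by (simp only: U_def conv_def Bochner_Integration.integral_zero)
    then show ?thesis by simp
  qed (simp add: \<eta>(4))
  have pU: "partial i (U n) = conv (partial i (K n)) V" for i n
    unfolding U_def by (rule partial_conv[OF K(1) compact_cball Ko V(1)])
  \<comment> \<open>The divergence at \<open>x\<close> is the flux of \<open>V\<close> against the reflected and translated kernel.\<close>
  have divU: "(\<Sum>i\<in>UNIV. partial i (U n) x $ i) = 0" if x: "x \<in> C" for n x
  proof -
    define \<phi> where "\<phi> y = K n (x + (-1) *\<^sub>R y)" for y
    have C\<phi>: "Ck k \<phi>" for k unfolding \<phi>_def by (rule Ck_affine[OF K(1)])
    have par: "partial i \<phi> y = - partial i (K n) (x - y)" for i y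
      using partial_affine(1)[of "K n" i x "-1"] K(1)[of 1 n] by (simp add: \<phi>_def[abs_def])
    have "(LINT y|lborel. gradient \<phi> y \<bullet> V y) = 0"
    proof (rule flux_vanishes_near_boundary[OF chart \<Omega> V v tangential D C\<phi> _ compact_cball])
      show "\<phi> y \<ge> 0" for y using K(2) by (simp add: \<phi>_def)
      show "cball (x - h n *\<^sub>R d) (\<epsilon> n) \<subseteq> ball x0 r"
      proof
        fix y assume y: "y \<in> cball (x - h n *\<^sub>R d) (\<epsilon> n)"
        then have "x - y \<in> cball (h n *\<^sub>R d) (\<epsilon> n)" by (simp add: dist_norm algebra_simps norm_minus_commute)
        then have "y \<in> cball x \<delta>" using cb\<delta> by (simp add: dist_norm)
        then show "y \<in> ball x0 r" using x \<delta>(2) by blast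
      qed
      show "\<phi> y = 0" if "y \<notin> cball (x - h n *\<^sub>R d) (\<epsilon> n)" for y
      proof -
        have "x - y \<notin> cball (h n *\<^sub>R d) (\<epsilon> n)" using that by (simp add: dist_norm algebra_simps norm_minus_commute)
        then show ?thesis using Ko by (simp add: \<phi>_def)
      qed
    qed
    then have 0: "(LINT y|lborel. (\<Sum>i\<in>UNIV. - (partial i (K n) (x - y) * V y $ i))) = 0"
      by (simp add: gradient_inner par)
    have int: "integrable lborel (\<lambda>y. partial i (K n) (x - y) *\<^sub>R V y)" for i
    proof (rule integrable_conv[OF _ compact_cball _ V(1)])
      show "continuous_on UNIV (partial i (K n))" using K(1)[of 1 n] by simp
      show "z \<notin> cball (h n *\<^sub>R d) (\<epsilon> n) \<Longrightarrow> partial i (K n) z = 0" for z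
        by (rule partial_eq_0_outside[OF closed_cball Ko])
    qed
    have int': "integrable lborel (\<lambda>y. partial i (K n) (x - y) * V y $ i)" for i
      using integrable_inner_left[of "axis i 1", OF int] by (simp add: inner_axis)
    have "partial i (U n) x $ i = (LINT y|lborel. partial i (K n) (x - y) * V y $ i)" for i
    proof -
      have "partial i (U n) x \<bullet> axis i 1 = (LINT y|lborel. (partial i (K n) (x - y) *\<^sub>R V y) \<bullet> axis i 1)"
        unfolding pU conv_def using int by (intro integral_inner_left[symmetric])
      then show ?thesis by (simp add: inner_axis)
    qed
    then have "(\<Sum>i\<in>UNIV. partial i (U n) x $ i) = (LINT y|lborel. (\<Sum>i\<in>UNIV. partial i (K n) (x - y) * V y $ i))"
      by (simp add: Bochner_Integration.integral_sum int')
    also have "\<dots> = 0" using 0 by (simp add: sum_negf)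
    finally show ?thesis .
  qed
  have zero: "(LINT x|lebesgue_on \<Omega>. p x * (gradient \<eta> x \<bullet> U n x) + \<eta> x * (W x \<bullet> U n x)) = 0" for n
  proof -
    define f where "f i x = \<eta> x * U n x $ i" for i x
    have Cf: "Ck k (f i)" for k i
      unfolding f_def by (intro Ck_mult \<eta>(1) Ck_bounded_linear_comp[OF bounded_linear_vec_nth] CU)
    have f0: "x \<notin> Z n \<Longrightarrow> f i x = 0" for i x using \<eta>U[of x n] by (auto simp: f_def)
    have tf: "test_function \<Omega> (f i)" for i by (rule test_functionI[OF Cf cZ Z\<Omega> f0])
    have cf: "continuous_on UNIV (f i)" "continuous_on UNIV (partial i (f i))" for i
      using continuous_Ck[OF Cf] Cf[of 1 i] by auto
    have f0': "x \<notin> Z n \<Longrightarrow> partial i (f i) x = 0" for i x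
      by (rule partial_eq_0_outside[OF compact_imp_closed[OF cZ] f0])
    have pf: "partial i (f i) x = \<eta> x * partial i (U n) x $ i + partial i \<eta> x * U n x $ i" for i x
    proof -
      have 1: "partial i (\<lambda>x. U n x $ i) x = partial i (U n) x $ i"
      proof -
        have "(U n has_derivative frechet_derivative (U n) (at x)) (at x)" by (rule Ck_has_derivative[OF CU])
        from partial_has_derivative[OF bounded_linear.has_derivative[OF bounded_linear_vec_nth this]]
        show ?thesis by (simp add: partial_def)
      qed
      have "Ck 1 (\<lambda>x. U n x $ i)" by (rule Ck_bounded_linear_comp[OF bounded_linear_vec_nth CU])
      then have "(\<lambda>x. U n x $ i) differentiable at x" by simp
      moreover have "\<eta> differentiable at x" using \<eta>(1)[of 1] by simp
      ultimately show ?thesis using partial_scaleR[of \<eta> x "\<lambda>x. U n x $ i" i] 1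
        by (simp add: f_def[abs_def])
    qed
    have eq: "(LINT x|lebesgue_on \<Omega>. partial i (f i) x * p x + f i x * W x $ i) = 0"
      and int: "integrable (lebesgue_on \<Omega>) (\<lambda>x. partial i (f i) x * p x + f i x * W x $ i)" for i
    proof -
      have li: "locally_integrable \<Omega> p" "locally_integrable \<Omega> (\<lambda>x. W x $ i)"
        using p(1)[of i] by (auto simp: has_weak_partial_def)
      have 1: "integrable (lebesgue_on \<Omega>) (\<lambda>x. partial i (f i) x *\<^sub>R p x)"
        by (rule integrable_times_locally_integrable[OF \<Omega>(1) li(1) cf(2) cZ Z\<Omega> f0'])
      have 2: "integrable (lebesgue_on \<Omega>) (\<lambda>x. f i x *\<^sub>R W x $ i)"
        by (rule integrable_times_locally_integrable[OF \<Omega>(1) li(2) cf(1) cZ Z\<Omega> f0])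
      have "(LINT x|lebesgue_on \<Omega>. partial i (f i) x *\<^sub>R p x) = - (LINT x|lebesgue_on \<Omega>. f i x *\<^sub>R W x $ i)"
        using p(1)[of i] tf[of i] by (auto simp: has_weak_partial_def)
      then show "(LINT x|lebesgue_on \<Omega>. partial i (f i) x * p x + f i x * W x $ i) = 0"
        using Bochner_Integration.integral_add[OF 1 2] by simp
      show "integrable (lebesgue_on \<Omega>) (\<lambda>x. partial i (f i) x * p x + f i x * W x $ i)"
        using Bochner_Integration.integrable_add[OF 1 2] by simp
    qed
    have "p x * (gradient \<eta> x \<bullet> U n x) + \<eta> x * (W x \<bullet> U n x) = (\<Sum>i\<in>UNIV. partial i (f i) x * p x + f i x * W x $ i)" for x
    proof -
      have "(\<Sum>i\<in>UNIV. partial i (f i) x * p x + f i x * W x $ i)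
          = \<eta> x * p x * (\<Sum>i\<in>UNIV. partial i (U n) x $ i) + p x * (gradient \<eta> x \<bullet> U n x) + \<eta> x * (W x \<bullet> U n x)"
        by (simp add: pf f_def gradient_def inner_vec_def sum_2 algebra_simps)
      moreover have "\<eta> x * (\<Sum>i\<in>UNIV. partial i (U n) x $ i) = 0"
        using divU \<eta>(4) by (cases "x \<in> C") auto
      ultimately show ?thesis by (auto simp: mult.assoc)
    qed
    then show ?thesis using eq int by (simp add: Bochner_Integration.integral_sum)
  qed
  obtain M where M: "\<And>x. norm (V x) \<le> M"
    using bounded_zero_extension[OF \<Omega>(2) v V(2,3)] by blast
  have MU: "norm (U n x) \<le> M" for n x
    unfolding U_def by (rule norm_conv_le[OF Kc K(2) compact_cball Ko K(4) V(1) M])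
  have M0: "M \<ge> 0" using M[of 0] norm_ge_zero order_trans by blast
  have \<eta>c: "continuous_on UNIV \<eta>" "continuous_on UNIV (gradient \<eta>)"
    using continuous_Ck[OF \<eta>(1)] continuous_gradient[OF \<eta>(1)] by auto
  obtain E where E: "E > 0" "\<And>x. norm (\<eta> x) \<le> E" using bounded_compact_support[OF \<eta>c(1) \<eta>(2,4)] by blast
  obtain G where G: "G > 0" "\<And>x. norm (gradient \<eta> x) \<le> G"
    using bounded_compact_support[OF \<eta>c(2) \<eta>(2) gradient_eq_0_outside[OF \<eta>(2,4)]] by blast
  have pm: "p \<in> borel_measurable (lebesgue_on \<Omega>)" "W \<in> borel_measurable (lebesgue_on \<Omega>)"
    using p(2,3) by auto
  have \<eta>m: "\<eta> \<in> borel_measurable (lebesgue_on \<Omega>)" "gradient \<eta> \<in> borel_measurable (lebesgue_on \<Omega>)"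
    using \<eta>c by (auto intro!: borel_measurable_lebesgue_on borel_measurable_continuous_onI)
  have Vm: "V \<in> borel_measurable (lebesgue_on \<Omega>)" "U n \<in> borel_measurable (lebesgue_on \<Omega>)" for n
    using borel_measurable_integrable[OF V(1)] continuous_Ck[OF CU] by (auto intro!: borel_measurable_lebesgue_on borel_measurable_continuous_onI)
  have "(\<lambda>n. LINT x|lebesgue_on \<Omega>. p x * (gradient \<eta> x \<bullet> U n x) + \<eta> x * (W x \<bullet> U n x))
      \<longlonglongrightarrow> (LINT x|lebesgue_on \<Omega>. p x * (gradient \<eta> x \<bullet> V x) + \<eta> x * (W x \<bullet> V x))"
  proof (rule integral_dominated_convergence[where w = "\<lambda>x. G * M * norm (p x) + E * M * norm (W x)"])
    show "(\<lambda>x. p x * (gradient \<eta> x \<bullet> V x) + \<eta> x * (W x \<bullet> V x)) \<in> borel_measurable (lebesgue_on \<Omega>)"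
      "(\<lambda>x. p x * (gradient \<eta> x \<bullet> U n x) + \<eta> x * (W x \<bullet> U n x)) \<in> borel_measurable (lebesgue_on \<Omega>)" for n
      by (intro borel_measurable_add borel_measurable_times borel_measurable_inner pm \<eta>m Vm)+
    show "integrable (lebesgue_on \<Omega>) (\<lambda>x. G * M * norm (p x) + E * M * norm (W x))"
      by (intro Bochner_Integration.integrable_add integrable_mult_right integrable_norm p)
    show "AE x in lebesgue_on \<Omega>. (\<lambda>n. p x * (gradient \<eta> x \<bullet> U n x) + \<eta> x * (W x \<bullet> U n x))
        \<longlonglongrightarrow> p x * (gradient \<eta> x \<bullet> V x) + \<eta> x * (W x \<bullet> V x)"
    proof (rule AE_I2)
      fix x assume "x \<in> space (lebesgue_on \<Omega>)"
      then have x: "x \<in> \<Omega>" by simp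
      have "continuous_on \<Omega> V"
        using continuous_on_subset[OF v closure_subset] V(2) by (simp cong: continuous_on_cong)
      then have "isCont V x" using x \<Omega>(1) by (simp add: continuous_on_eq_continuous_at)
      then have "(\<lambda>n. U n x) \<longlonglongrightarrow> V x"
        unfolding U_def
        by (intro conv_tendsto[OF Kc K(2) _ K(4) hlim V(1)]) (use cb Ko in blast)+
      then show "(\<lambda>n. p x * (gradient \<eta> x \<bullet> U n x) + \<eta> x * (W x \<bullet> U n x))
        \<longlonglongrightarrow> p x * (gradient \<eta> x \<bullet> V x) + \<eta> x * (W x \<bullet> V x)" by (intro tendsto_intros)
    qed
    show "AE x in lebesgue_on \<Omega>. norm (p x * (gradient \<eta> x \<bullet> U n x) + \<eta> x * (W x \<bullet> U n x))
        \<le> G * M * norm (p x) + E * M * norm (W x)" for n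
    proof (intro always_eventually allI order_trans[OF norm_triangle_ineq] add_mono)
      fix x
      have "\<bar>gradient \<eta> x \<bullet> U n x\<bar> \<le> norm (gradient \<eta> x) * norm (U n x)" by (rule Cauchy_Schwarz_ineq2)
      also have "\<dots> \<le> G * M" using G MU M0 by (intro mult_mono) auto
      finally show "norm (p x * (gradient \<eta> x \<bullet> U n x)) \<le> G * M * norm (p x)"
        by (simp add: abs_mult mult.commute[of "G * M"] mult_left_mono)
      have "\<bar>W x \<bullet> U n x\<bar> \<le> norm (W x) * norm (U n x)" by (rule Cauchy_Schwarz_ineq2)
      also have "\<dots> \<le> norm (W x) * M" using MU by (intro mult_left_mono) auto
      finally have "\<bar>\<eta> x\<bar> * \<bar>W x \<bullet> U n x\<bar> \<le> E * (norm (W x) * M)" using E by (intro mult_mono) (auto intro: less_imp_le)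
      then show "norm (\<eta> x * (W x \<bullet> U n x)) \<le> E * M * norm (W x)" by (simp add: abs_mult mult.assoc mult.commute[of M])
    qed
  qed
  then show ?thesis by (simp add: zero LIMSEQ_const_iff)
qed

lemma sum_gradient_partition_of_unity:
  assumes "open \<Omega>" "x \<in> \<Omega>" "\<And>j. j \<in> I \<Longrightarrow> \<eta> j differentiable at x" "\<And>y. y \<in> \<Omega> \<Longrightarrow> (\<Sum>j\<in>I. \<eta> j y) = (1::real)"
  shows "(\<Sum>j\<in>I. gradient (\<eta> j) x) = 0"
proof -
  have "((\<lambda>y. \<Sum>j\<in>I. \<eta> j y) has_derivative (\<lambda>h. \<Sum>j\<in>I. frechet_derivative (\<eta> j) (at x) h)) (at x)"
    using assms(3) by (intro has_derivative_sum) (simp add: frechet_derivative_works)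
  moreover have "((\<lambda>y. \<Sum>j\<in>I. \<eta> j y) has_derivative (\<lambda>h. 0)) (at x)"
    by (rule has_derivative_transform_within_open[of "\<lambda>y. 1" _ _ _ \<Omega>]) (use assms in auto)
  ultimately have "(\<lambda>h. \<Sum>j\<in>I. frechet_derivative (\<eta> j) (at x) h) = (\<lambda>h. 0)"
    by (rule has_derivative_unique)
  then have "(\<Sum>j\<in>I. partial i (\<eta> j) x) = 0" for i
    unfolding partial_def by metis
  then show ?thesis by (simp add: vec_eq_iff gradient_def)
qed

text \<open>
  Summation of the local identities over a partition of unity; the terms with \<open>\<nabla>\<eta>\<close> add up to zero.
\<close>

lemma integral_gradient_inner_eq_0:
  fixes V v W :: "real^2 \<Rightarrow> real^2" and p :: "real^2 \<Rightarrow> real"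
  assumes \<Omega>: "open \<Omega>" "bounded \<Omega>" "C1_boundary \<Omega>"
    and normal: "\<And>x. x \<in> frontier \<Omega> \<Longrightarrow> outward_unit_normal \<Omega> x (\<n> x)"
    and V: "integrable lborel V" "\<And>x. x \<in> \<Omega> \<Longrightarrow> V x = v x" "\<And>x. x \<notin> \<Omega> \<Longrightarrow> V x = 0"
    and v: "continuous_on (closure \<Omega>) v" "\<And>x. x \<in> frontier \<Omega> \<Longrightarrow> v x \<bullet> \<n> x = 0"
    and D: "\<And>\<phi>. test_function \<Omega> \<phi> \<Longrightarrow> (LINT x|lborel. gradient \<phi> x \<bullet> V x) = 0"
    and p: "\<And>i. has_weak_partial \<Omega> i p (\<lambda>x. W x $ i)"
      "integrable (lebesgue_on \<Omega>) p" "integrable (lebesgue_on \<Omega>) W"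
  shows "(LINT x|lebesgue_on \<Omega>. W x \<bullet> V x) = 0"
proof -
  define F where "F \<eta> x = p x * (gradient \<eta> x \<bullet> V x) + \<eta> x * (W x \<bullet> V x)" for \<eta> x
  have "\<exists>r>0. \<forall>\<eta> C. (\<forall>k. Ck k \<eta>) \<and> compact C \<and> C \<subseteq> ball x r \<and> (\<forall>y. y \<notin> C \<longrightarrow> \<eta> y = 0)
      \<longrightarrow> integral\<^sup>L (lebesgue_on \<Omega>) (F \<eta>) = 0" if x: "x \<in> closure \<Omega>" for x
  proof -
    have "\<exists>r e d g g'. C1_boundary_chart \<Omega> x r e d g g'"
    proof (cases "x \<in> \<Omega>")
      case True then show ?thesis by (rule interior_chart[OF \<Omega>(1)])
    next
      case False
      then have "x \<in> frontier \<Omega>" using x \<Omega>(1) by (simp add: frontier_def interior_open)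
      then show ?thesis using \<Omega>(3) by (simp add: C1_boundary_def)
    qed
    then obtain r e d g g' where chart: "C1_boundary_chart \<Omega> x r e d g g'" by blast
    have tangential: "(d - g' (y \<bullet> e) *\<^sub>R e) \<bullet> v y = 0" if y: "y \<in> frontier \<Omega>" "y \<in> ball x r" for y
    proof -
      obtain r2 e2 d2 g2 g2' where 2: "C1_boundary_chart \<Omega> y r2 e2 d2 g2 g2'"
        "\<n> y = (1 / sqrt (1 + (g2' (y \<bullet> e2))\<^sup>2)) *\<^sub>R (g2' (y \<bullet> e2) *\<^sub>R e2 - d2)"
        using normal[OF y(1)] by (auto simp: outward_unit_normal_def)
      have "sqrt (1 + (g2' (y \<bullet> e2))\<^sup>2) \<noteq> 0"
        using zero_le_power2[of "g2' (y \<bullet> e2)"] by (simp add: add_nonneg_eq_0_iff)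
      then have "(g2' (y \<bullet> e2) *\<^sub>R e2 - d2) \<bullet> v y = 0"
        using v(2)[OF y(1)] by (simp add: 2(2) inner_commute[of "v y"])
      then have z: "(d2 - g2' (y \<bullet> e2) *\<^sub>R e2) \<bullet> v y = 0" by (simp add: inner_diff_left)
      have "y \<in> closure \<Omega>" "y \<notin> \<Omega>" using y(1) \<Omega>(1) by (auto simp: frontier_def interior_open)
      moreover have "y \<in> ball y r2" using 2(1) by (simp add: C1_boundary_chart_def)
      ultimately show ?thesis using chart_normals_parallel[OF chart 2(1) _ _ y(2) _ z] by blast
    qed
    have "integral\<^sup>L (lebesgue_on \<Omega>) (F \<eta>) = 0"
      if "(\<forall>k. Ck k \<eta>) \<and> compact C \<and> C \<subseteq> ball x r \<and> (\<forall>y. y \<notin> C \<longrightarrow> \<eta> y = 0)" for \<eta> C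
      unfolding F_def
      by (rule chart_integration_by_parts[OF chart \<Omega>(1,2) V v(1) tangential D p, of \<eta> C]) (use that in auto)
    moreover have "r > 0" using chart by (simp add: C1_boundary_chart_def)
    ultimately show ?thesis by blast
  qed
  then obtain r where r: "\<And>x. x \<in> closure \<Omega> \<Longrightarrow> r x > 0"
    "\<And>x \<eta> C. x \<in> closure \<Omega> \<Longrightarrow> (\<forall>k. Ck k \<eta>) \<Longrightarrow> compact C \<Longrightarrow> C \<subseteq> ball x (r x) \<Longrightarrow> (\<forall>y. y \<notin> C \<longrightarrow> \<eta> y = 0)
      \<Longrightarrow> integral\<^sup>L (lebesgue_on \<Omega>) (F \<eta>) = 0" by metis
  have K: "compact (closure \<Omega>)" using \<Omega>(2) by (simp add: compact_closure)
  obtain I and \<eta> :: "real^2 \<Rightarrow> real^2 \<Rightarrow> real" where I: "finite I" "I \<subseteq> closure \<Omega>"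
    and \<eta>: "\<And>x k. x \<in> I \<Longrightarrow> Ck k (\<eta> x)" "\<And>x y. x \<in> I \<Longrightarrow> y \<notin> cball x (r x / 2) \<Longrightarrow> \<eta> x y = 0"
      "\<And>y. y \<in> closure \<Omega> \<Longrightarrow> (\<Sum>x\<in>I. \<eta> x y) = 1" 
  proof (rule smooth_partition_of_unity[OF K, of r])
    show "x \<in> closure \<Omega> \<Longrightarrow> 0 < r x" for x by (rule r(1))
    fix I and \<eta> :: "real^2 \<Rightarrow> real^2 \<Rightarrow> real"
    assume "finite I" "I \<subseteq> closure \<Omega>" "\<And>x k. x \<in> I \<Longrightarrow> Ck k (\<eta> x)"
      "\<And>x y. x \<in> I \<Longrightarrow> y \<notin> cball x (r x / 2) \<Longrightarrow> \<eta> x y = 0"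
      "\<And>y. y \<in> closure \<Omega> \<Longrightarrow> (\<Sum>x\<in>I. \<eta> x y) = 1"
    then show thesis by (rule that)
  qed
  have F0: "integral\<^sup>L (lebesgue_on \<Omega>) (F (\<eta> x)) = 0" if "x \<in> I" for x
  proof (rule r(2))
    show x: "x \<in> closure \<Omega>" using that I(2) by blast
    show "cball x (r x / 2) \<subseteq> ball x (r x)" using r(1)[OF x] by auto
  qed (use that \<eta> in auto)
  obtain M where M: "\<And>x. norm (V x) \<le> M"
    using bounded_zero_extension[OF \<Omega>(2) v(1) V(2,3)] by blast
  have M0: "M \<ge> 0" using M[of 0] norm_ge_zero order_trans by blast
  have Vm: "V \<in> borel_measurable (lebesgue_on \<Omega>)"
    using borel_measurable_integrable[OF V(1)] by (intro borel_measurable_lebesgue_on) simp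
  have WV: "integrable (lebesgue_on \<Omega>) (\<lambda>x. W x \<bullet> V x)"
  proof (rule Bochner_Integration.integrable_bound[where f = "\<lambda>x. M *\<^sub>R W x"])
    show "integrable (lebesgue_on \<Omega>) (\<lambda>x. M *\<^sub>R W x)" using p(3) by (rule integrable_scaleR_right)
    show "(\<lambda>x. W x \<bullet> V x) \<in> borel_measurable (lebesgue_on \<Omega>)" using p(3) Vm by auto
    show "AE x in lebesgue_on \<Omega>. norm (W x \<bullet> V x) \<le> norm (M *\<^sub>R W x)"
    proof (intro always_eventually allI)
      fix x
      have "norm (W x \<bullet> V x) \<le> norm (W x) * norm (V x)" by (simp add: Cauchy_Schwarz_ineq2)
      also have "\<dots> \<le> norm (W x) * M" by (intro mult_left_mono M) simp
      finally show "norm (W x \<bullet> V x) \<le> norm (M *\<^sub>R W x)" using M0 by (simp add: mult.commute)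
    qed
  qed
  have FI: "integrable (lebesgue_on \<Omega>) (F (\<eta> x))" if xI: "x \<in> I" for x
  proof -
    have c: "continuous_on UNIV (\<eta> x)" "continuous_on UNIV (gradient (\<eta> x))"
      using continuous_Ck[OF \<eta>(1)[OF xI]] continuous_gradient[OF \<eta>(1)[OF xI]] by auto
    obtain E where E: "E > 0" "\<And>y. norm (\<eta> x y) \<le> E"
      using bounded_compact_support[OF c(1) compact_cball \<eta>(2)[OF xI]] by blast
    have o: "y \<notin> cball x (r x / 2) \<Longrightarrow> gradient (\<eta> x) y = 0" for y
      by (rule gradient_eq_0_outside[OF compact_cball \<eta>(2)[OF xI]])
    obtain G where G: "G > 0" "\<And>y. norm (gradient (\<eta> x) y) \<le> G"
      using bounded_compact_support[OF c(2) compact_cball o] by blast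
    have m: "\<eta> x \<in> borel_measurable (lebesgue_on \<Omega>)" "gradient (\<eta> x) \<in> borel_measurable (lebesgue_on \<Omega>)"
      using c by (auto intro!: borel_measurable_lebesgue_on borel_measurable_continuous_onI)
    have "\<bar>gradient (\<eta> x) y \<bullet> V y\<bar> \<le> G * M" for y
    proof -
      have "\<bar>gradient (\<eta> x) y \<bullet> V y\<bar> \<le> norm (gradient (\<eta> x) y) * norm (V y)" by (rule Cauchy_Schwarz_ineq2)
      also have "\<dots> \<le> G * M" using G M M0 by (intro mult_mono) auto
      finally show ?thesis .
    qed
    then have "integrable (lebesgue_on \<Omega>) (\<lambda>y. p y * (gradient (\<eta> x) y \<bullet> V y))"
      using m(2) Vm by (intro integrable_bounded_mult[OF p(2)]) auto
    moreover have "integrable (lebesgue_on \<Omega>) (\<lambda>y. (W y \<bullet> V y) * \<eta> x y)"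
      using m(1) E by (intro integrable_bounded_mult[OF WV]) auto
    ultimately show ?thesis unfolding F_def[abs_def]
      by (simp add: mult.commute[of "\<eta> x _"])
  qed
  have "0 = (LINT y|lebesgue_on \<Omega>. (\<Sum>x\<in>I. F (\<eta> x) y))"
    by (subst Bochner_Integration.integral_sum) (simp_all add: FI F0)
  also have "\<dots> = (LINT y|lebesgue_on \<Omega>. W y \<bullet> V y)"
  proof (rule Bochner_Integration.integral_cong)
    fix y assume "y \<in> space (lebesgue_on \<Omega>)"
    then have y: "y \<in> \<Omega>" by simp
    have one: "(\<Sum>x\<in>I. \<eta> x z) = 1" if "z \<in> \<Omega>" for z using \<eta>(3) closure_subset that by blast
    have "(\<Sum>x\<in>I. gradient (\<eta> x) y) = 0"
      by (rule sum_gradient_partition_of_unity[OF \<Omega>(1) y _ one]) (use \<eta>(1)[of _ 1] in auto)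
    moreover have "(\<Sum>x\<in>I. F (\<eta> x) y) = p y * ((\<Sum>x\<in>I. gradient (\<eta> x) y) \<bullet> V y) + (\<Sum>x\<in>I. \<eta> x y) * (W y \<bullet> V y)"
      by (simp add: F_def sum.distrib inner_sum_left sum_distrib_left sum_distrib_right)
    ultimately show "(\<Sum>x\<in>I. F (\<eta> x) y) = W y \<bullet> V y" using one[OF y] by simp
  qed simp
  finally show ?thesis by simp
qed

section \<open>The space L2 and the first Green identity\<close>

lemma sets_lebesgue_open: "open \<Omega> \<Longrightarrow> \<Omega> \<in> sets lebesgue"
  by (simp add: borel_open lborelD)

lemma L2_integrable:
  fixes f :: "real^2 \<Rightarrow> 'b::euclidean_space"
  assumes "open \<Omega>" "bounded \<Omega>" "f \<in> L2 \<Omega>"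
  shows "integrable (lebesgue_on \<Omega>) f"
proof (rule Bochner_Integration.integrable_bound[where f = "\<lambda>x. 1 + (norm (f x))\<^sup>2"])
  have "\<Omega> \<in> lmeasurable" using assms(1,2) by (rule lmeasurable_open[rotated])
  then have "integrable (lebesgue_on \<Omega>) (\<lambda>x. 1::real)"
    by (simp add: lmeasurable_iff_integrable_on integrable_restrict_space sets_lebesgue_open[OF assms(1)] fmeasurable_def)
  then show "integrable (lebesgue_on \<Omega>) (\<lambda>x. 1 + (norm (f x))\<^sup>2)"
    using assms(3) by (auto simp: L2_def)
  show "f \<in> borel_measurable (lebesgue_on \<Omega>)" using assms(3) by (simp add: L2_def)
  show "AE x in lebesgue_on \<Omega>. norm (f x) \<le> norm (1 + (norm (f x))\<^sup>2)"
  proof (intro always_eventually allI)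
    fix x
    have "0 \<le> (norm (f x) - 1)\<^sup>2" by simp
    then have "2 * norm (f x) \<le> 1 + (norm (f x))\<^sup>2" by (simp add: power2_diff)
    then have "norm (f x) \<le> 1 + (norm (f x))\<^sup>2" using norm_ge_zero[of "f x"] by linarith
    then show "norm (f x) \<le> norm (1 + (norm (f x))\<^sup>2)" by simp
  qed
qed

lemma L2_inner_integrable:
  fixes f g :: "real^2 \<Rightarrow> 'b::euclidean_space"
  assumes "f \<in> L2 \<Omega>" "g \<in> L2 \<Omega>"
  shows "integrable (lebesgue_on \<Omega>) (\<lambda>x. f x \<bullet> g x)"
proof (rule Bochner_Integration.integrable_bound[where f = "\<lambda>x. (norm (f x))\<^sup>2 + (norm (g x))\<^sup>2"])
  show "integrable (lebesgue_on \<Omega>) (\<lambda>x. (norm (f x))\<^sup>2 + (norm (g x))\<^sup>2)"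
    using assms by (auto simp: L2_def)
  show "(\<lambda>x. f x \<bullet> g x) \<in> borel_measurable (lebesgue_on \<Omega>)" using assms by (auto simp: L2_def)
  show "AE x in lebesgue_on \<Omega>. norm (f x \<bullet> g x) \<le> norm ((norm (f x))\<^sup>2 + (norm (g x))\<^sup>2)"
  proof (intro always_eventually allI)
    fix x
    have "0 \<le> (norm (f x) - norm (g x))\<^sup>2" by simp
    then have "2 * (norm (f x) * norm (g x)) \<le> (norm (f x))\<^sup>2 + (norm (g x))\<^sup>2" by (simp add: power2_diff)
    moreover have "\<bar>f x \<bullet> g x\<bar> \<le> norm (f x) * norm (g x)" by (rule Cauchy_Schwarz_ineq2)
    moreover have "0 \<le> norm (f x) * norm (g x)" by simp
    ultimately have "\<bar>f x \<bullet> g x\<bar> \<le> (norm (f x))\<^sup>2 + (norm (g x))\<^sup>2" by linarith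
    then show "norm (f x \<bullet> g x) \<le> norm ((norm (f x))\<^sup>2 + (norm (g x))\<^sup>2)" by simp
  qed
qed

lemma L2_scaleR:
  fixes f :: "real^2 \<Rightarrow> 'b::euclidean_space"
  shows "f \<in> L2 \<Omega> \<Longrightarrow> (\<lambda>x. c *\<^sub>R f x) \<in> L2 \<Omega>"
  by (auto simp: L2_def power_mult_distrib)

lemma L2_scaleR_left:
  fixes c :: "'b::euclidean_space"
  shows "f \<in> L2 \<Omega> \<Longrightarrow> (\<lambda>x. f x *\<^sub>R c) \<in> L2 \<Omega>"
  by (auto simp: L2_def power_mult_distrib)

lemma L2_add:
  fixes f g :: "real^2 \<Rightarrow> 'b::euclidean_space"
  assumes "f \<in> L2 \<Omega>" "g \<in> L2 \<Omega>"
  shows "(\<lambda>x. f x + g x) \<in> L2 \<Omega>"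
proof -
  have "(\<lambda>x. (norm (f x + g x))\<^sup>2) = (\<lambda>x. (norm (f x))\<^sup>2 + 2 * (f x \<bullet> g x) + (norm (g x))\<^sup>2)"
    by (simp add: power2_norm_eq_inner inner_add_left inner_add_right inner_commute fun_eq_iff)
  then show ?thesis using assms L2_inner_integrable[OF assms] by (auto simp: L2_def)
qed

lemma L2_diff:
  fixes f g :: "real^2 \<Rightarrow> 'b::euclidean_space"
  shows "f \<in> L2 \<Omega> \<Longrightarrow> g \<in> L2 \<Omega> \<Longrightarrow> (\<lambda>x. f x - g x) \<in> L2 \<Omega>"
  using L2_add[OF _ L2_scaleR[of g \<Omega> "-1"], of f] by simp

lemma L2_sum:
  fixes f :: "'i::finite \<Rightarrow> real^2 \<Rightarrow> 'b::euclidean_space"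
  assumes "\<And>i. f i \<in> L2 \<Omega>" shows "(\<lambda>x. \<Sum>i\<in>J. f i x) \<in> L2 \<Omega>"
proof (induction J rule: infinite_finite_induct)
  case (insert i J) then show ?case using L2_add[OF assms[of i]] by simp
qed (simp_all add: L2_def)

lemma L2_norm_power2: "(L2_norm \<Omega> f)\<^sup>2 = L2_inner \<Omega> f f"
  by (simp add: L2_norm_def L2_inner_def integral_nonneg_AE)

lemma L2_inner_commute: "L2_inner \<Omega> f g = L2_inner \<Omega> g f"
  by (simp add: L2_inner_def inner_commute)

lemma L2_inner_cong_AE:
  assumes "AE x in lebesgue_on \<Omega>. f x = f' x" "AE x in lebesgue_on \<Omega>. g x = g' x"
    "f \<in> L2 \<Omega>" "f' \<in> L2 \<Omega>" "g \<in> L2 \<Omega>" "g' \<in> L2 \<Omega>"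
  shows "L2_inner \<Omega> f g = L2_inner \<Omega> f' g'"
  unfolding L2_inner_def
proof (rule integral_cong_AE)
  show "AE x in lebesgue_on \<Omega>. f x \<bullet> g x = f' x \<bullet> g' x" using assms(1,2) by eventually_elim simp
qed (use assms in \<open>auto simp: L2_def\<close>)

lemma L2_inner_add_left:
  "f \<in> L2 \<Omega> \<Longrightarrow> g \<in> L2 \<Omega> \<Longrightarrow> h \<in> L2 \<Omega> \<Longrightarrow> L2_inner \<Omega> (\<lambda>x. f x + g x) h = L2_inner \<Omega> f h + L2_inner \<Omega> g h"
  unfolding L2_inner_def inner_add_left by (intro Bochner_Integration.integral_add L2_inner_integrable)

lemma L2_inner_add_right:
  "f \<in> L2 \<Omega> \<Longrightarrow> g \<in> L2 \<Omega> \<Longrightarrow> h \<in> L2 \<Omega> \<Longrightarrow> L2_inner \<Omega> h (\<lambda>x. f x + g x) = L2_inner \<Omega> h f + L2_inner \<Omega> h g"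
  using L2_inner_add_left[of f \<Omega> g h] by (simp add: L2_inner_commute)

lemma L2_inner_diff_left:
  "f \<in> L2 \<Omega> \<Longrightarrow> g \<in> L2 \<Omega> \<Longrightarrow> h \<in> L2 \<Omega> \<Longrightarrow> L2_inner \<Omega> (\<lambda>x. f x - g x) h = L2_inner \<Omega> f h - L2_inner \<Omega> g h"
  unfolding L2_inner_def inner_diff_left by (intro Bochner_Integration.integral_diff L2_inner_integrable)

lemma L2_inner_scaleR_left: "L2_inner \<Omega> (\<lambda>x. c *\<^sub>R f x) g = c * L2_inner \<Omega> f g"
  by (simp add: L2_inner_def)

lemma L2_inner_scaleR_right: "L2_inner \<Omega> f (\<lambda>x. c *\<^sub>R g x) = c * L2_inner \<Omega> f g"
  by (simp add: L2_inner_def)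

lemma H1_L2: "f \<in> H1 \<Omega> \<Longrightarrow> f \<in> L2 \<Omega>" "f \<in> H1 \<Omega> \<Longrightarrow> wpartial \<Omega> i f \<in> L2 \<Omega>"
  by (auto simp: H1_def)

lemma H2_H1: "f \<in> H2 \<Omega> \<Longrightarrow> f \<in> H1 \<Omega>" "f \<in> H2 \<Omega> \<Longrightarrow> wpartial \<Omega> i f \<in> H1 \<Omega>"
  by (auto simp: H2_def)

lemma grad_L2:
  assumes "p \<in> H1 \<Omega>" shows "grad \<Omega> p \<in> L2 \<Omega>"
proof -
  have "grad \<Omega> p = (\<lambda>x. \<Sum>i\<in>UNIV. wpartial \<Omega> i p x *\<^sub>R axis i 1)"
  proof
    fix x show "grad \<Omega> p x = (\<Sum>i\<in>UNIV. wpartial \<Omega> i p x *\<^sub>R axis i 1)"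
      using basis_expansion[of "grad \<Omega> p x"] by (simp add: grad_def scalar_mult_eq_scaleR)
  qed
  then show ?thesis using H1_L2(2)[OF assms] by (auto intro!: L2_sum L2_scaleR_left)
qed

lemma laplacian_L2: "f \<in> H2 \<Omega> \<Longrightarrow> laplacian \<Omega> f \<in> L2 \<Omega>"
  unfolding laplacian_def[abs_def] by (intro L2_sum H1_L2(2) H2_H1(2))

lemma weak_partial_component:
  fixes f g :: "real^2 \<Rightarrow> real^2" and \<psi> :: "real^2 \<Rightarrow> real"
  assumes \<Omega>: "open \<Omega>" and w: "has_weak_partial \<Omega> i f g" and t: "test_function \<Omega> \<psi>"
  shows "integrable (lebesgue_on \<Omega>) (\<lambda>x. partial i \<psi> x * f x $ j)"
    and "integrable (lebesgue_on \<Omega>) (\<lambda>x. \<psi> x * g x $ j)"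
    and "(LINT x|lebesgue_on \<Omega>. partial i \<psi> x * f x $ j) = - (LINT x|lebesgue_on \<Omega>. \<psi> x * g x $ j)"
proof -
  obtain C where C: "\<And>k. Ck k \<psi>" "compact C" "C \<subseteq> \<Omega>" "\<And>x. x \<notin> C \<Longrightarrow> \<psi> x = 0"
    "\<And>x i. x \<notin> C \<Longrightarrow> partial i \<psi> x = 0" using test_functionE[OF t] by blast
  have c: "continuous_on UNIV \<psi>" "continuous_on UNIV (partial i \<psi>)"
    using C(1)[of 0] C(1)[of 1] by auto
  have li: "locally_integrable \<Omega> f" "locally_integrable \<Omega> g"
    and eq: "(LINT x|lebesgue_on \<Omega>. partial i \<psi> x *\<^sub>R f x) = - (LINT x|lebesgue_on \<Omega>. \<psi> x *\<^sub>R g x)"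
    using w t unfolding has_weak_partial_def by blast+
  have 1: "integrable (lebesgue_on \<Omega>) (\<lambda>x. partial i \<psi> x *\<^sub>R f x)"
    by (rule integrable_times_locally_integrable[OF \<Omega> li(1) c(2) C(2,3,5)])
  have 2: "integrable (lebesgue_on \<Omega>) (\<lambda>x. \<psi> x *\<^sub>R g x)"
    by (rule integrable_times_locally_integrable[OF \<Omega> li(2) c(1) C(2,3,4)])
  show "integrable (lebesgue_on \<Omega>) (\<lambda>x. partial i \<psi> x * f x $ j)"
    "integrable (lebesgue_on \<Omega>) (\<lambda>x. \<psi> x * g x $ j)"
    using integrable_inner_left[of "axis j 1", OF 1] integrable_inner_left[of "axis j 1", OF 2]
    by (simp_all add: inner_axis)
  have "(LINT x|lebesgue_on \<Omega>. partial i \<psi> x *\<^sub>R f x) \<bullet> axis j 1 = - ((LINT x|lebesgue_on \<Omega>. \<psi> x *\<^sub>R g x) \<bullet> axis j 1)"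
    unfolding eq by simp
  moreover have "(LINT x|lebesgue_on \<Omega>. (partial i \<psi> x *\<^sub>R f x) \<bullet> axis j 1) = (LINT x|lebesgue_on \<Omega>. partial i \<psi> x *\<^sub>R f x) \<bullet> axis j 1"
    "(LINT x|lebesgue_on \<Omega>. (\<psi> x *\<^sub>R g x) \<bullet> axis j 1) = (LINT x|lebesgue_on \<Omega>. \<psi> x *\<^sub>R g x) \<bullet> axis j 1"
    by (rule integral_inner_left, rule 1) (rule integral_inner_left, rule 2)
  ultimately show "(LINT x|lebesgue_on \<Omega>. partial i \<psi> x * f x $ j) = - (LINT x|lebesgue_on \<Omega>. \<psi> x * g x $ j)"
    by (simp add: inner_axis)
qed

lemma weak_divergence_integral:
  fixes u :: "real^2 \<Rightarrow> real^2"
  assumes \<Omega>: "open \<Omega>" and u: "u \<in> H1 \<Omega>" and divfree: "AE x in lebesgue_on \<Omega>. divergence \<Omega> u x = 0"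
    and t: "test_function \<Omega> \<phi>"
  shows "(LINT x|lebesgue_on \<Omega>. gradient \<phi> x \<bullet> u x) = 0"
proof -
  note c = weak_partial_component[OF \<Omega> has_weak_partial_wpartial[OF u] t]
  have "(LINT x|lebesgue_on \<Omega>. gradient \<phi> x \<bullet> u x) = (\<Sum>i\<in>UNIV. LINT x|lebesgue_on \<Omega>. partial i \<phi> x * u x $ i)"
    unfolding gradient_inner by (rule Bochner_Integration.integral_sum) (rule c(1))
  also have "\<dots> = - (LINT x|lebesgue_on \<Omega>. (\<Sum>i\<in>UNIV. \<phi> x * wpartial \<Omega> i u x $ i))"
    by (simp add: c(3) sum_negf Bochner_Integration.integral_sum c(2))
  also have "(LINT x|lebesgue_on \<Omega>. (\<Sum>i\<in>UNIV. \<phi> x * wpartial \<Omega> i u x $ i)) = 0"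
  proof (rule integral_eq_zero_AE)
    show "AE x in lebesgue_on \<Omega>. (\<Sum>i\<in>UNIV. \<phi> x * wpartial \<Omega> i u x $ i) = 0"
      using divfree by eventually_elim (simp add: divergence_def sum_distrib_left[symmetric])
  qed
  finally show ?thesis by simp
qed

text \<open>
  The orthogonality behind the Helmholtz decomposition: it is what removes the new pressure from
  the energy balance of the projection step.
\<close>

lemma gradient_orthogonal_to_solenoidal:
  fixes u :: "real^2 \<Rightarrow> real^2"
  assumes \<Omega>: "open \<Omega>" "bounded \<Omega>" "C1_boundary \<Omega>"
    and normal: "\<And>x. x \<in> frontier \<Omega> \<Longrightarrow> outward_unit_normal \<Omega> x (\<n> x)"
    and u: "u \<in> H1 \<Omega>" "AE x in lebesgue_on \<Omega>. divergence \<Omega> u x = 0"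
    and b: "has_trace \<Omega> u b" "\<And>x. x \<in> frontier \<Omega> \<Longrightarrow> b x \<bullet> \<n> x = 0"
    and p: "p \<in> H1 \<Omega>"
  shows "L2_inner \<Omega> (grad \<Omega> p) u = 0"
proof -
  obtain v where v: "continuous_on (closure \<Omega>) v" "AE x in lebesgue_on \<Omega>. u x = v x"
    "\<And>x. x \<in> frontier \<Omega> \<Longrightarrow> b x = v x" using b(1) by (auto simp: has_trace_def)
  define V where "V x = indicator \<Omega> x *\<^sub>R v x" for x
  have "integrable lborel (\<lambda>x. indicator (closure \<Omega>) x *\<^sub>R v x)"
    using \<Omega>(2) v(1) by (intro borel_integrable_compact) (simp_all add: compact_closure)
  then have "integrable lborel (\<lambda>x. indicator \<Omega> x *\<^sub>R (indicator (closure \<Omega>) x *\<^sub>R v x))"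
    by (rule integrable_mult_indicator[rotated]) (use \<Omega>(1) in \<open>simp add: borel_open\<close>)
  moreover have "(\<lambda>x. indicator \<Omega> x *\<^sub>R (indicator (closure \<Omega>) x *\<^sub>R v x)) = V"
    using closure_subset[of \<Omega>] by (auto simp: V_def fun_eq_iff indicator_def)
  ultimately have Vi: "integrable lborel V" by simp
  have Vm: "V \<in> borel_measurable borel" using borel_measurable_integrable[OF Vi] by simp
  have uV: "AE x in lebesgue_on \<Omega>. u x = V x"
    using v(2) by (rule AE_mp) (auto simp: V_def intro!: AE_I2)
  have um: "u \<in> borel_measurable (lebesgue_on \<Omega>)" using H1_L2(1)[OF u(1)] by (simp add: L2_def)
  have "(LINT x|lebesgue_on \<Omega>. grad \<Omega> p x \<bullet> V x) = 0"
  proof (rule integral_gradient_inner_eq_0[OF \<Omega> normal Vi _ _ v(1)])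
    show "V x = v x" if "x \<in> \<Omega>" for x using that by (simp add: V_def)
    show "V x = 0" if "x \<notin> \<Omega>" for x using that by (simp add: V_def)
    show "v x \<bullet> \<n> x = 0" if "x \<in> frontier \<Omega>" for x using b(2)[OF that] v(3)[OF that] by simp
    show "has_weak_partial \<Omega> i p (\<lambda>x. grad \<Omega> p x $ i)" for i
      using has_weak_partial_wpartial[OF p, of i] by (simp add: grad_def)
    show "integrable (lebesgue_on \<Omega>) p" "integrable (lebesgue_on \<Omega>) (grad \<Omega> p)"
      by (intro L2_integrable[OF \<Omega>(1,2)] H1_L2(1)[OF p] grad_L2[OF p])+
    fix \<phi> :: "real^2 \<Rightarrow> real" assume t: "test_function \<Omega> \<phi>"
    then have gc: "continuous_on UNIV (gradient \<phi>)" by (intro continuous_gradient) (simp add: test_function_def)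
    then have gm: "gradient \<phi> \<in> borel_measurable borel" by (rule borel_measurable_continuous_onI)
    have "(LINT x|lborel. gradient \<phi> x \<bullet> V x) = (LINT x|lebesgue. gradient \<phi> x \<bullet> V x)"
      using gm Vm by (intro integral_completion[symmetric]) simp
    also have "\<dots> = (LINT x|lebesgue. indicator \<Omega> x *\<^sub>R (gradient \<phi> x \<bullet> V x))"
      by (intro Bochner_Integration.integral_cong) (auto simp: V_def indicator_def)
    also have "\<dots> = (LINT x|lebesgue_on \<Omega>. gradient \<phi> x \<bullet> V x)"
      using sets_lebesgue_open[OF \<Omega>(1)] by (simp add: integral_restrict_space)
    also have "\<dots> = (LINT x|lebesgue_on \<Omega>. gradient \<phi> x \<bullet> u x)"
    proof (rule integral_cong_AE)
      show "AE x in lebesgue_on \<Omega>. gradient \<phi> x \<bullet> V x = gradient \<phi> x \<bullet> u x"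
        using uV by eventually_elim simp
    qed (use borel_measurable_lebesgue_on[OF gm] borel_measurable_lebesgue_on[OF Vm] um in auto)
    also have "\<dots> = 0" by (rule weak_divergence_integral[OF \<Omega>(1) u t])
    finally show "(LINT x|lborel. gradient \<phi> x \<bullet> V x) = 0" .
  qed
  moreover have "L2_inner \<Omega> (grad \<Omega> p) u = (LINT x|lebesgue_on \<Omega>. grad \<Omega> p x \<bullet> V x)"
    unfolding L2_inner_def
  proof (rule integral_cong_AE)
    show "AE x in lebesgue_on \<Omega>. grad \<Omega> p x \<bullet> u x = grad \<Omega> p x \<bullet> V x"
      using uV by eventually_elim simp
  qed (use borel_measurable_lebesgue_on[OF Vm] um grad_L2[OF p] in \<open>auto simp: L2_def\<close>)
  ultimately show ?thesis by simp
qed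

text \<open>
  Young's inequality, in a form that is convenient for the density argument below.
\<close>

lemma abs_L2_inner_le:
  fixes f g :: "real^2 \<Rightarrow> 'b::euclidean_space"
  assumes "f \<in> L2 \<Omega>" "g \<in> L2 \<Omega>" "s > 0"
  shows "\<bar>L2_inner \<Omega> f g\<bar> \<le> (L2_norm \<Omega> f)\<^sup>2 / s + s * (L2_norm \<Omega> g)\<^sup>2"
proof -
  have i: "integrable (lebesgue_on \<Omega>) (\<lambda>x. (f x \<bullet> f x) / s + s * (g x \<bullet> g x))"
    using L2_inner_integrable[OF assms(1,1)] L2_inner_integrable[OF assms(2,2)] by auto
  have "norm (LINT x|lebesgue_on \<Omega>. f x \<bullet> g x) \<le> (LINT x|lebesgue_on \<Omega>. (f x \<bullet> f x) / s + s * (g x \<bullet> g x))"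
  proof (rule Bochner_Integration.integral_norm_bound_integral[OF L2_inner_integrable[OF assms(1,2)] i])
    fix x
    have "0 \<le> (norm (f x) - s * norm (g x))\<^sup>2" by simp
    then have "2 * s * (norm (f x) * norm (g x)) \<le> f x \<bullet> f x + s\<^sup>2 * (g x \<bullet> g x)"
      by (simp add: power2_diff power_mult_distrib power2_norm_eq_inner algebra_simps)
    moreover have "s * \<bar>f x \<bullet> g x\<bar> \<le> s * (norm (f x) * norm (g x))"
      using assms(3) by (intro mult_left_mono Cauchy_Schwarz_ineq2) auto
    moreover have "0 \<le> s * (norm (f x) * norm (g x))" using assms(3) by simp
    ultimately have "s * \<bar>f x \<bullet> g x\<bar> \<le> f x \<bullet> f x + s\<^sup>2 * (g x \<bullet> g x)" by linarith
    also have "\<dots> = s * ((f x \<bullet> f x) / s + s * (g x \<bullet> g x))"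
      using assms(3) by (simp add: field_simps power2_eq_square)
    finally show "norm (f x \<bullet> g x) \<le> (f x \<bullet> f x) / s + s * (g x \<bullet> g x)"
      using assms(3) by simp
  qed
  also have "\<dots> = L2_inner \<Omega> f f / s + s * L2_inner \<Omega> g g"
    using L2_inner_integrable[OF assms(1,1)] L2_inner_integrable[OF assms(2,2)] by (simp add: L2_inner_def)
  finally show ?thesis by (simp add: L2_norm_power2 L2_inner_def)
qed

lemma L2_continuous_compact_support:
  fixes f :: "real^2 \<Rightarrow> 'b::euclidean_space"
  assumes "open \<Omega>" and f: "continuous_on UNIV f" "compact C" "\<And>x. x \<notin> C \<Longrightarrow> f x = 0"
  shows "f \<in> L2 \<Omega>"
proof -
  have fm: "f \<in> borel_measurable borel" using f(1) by (rule borel_measurable_continuous_onI)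
  have c2: "continuous_on UNIV (\<lambda>x. (norm (f x))\<^sup>2)" by (intro continuous_intros f(1))
  have "integrable lborel (\<lambda>x. (norm (f x))\<^sup>2)"
    by (rule integrable_compact_support[OF c2 f(2)]) (simp add: f(3))
  then have "integrable lebesgue (\<lambda>x. (norm (f x))\<^sup>2)"
    using c2 by (subst integrable_completion) (auto intro!: borel_measurable_continuous_onI)
  then have "integrable lebesgue (\<lambda>x. indicator \<Omega> x *\<^sub>R (norm (f x))\<^sup>2)"
    by (rule integrable_mult_indicator[OF sets_lebesgue_open[OF assms(1)]])
  then have "integrable (lebesgue_on \<Omega>) (\<lambda>x. (norm (f x))\<^sup>2)"
    using sets_lebesgue_open[OF assms(1)] by (simp add: integrable_restrict_space)
  moreover have "f \<in> borel_measurable (lebesgue_on \<Omega>)"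
    using fm by (rule borel_measurable_lebesgue_on)
  ultimately show ?thesis by (simp add: L2_def)
qed

lemma L2_inner_sum_right:
  fixes f :: "real^2 \<Rightarrow> 'b::euclidean_space"
  assumes "f \<in> L2 \<Omega>" "\<And>i. g i \<in> L2 \<Omega>"
  shows "L2_inner \<Omega> f (\<lambda>x. \<Sum>i\<in>J. g i x) = (\<Sum>i\<in>J. L2_inner \<Omega> f (g i))"
  unfolding L2_inner_def inner_sum_right
  by (rule Bochner_Integration.integral_sum) (intro L2_inner_integrable assms)

lemma weak_partial_inner_test_function:
  fixes f g :: "real^2 \<Rightarrow> real^2"
  assumes \<Omega>: "open \<Omega>" and w: "has_weak_partial \<Omega> i f g" and t: "test_function \<Omega> \<phi>"
  shows "(LINT x|lebesgue_on \<Omega>. partial i \<phi> x \<bullet> f x) = - (LINT x|lebesgue_on \<Omega>. \<phi> x \<bullet> g x)"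
proof -
  obtain C where C: "\<And>k. Ck k \<phi>" "compact C" "C \<subseteq> \<Omega>" "\<And>x. x \<notin> C \<Longrightarrow> \<phi> x = 0"
    "\<And>x i. x \<notin> C \<Longrightarrow> partial i \<phi> x = 0" using test_functionE[OF t] by blast
  define \<psi> where "\<psi> j x = \<phi> x $ j" for j x
  have t\<psi>: "test_function \<Omega> (\<psi> j)" for j
    unfolding \<psi>_def[abs_def]
    by (rule test_functionI[OF Ck_bounded_linear_comp[OF bounded_linear_vec_nth C(1)] C(2,3)]) (simp add: C(4))
  have par: "partial i (\<psi> j) x = partial i \<phi> x $ j" for j x
  proof -
    have "(\<phi> has_derivative frechet_derivative \<phi> (at x)) (at x)" by (rule Ck_has_derivative[OF C(1)])
    from partial_has_derivative[OF bounded_linear.has_derivative[OF bounded_linear_vec_nth this]]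
    show ?thesis by (simp add: partial_def \<psi>_def[abs_def])
  qed
  note c = weak_partial_component[OF \<Omega> w t\<psi>, unfolded par \<psi>_def]
  have "(LINT x|lebesgue_on \<Omega>. partial i \<phi> x \<bullet> f x) = (\<Sum>j\<in>UNIV. LINT x|lebesgue_on \<Omega>. partial i \<phi> x $ j * f x $ j)"
    unfolding inner_vec_def inner_real_def by (rule Bochner_Integration.integral_sum) (rule c(1))
  also have "\<dots> = - (\<Sum>j\<in>UNIV. LINT x|lebesgue_on \<Omega>. \<phi> x $ j * g x $ j)"
    by (simp add: c(3) sum_negf)
  also have "(\<Sum>j\<in>UNIV. LINT x|lebesgue_on \<Omega>. \<phi> x $ j * g x $ j) = (LINT x|lebesgue_on \<Omega>. \<phi> x \<bullet> g x)"
    unfolding inner_vec_def inner_real_def by (rule Bochner_Integration.integral_sum[symmetric]) (rule c(2))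
  finally show ?thesis .
qed

text \<open>
  For a test function \<open>\<phi>\<close> in place of one factor \<open>f\<close> this is the definition of the weak derivative;
  density of the test functions gives the rest.
\<close>

lemma L2_inner_laplacian:
  fixes f :: "real^2 \<Rightarrow> real^2"
  assumes \<Omega>: "open \<Omega>" and f: "f \<in> H2 \<Omega>" "f \<in> H10 \<Omega>"
  shows "L2_inner \<Omega> (laplacian \<Omega> f) f = - (L2_norm \<Omega> (vgrad \<Omega> f))\<^sup>2"
proof -
  define g where "g i = wpartial \<Omega> i f" for i
  define l where "l i = wpartial \<Omega> i (g i)" for i
  have gH: "g i \<in> H1 \<Omega>" for i unfolding g_def by (rule H2_H1(2)[OF f(1)])
  have gL: "g i \<in> L2 \<Omega>" for i by (rule H1_L2(1)[OF gH])
  have lL: "l i \<in> L2 \<Omega>" for i unfolding l_def by (rule H1_L2(2)[OF gH])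
  have fL: "f \<in> L2 \<Omega>" by (rule H1_L2(1)[OF H2_H1(1)[OF f(1)]])
  have lap: "laplacian \<Omega> f = (\<lambda>x. \<Sum>i\<in>UNIV. l i x)"
    by (simp add: laplacian_def[abs_def] l_def g_def)
  have LL: "laplacian \<Omega> f \<in> L2 \<Omega>" by (rule laplacian_L2[OF f(1)])
  have vg: "(L2_norm \<Omega> (vgrad \<Omega> f))\<^sup>2 = (\<Sum>i\<in>UNIV. (L2_norm \<Omega> (g i))\<^sup>2)"
  proof -
    have "vgrad \<Omega> f x \<bullet> vgrad \<Omega> f x = (\<Sum>i\<in>UNIV. g i x \<bullet> g i x)" for x
      by (simp add: vgrad_def g_def inner_vec_def sum_2)
    then show ?thesis
      by (simp add: L2_norm_power2 L2_inner_def Bochner_Integration.integral_sum L2_inner_integrable gL)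
  qed
  define X where "X = (\<Sum>i\<in>UNIV. (L2_norm \<Omega> (g i))\<^sup>2) + L2_inner \<Omega> f (laplacian \<Omega> f)"
  define B where "B = (\<Sum>i\<in>UNIV. (L2_norm \<Omega> (g i))\<^sup>2) + (L2_norm \<Omega> (laplacian \<Omega> f))\<^sup>2"
  \<comment> \<open>A squared approximation error below \<open>s\<^sup>2\<close>, divided by \<open>s\<close> in Young's inequality, contributes at most \<open>s\<close>.\<close>
  have bound: "\<bar>X\<bar> \<le> s + s * B" if s: "s > 0" for s
  proof -
    have "s\<^sup>2 > 0" using s by simp
    then obtain \<phi> where t: "test_function \<Omega> \<phi>"
      and ap: "(L2_norm \<Omega> (\<lambda>x. f x - \<phi> x))\<^sup>2 + (\<Sum>i\<in>UNIV. (L2_norm \<Omega> (\<lambda>x. g i x - partial i \<phi> x))\<^sup>2) < s\<^sup>2"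
      using f(2) unfolding H10_def g_def by blast
    obtain C where C: "\<And>k. Ck k \<phi>" "compact C" "C \<subseteq> \<Omega>" "\<And>x. x \<notin> C \<Longrightarrow> \<phi> x = 0"
      "\<And>x i. x \<notin> C \<Longrightarrow> partial i \<phi> x = 0" using test_functionE[OF t] by blast
    have \<phi>L: "\<phi> \<in> L2 \<Omega>"
      by (rule L2_continuous_compact_support[OF \<Omega> continuous_Ck[OF C(1)] C(2,4)])
    have \<phi>L': "partial i \<phi> \<in> L2 \<Omega>" for i
      by (rule L2_continuous_compact_support[OF \<Omega> _ C(2,5)]) (use C(1)[of 1] in auto)
    have green: "L2_inner \<Omega> (partial i \<phi>) (g i) = - L2_inner \<Omega> \<phi> (l i)" for i
      unfolding L2_inner_def l_def
      by (rule weak_partial_inner_test_function[OF \<Omega> has_weak_partial_wpartial[OF gH] t])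
    have Xeq: "X = (\<Sum>i\<in>UNIV. L2_inner \<Omega> (\<lambda>x. g i x - partial i \<phi> x) (g i)) + L2_inner \<Omega> (\<lambda>x. f x - \<phi> x) (laplacian \<Omega> f)"
    proof -
      have "(\<Sum>i\<in>UNIV. L2_inner \<Omega> (\<lambda>x. g i x - partial i \<phi> x) (g i))
          = (\<Sum>i\<in>UNIV. (L2_norm \<Omega> (g i))\<^sup>2) + (\<Sum>i\<in>UNIV. L2_inner \<Omega> \<phi> (l i))"
        by (simp add: L2_inner_diff_left gL \<phi>L' green L2_norm_power2 sum.distrib)
      moreover have "(\<Sum>i\<in>UNIV. L2_inner \<Omega> \<phi> (l i)) = L2_inner \<Omega> \<phi> (laplacian \<Omega> f)"
        unfolding lap by (rule L2_inner_sum_right[OF \<phi>L lL, symmetric])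
      moreover have "L2_inner \<Omega> (\<lambda>x. f x - \<phi> x) (laplacian \<Omega> f) = L2_inner \<Omega> f (laplacian \<Omega> f) - L2_inner \<Omega> \<phi> (laplacian \<Omega> f)"
        by (rule L2_inner_diff_left[OF fL \<phi>L LL])
      ultimately show ?thesis by (simp add: X_def)
    qed
    have "\<bar>X\<bar> \<le> (\<Sum>i\<in>UNIV. (L2_norm \<Omega> (\<lambda>x. g i x - partial i \<phi> x))\<^sup>2 / s + s * (L2_norm \<Omega> (g i))\<^sup>2)
        + ((L2_norm \<Omega> (\<lambda>x. f x - \<phi> x))\<^sup>2 / s + s * (L2_norm \<Omega> (laplacian \<Omega> f))\<^sup>2)"
      unfolding Xeq
      by (intro order_trans[OF abs_triangle_ineq] add_mono order_trans[OF sum_abs] sum_mono abs_L2_inner_le L2_diff gL \<phi>L' fL \<phi>L LL s)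
    also have "\<dots> = ((L2_norm \<Omega> (\<lambda>x. f x - \<phi> x))\<^sup>2 + (\<Sum>i\<in>UNIV. (L2_norm \<Omega> (\<lambda>x. g i x - partial i \<phi> x))\<^sup>2)) / s + s * B"
      unfolding B_def sum.distrib sum_divide_distrib[symmetric] sum_distrib_left[symmetric]
        add_divide_distrib distrib_left by linarith
    also have "\<dots> \<le> s\<^sup>2 / s + s * B" 
      by (intro add_right_mono divide_right_mono less_imp_le[OF ap] less_imp_le[OF s])
    also have "\<dots> = s + s * B" by (simp add: power2_eq_square)
    finally show ?thesis .
  qed
  have B0: "B \<ge> 0" by (simp add: B_def sum_nonneg)
  have "\<bar>X\<bar> \<le> 0"
  proof (rule field_le_epsilon)
    fix e :: real assume e: "e > 0"
    have "\<bar>X\<bar> \<le> e / (1 + B) + e / (1 + B) * B" using e B0 by (intro bound) simp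
    also have "\<dots> = e / (1 + B) * (1 + B)" by (simp only: distrib_left mult_1_right)
    also have "\<dots> = e" using B0 by simp
    finally show "\<bar>X\<bar> \<le> 0 + e" by simp
  qed
  then show ?thesis by (simp add: X_def vg L2_inner_commute[of \<Omega> f])
qed

lemma convect_measurable:
  assumes "u \<in> L2 \<Omega>" "v \<in> H1 \<Omega>"
  shows "convect \<Omega> u v \<in> borel_measurable (lebesgue_on \<Omega>)"
proof -
  have "(\<lambda>x. u x \<bullet> axis j 1) \<in> borel_measurable (lebesgue_on \<Omega>)" for j
    using assms(1) by (auto simp: L2_def)
  moreover have "wpartial \<Omega> j v \<in> borel_measurable (lebesgue_on \<Omega>)" for j
    using H1_L2(2)[OF assms(2), of j] by (simp add: L2_def)
  ultimately show ?thesis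
    unfolding convect_def[abs_def] by (intro borel_measurable_sum borel_measurable_scaleR) (simp_all add: inner_axis)
qed

section \<open>Energy stability\<close>

theorem theorem4p1:
  fixes \<Omega> :: "(real^2) set"
    and \<n> :: "real^2 \<Rightarrow> real^2"
    and \<nu> T dt :: real
    and N :: nat
    and t :: "nat \<Rightarrow> real"
    and ut u :: "nat \<Rightarrow> real^2 \<Rightarrow> real^2"
    and p :: "nat \<Rightarrow> real^2 \<Rightarrow> real"
    and q E :: "nat \<Rightarrow> real"
  assumes domain: "open \<Omega>" "connected \<Omega>" "\<Omega> \<noteq> {}" "bounded \<Omega>"
    and boundary: "C1_boundary \<Omega>"
    and normal: "\<And>x. x \<in> frontier \<Omega> \<Longrightarrow> outward_unit_normal \<Omega> x (\<n> x)"
    and parameters: "\<nu> > 0" "T > 0" "N \<ge> 1"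
    and time_step: "dt = T / real N"
    and times: "\<And>n. t n = real n * dt"
    and initial_data:
      "u 0 \<in> H2 \<Omega> \<inter> H10 \<Omega>" "AE x in lebesgue_on \<Omega>. divergence \<Omega> (u 0) x = 0" "p 0 \<in> H1 \<Omega>"
    and regularity:
      "\<And>n. n < N \<Longrightarrow> ut (Suc n) \<in> H2 \<Omega> \<inter> H10 \<Omega>"
      "\<And>n. n < N \<Longrightarrow> u (Suc n) \<in> H2 \<Omega>"
      "\<And>n. n < N \<Longrightarrow> p (Suc n) \<in> H1 \<Omega>"
    and momentum:
      "\<And>n. n < N \<Longrightarrow> AE x in lebesgue_on \<Omega>.
         (1 / dt) *\<^sub>R (ut (Suc n) x - u n x)
         + (q (Suc n) / exp (- t (Suc n) / T)) *\<^sub>R convect \<Omega> (u n) (u n) x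
         - \<nu> *\<^sub>R laplacian \<Omega> (ut (Suc n)) x
         + grad \<Omega> (p n) x = 0"
    and no_slip: "\<And>n. n < N \<Longrightarrow> has_trace \<Omega> (ut (Suc n)) (\<lambda>_. 0)"
    and projection:
      "\<And>n. n < N \<Longrightarrow> AE x in lebesgue_on \<Omega>.
         (1 / dt) *\<^sub>R (u (Suc n) x - ut (Suc n) x)
         + grad \<Omega> (\<lambda>y. p (Suc n) y - p n y) x = 0"
    and incompressible:
      "\<And>n. n < N \<Longrightarrow> AE x in lebesgue_on \<Omega>. divergence \<Omega> (u (Suc n)) x = 0"
    and no_penetration:
      "\<And>n. n < N \<Longrightarrow> \<exists>b. has_trace \<Omega> (u (Suc n)) b \<and> (\<forall>x\<in>frontier \<Omega>. b x \<bullet> \<n> x = 0)"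
    and auxiliary:
      "\<And>n. n < N \<Longrightarrow>
         (q (Suc n) - q n) / dt
         = - (1 / T) * q (Suc n)
           + 1 / exp (- t (Suc n) / T) * L2_inner \<Omega> (convect \<Omega> (u n) (u n)) (ut (Suc n))"
    and energy:
      "\<And>n. E n = (L2_norm \<Omega> (u n))\<^sup>2 + \<bar>q n\<bar>\<^sup>2 + dt\<^sup>2 * (L2_norm \<Omega> (grad \<Omega> (p n)))\<^sup>2"
  shows "\<forall>n<N. E (Suc n) - E n \<le> - 2 * \<nu> * dt * (L2_norm \<Omega> (vgrad \<Omega> (ut (Suc n))))\<^sup>2"
proof (intro allI impI)
  fix n assume n: "n < N"
  define w where "w = ut (Suc n)"
  define P where "P = grad \<Omega> (p n)"
  define P' where "P' = grad \<Omega> (p (Suc n))"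
  define c where "c = q (Suc n) / exp (- t (Suc n) / T)"
  define NL where "NL = convect \<Omega> (u n) (u n)"
  have dt: "dt > 0" using parameters time_step by simp
  have uH: "u n \<in> H2 \<Omega>" using initial_data(1) regularity(2)[of "n - 1"] n by (cases n) auto
  have uH': "u (Suc n) \<in> H2 \<Omega>" by (rule regularity(2)[OF n])
  have wH: "w \<in> H2 \<Omega>" "w \<in> H10 \<Omega>" using regularity(1)[OF n] by (auto simp: w_def)
  have pH: "p n \<in> H1 \<Omega>" using initial_data(3) regularity(3)[of "n - 1"] n by (cases n) auto
  have pH': "p (Suc n) \<in> H1 \<Omega>" by (rule regularity(3)[OF n])
  have L: "u n \<in> L2 \<Omega>" "u (Suc n) \<in> L2 \<Omega>" "w \<in> L2 \<Omega>" "P \<in> L2 \<Omega>" "P' \<in> L2 \<Omega>" "laplacian \<Omega> w \<in> L2 \<Omega>"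
    unfolding P_def P'_def
    by (intro H1_L2(1) H2_H1(1) uH uH' wH grad_L2 pH pH' laplacian_L2)+
  note Lc = L2_add L2_diff L2_scaleR L
  have orth: "L2_inner \<Omega> P' (u (Suc n)) = 0"
  proof -
    obtain b where b: "has_trace \<Omega> (u (Suc n)) b" "\<And>x. x \<in> frontier \<Omega> \<Longrightarrow> b x \<bullet> \<n> x = 0"
      using no_penetration[OF n] by blast
    show ?thesis unfolding P'_def
      by (rule gradient_orthogonal_to_solenoidal[OF domain(1,4) boundary normal H2_H1(1)[OF uH'] incompressible[OF n] b pH'])
  qed
  have green: "L2_inner \<Omega> (laplacian \<Omega> w) w = - (L2_norm \<Omega> (vgrad \<Omega> w))\<^sup>2"
    by (rule L2_inner_laplacian[OF domain(1) wH])
  \<comment> \<open>The equation itself shows that \<open>c *\<^sub>R NL\<close> is square integrable, whether or not \<open>NL\<close> is.\<close>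
  have mom: "c * L2_inner \<Omega> NL w = \<nu> * L2_inner \<Omega> (laplacian \<Omega> w) w - (1 / dt) * (L2_inner \<Omega> w w - L2_inner \<Omega> (u n) w) - L2_inner \<Omega> P w"
  proof -
    define R where "R x = \<nu> *\<^sub>R laplacian \<Omega> w x - (1 / dt) *\<^sub>R (w x - u n x) - P x" for x
    have RL: "R \<in> L2 \<Omega>" unfolding R_def by (intro Lc)
    have AE: "AE x in lebesgue_on \<Omega>. c *\<^sub>R NL x = R x"
      using momentum[OF n]
      by eventually_elim (simp add: R_def c_def NL_def w_def P_def algebra_simps add_eq_0_iff)
    have "c * L2_inner \<Omega> NL w = (LINT x|lebesgue_on \<Omega>. (c *\<^sub>R NL x) \<bullet> w x)"
      by (simp add: L2_inner_def)
    also have "\<dots> = L2_inner \<Omega> R w"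
    proof -
      have m: "R \<in> borel_measurable (lebesgue_on \<Omega>)" "w \<in> borel_measurable (lebesgue_on \<Omega>)"
        using RL L(3) by (auto simp: L2_def)
      have m': "NL \<in> borel_measurable (lebesgue_on \<Omega>)"
        unfolding NL_def by (rule convect_measurable[OF L(1) H2_H1(1)[OF uH]])
      show ?thesis unfolding L2_inner_def
      proof (rule integral_cong_AE)
        show "AE x in lebesgue_on \<Omega>. (c *\<^sub>R NL x) \<bullet> w x = R x \<bullet> w x"
          using AE by eventually_elim (simp only:)
      qed (use m m' in auto)
    qed
    also have "\<dots> = \<nu> * L2_inner \<Omega> (laplacian \<Omega> w) w - (1 / dt) * (L2_inner \<Omega> w w - L2_inner \<Omega> (u n) w) - L2_inner \<Omega> P w"
    proof -
      have "L2_inner \<Omega> R w = L2_inner \<Omega> (\<lambda>x. \<nu> *\<^sub>R laplacian \<Omega> w x - (1 / dt) *\<^sub>R (w x - u n x)) w - L2_inner \<Omega> P w"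
        unfolding R_def by (intro L2_inner_diff_left Lc)
      also have "L2_inner \<Omega> (\<lambda>x. \<nu> *\<^sub>R laplacian \<Omega> w x - (1 / dt) *\<^sub>R (w x - u n x)) w
          = L2_inner \<Omega> (\<lambda>x. \<nu> *\<^sub>R laplacian \<Omega> w x) w - L2_inner \<Omega> (\<lambda>x. (1 / dt) *\<^sub>R (w x - u n x)) w"
        by (intro L2_inner_diff_left Lc)
      also have "L2_inner \<Omega> (\<lambda>x. (1 / dt) *\<^sub>R (w x - u n x)) w = (1 / dt) * (L2_inner \<Omega> w w - L2_inner \<Omega> (u n) w)"
        unfolding L2_inner_scaleR_left by (subst L2_inner_diff_left) (intro Lc refl)+
      finally show ?thesis by (simp only: L2_inner_scaleR_left)
    qed
    finally show ?thesis .
  qed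
  \<comment> \<open>Squaring \<open>u (Suc n) + dt P' = w + dt P\<close> leaves only the cross term on the right, by orthogonality.\<close>
  have proj: "L2_inner \<Omega> (u (Suc n)) (u (Suc n)) + dt\<^sup>2 * L2_inner \<Omega> P' P'
      = L2_inner \<Omega> w w + 2 * dt * L2_inner \<Omega> P w + dt\<^sup>2 * L2_inner \<Omega> P P"
  proof -
    have AE: "AE x in lebesgue_on \<Omega>. u (Suc n) x + dt *\<^sub>R P' x = w x + dt *\<^sub>R P x"
      using projection[OF n] grad_diff[OF domain(1) pH' pH]
    proof eventually_elim
      case (elim x)
      then have "dt *\<^sub>R ((1 / dt) *\<^sub>R (u (Suc n) x - w x) + (P' x - P x)) = 0"
        by (simp add: w_def P_def P'_def)
      then have "(u (Suc n) x - w x) + dt *\<^sub>R (P' x - P x) = 0"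
        using dt by (simp add: scaleR_add_right)
      then show ?case by (simp add: algebra_simps add_eq_0_iff)
    qed
    have sq: "L2_inner \<Omega> (\<lambda>x. f x + dt *\<^sub>R g x) (\<lambda>x. f x + dt *\<^sub>R g x)
        = L2_inner \<Omega> f f + 2 * dt * L2_inner \<Omega> g f + dt\<^sup>2 * L2_inner \<Omega> g g"
      if "f \<in> L2 \<Omega>" "g \<in> L2 \<Omega>" for f g :: "real^2 \<Rightarrow> real^2"
    proof -
      have "(\<lambda>x. dt *\<^sub>R g x) \<in> L2 \<Omega>" by (rule L2_scaleR[OF that(2)])
      moreover from this have "(\<lambda>x. f x + dt *\<^sub>R g x) \<in> L2 \<Omega>" by (rule L2_add[OF that(1)])
      ultimately show ?thesis using that
        by (simp add: L2_inner_add_left L2_inner_add_right L2_inner_scaleR_left L2_inner_scaleR_right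
            L2_inner_commute[of \<Omega> f g] power2_eq_square algebra_simps)
    qed
    have "L2_inner \<Omega> (\<lambda>x. u (Suc n) x + dt *\<^sub>R P' x) (\<lambda>x. u (Suc n) x + dt *\<^sub>R P' x)
        = L2_inner \<Omega> (\<lambda>x. w x + dt *\<^sub>R P x) (\<lambda>x. w x + dt *\<^sub>R P x)"
      by (intro L2_inner_cong_AE AE Lc)
    then show ?thesis by (simp add: sq L orth)
  qed
  \<comment> \<open>The equation for \<open>q\<close>, multiplied by the new value of \<open>q\<close>, produces the same convective term.\<close>
  have aux: "q (Suc n) * (q (Suc n) - q n) = - (dt / T) * (q (Suc n))\<^sup>2 + dt * (c * L2_inner \<Omega> NL w)"
  proof -
    have "q (Suc n) - q n = dt * (- (1 / T) * q (Suc n) + 1 / exp (- t (Suc n) / T) * L2_inner \<Omega> NL w)"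
      using auxiliary[OF n] dt by (simp add: NL_def w_def field_simps)
    then have "q (Suc n) * (q (Suc n) - q n)
        = q (Suc n) * (dt * (- (1 / T) * q (Suc n) + 1 / exp (- t (Suc n) / T) * L2_inner \<Omega> NL w))" by (simp only:)
    also have "\<dots> = - (dt / T) * (q (Suc n))\<^sup>2 + dt * (c * L2_inner \<Omega> NL w)"
      by (simp add: c_def power2_eq_square algebra_simps)
    finally show ?thesis .
  qed
  have pos: "0 \<le> L2_inner \<Omega> w w - 2 * L2_inner \<Omega> (u n) w + L2_inner \<Omega> (u n) (u n)"
  proof -
    define d where "d x = w x - u n x" for x
    have dL: "d \<in> L2 \<Omega>" unfolding d_def by (rule L2_diff[OF L(3,1)])
    have left: "L2_inner \<Omega> d f = L2_inner \<Omega> w f - L2_inner \<Omega> (u n) f" if "f \<in> L2 \<Omega>" for f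
      unfolding d_def by (rule L2_inner_diff_left[OF L(3,1) that])
    have "L2_inner \<Omega> d d = L2_inner \<Omega> d w - L2_inner \<Omega> d (u n)"
      unfolding left[OF dL] by (simp only: L2_inner_commute[of \<Omega> w d] L2_inner_commute[of \<Omega> "u n" d])
    also have "\<dots> = L2_inner \<Omega> w w - 2 * L2_inner \<Omega> (u n) w + L2_inner \<Omega> (u n) (u n)"
      using L2_inner_commute[of \<Omega> w "u n"] by (simp add: left L)
    finally have "L2_inner \<Omega> w w - 2 * L2_inner \<Omega> (u n) w + L2_inner \<Omega> (u n) (u n) = (L2_norm \<Omega> d)\<^sup>2"
      by (simp add: L2_norm_power2)
    then show ?thesis by simp
  qed
  define a where "a = L2_inner \<Omega> w w"
  define b where "b = L2_inner \<Omega> (u n) w"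
  define k where "k = L2_inner \<Omega> P w"
  define v where "v = (L2_norm \<Omega> (vgrad \<Omega> w))\<^sup>2"
  have dmom: "dt * (c * L2_inner \<Omega> NL w) = - \<nu> * dt * v - (a - b) - dt * k"
    unfolding mom green using dt by (simp add: a_def b_def k_def v_def field_simps)
  have "E (Suc n) - E n = a + 2 * dt * k - L2_inner \<Omega> (u n) (u n) + (q (Suc n))\<^sup>2 - (q n)\<^sup>2"
    using proj by (simp add: energy L2_norm_power2 P_def[symmetric] P'_def[symmetric] a_def k_def)
  also have "\<dots> = - (a - 2 * b + L2_inner \<Omega> (u n) (u n)) - 2 * \<nu> * dt * v
      - (q (Suc n) - q n)\<^sup>2 - 2 * (dt / T) * (q (Suc n))\<^sup>2"
  proof -
    have "2 * dt * k = - 2 * \<nu> * dt * v - 2 * (a - b) - 2 * (q (Suc n) * (q (Suc n) - q n)) - 2 * (dt / T) * (q (Suc n))\<^sup>2"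
      using aux dmom by simp
    then show ?thesis by (simp add: power2_eq_square algebra_simps)
  qed
  also have "\<dots> \<le> - 2 * \<nu> * dt * v"
  proof -
    have "0 \<le> (q (Suc n) - q n)\<^sup>2" "0 \<le> 2 * (dt / T) * (q (Suc n))\<^sup>2" using dt parameters(2) by auto
    with pos show ?thesis unfolding a_def b_def by linarith
  qed
  finally show "E (Suc n) - E n \<le> - 2 * \<nu> * dt * (L2_norm \<Omega> (vgrad \<Omega> (ut (Suc n))))\<^sup>2"
    by (simp add: v_def w_def)
qed

end
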